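(* Let $k$ be a field, let $L/k$ be a finite abelian (Galois) extension with $G:=\mathrm{Gal}(L/k)$, and let $\mathrm{Fun}(\mathbb{Z}/2\mathbb{Z}\ltimes G,k)$ be the $k$-Hopf algebra of functions on $\mathbb{Z}/2\mathbb{Z}\ltimes G$ with values in $k$, where $\mathbb{Z}/2\mathbb{Z}$ acts on $G$ by inversion. Then there exists a commutative semisimple Hopf algebra $H$ over $k$ of dimension $2[L:k]$ which satisfies the following: (1) $L$ is a homomorphic image (as a $k$-algebra) of $H$. (2) $H\otimes_k L\cong \mathrm{Fun}(\mathbb{Z}/2\mathbb{Z}\ltimes G,k)\otimes_k L\cong \mathrm{Fun}(\mathbb{Z}/2\mathbb{Z}\ltimes G,L)$ as Hopf algebras over $L$. In particular, $H$ is a $k$-form of $\mathrm{Fun}(\mathbb{Z}/2\mathbb{Z}\ltimes G,k)$.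
   Context: For a finite group $\Gamma$ and a field $F$, $\mathrm{Fun}(\Gamma,F)$ is the Hopf algebra of $F$-valued functions on $\Gamma$, i.e. the dual Hopf algebra of the group algebra $F\Gamma$. A Hopf algebra is called semisimple if it is semisimple as an algebra. A $k$-Hopf algebra $H$ is a $k$-form of a $k$-Hopf algebra $H'$ if the two become isomorphic as Hopf algebras after extension of scalars to some field extension of $k$. *)

theory Defs
  imports "HOL-Algebra.Algebra" "Jordan_Normal_Form.Missing_VectorSpace"
begin

section \<open>Tensor products of modules\<close>

text \<open>
  The type \<open>('a, 'b) module\<close> carries ring operations on the module as well. They are irrelevant
  for plain modules and are used as soon as the module is an algebra.
\<close>

definition free_module :: "('a, 'm) ring_scheme \<Rightarrow> 'p set \<Rightarrow> ('a, 'p \<Rightarrow> 'a) module" where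
  "free_module R A =
     \<lparr>carrier = {u. (\<forall>p\<in>A. u p \<in> carrier R) \<and> (\<forall>p. p \<notin> A \<longrightarrow> u p = \<zero>\<^bsub>R\<^esub>)
                    \<and> finite {p. u p \<noteq> \<zero>\<^bsub>R\<^esub>}},
      monoid.mult = undefined, monoid.one = undefined,
      ring.zero = (\<lambda>_. \<zero>\<^bsub>R\<^esub>), ring.add = (\<lambda>u v p. u p \<oplus>\<^bsub>R\<^esub> v p),
      smult = (\<lambda>r u p. r \<otimes>\<^bsub>R\<^esub> u p)\<rparr>"

definition free_gen :: "('a, 'm) ring_scheme \<Rightarrow> 'p \<Rightarrow> 'p \<Rightarrow> 'a" where
  "free_gen R p = (\<lambda>q. if q = p then \<one>\<^bsub>R\<^esub> else \<zero>\<^bsub>R\<^esub>)"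

definition quotient_module :: "('a, 'b, 'x) module_scheme \<Rightarrow> 'b set \<Rightarrow> ('a, 'b set) module" where
  "quotient_module F I =
     \<lparr>carrier = (\<lambda>u. I +>\<^bsub>F\<^esub> u) ` carrier F,
      monoid.mult = undefined, monoid.one = undefined,
      ring.zero = I, ring.add = set_add F,
      smult = (\<lambda>r U. \<Union>u\<in>U. I +>\<^bsub>F\<^esub> (r \<odot>\<^bsub>F\<^esub> u))\<rparr>"

definition tensor_rels ::
  "('a, 'm) ring_scheme \<Rightarrow> ('a, 'b, 'x) module_scheme \<Rightarrow> ('a, 'c, 'y) module_scheme
     \<Rightarrow> ('b \<times> 'c \<Rightarrow> 'a) set" where
  "tensor_rels R M N =
     (let F = free_module R (carrier M \<times> carrier N); e = (\<lambda>m n. free_gen R (m, n)) in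
        {e (m \<oplus>\<^bsub>M\<^esub> m') n \<ominus>\<^bsub>F\<^esub> (e m n \<oplus>\<^bsub>F\<^esub> e m' n) | m m' n.
            m \<in> carrier M \<and> m' \<in> carrier M \<and> n \<in> carrier N}
      \<union> {e m (n \<oplus>\<^bsub>N\<^esub> n') \<ominus>\<^bsub>F\<^esub> (e m n \<oplus>\<^bsub>F\<^esub> e m n') | m n n'.
            m \<in> carrier M \<and> n \<in> carrier N \<and> n' \<in> carrier N}
      \<union> {e (r \<odot>\<^bsub>M\<^esub> m) n \<ominus>\<^bsub>F\<^esub> (r \<odot>\<^bsub>F\<^esub> e m n) | r m n.
            r \<in> carrier R \<and> m \<in> carrier M \<and> n \<in> carrier N}
      \<union> {e m (r \<odot>\<^bsub>N\<^esub> n) \<ominus>\<^bsub>F\<^esub> (r \<odot>\<^bsub>F\<^esub> e m n) | r m n.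
            r \<in> carrier R \<and> m \<in> carrier M \<and> n \<in> carrier N})"

definition tensor_kernel ::
  "('a, 'm) ring_scheme \<Rightarrow> ('a, 'b, 'x) module_scheme \<Rightarrow> ('a, 'c, 'y) module_scheme
     \<Rightarrow> ('b \<times> 'c \<Rightarrow> 'a) set" where
  "tensor_kernel R M N =
     module.span R (free_module R (carrier M \<times> carrier N)) (tensor_rels R M N)"

definition tensor_module ::
  "('a, 'm) ring_scheme \<Rightarrow> ('a, 'b, 'x) module_scheme \<Rightarrow> ('a, 'c, 'y) module_scheme
     \<Rightarrow> ('a, ('b \<times> 'c \<Rightarrow> 'a) set) module" where
  "tensor_module R M N =
     quotient_module (free_module R (carrier M \<times> carrier N)) (tensor_kernel R M N)"

definition pure_tensor ::
  "('a, 'm) ring_scheme \<Rightarrow> ('a, 'b, 'x) module_scheme \<Rightarrow> ('a, 'c, 'y) module_scheme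
     \<Rightarrow> 'b \<Rightarrow> 'c \<Rightarrow> ('b \<times> 'c \<Rightarrow> 'a) set" where
  "pure_tensor R M N m n =
     tensor_kernel R M N +>\<^bsub>free_module R (carrier M \<times> carrier N)\<^esub> free_gen R (m, n)"

text \<open>
  \<open>tensor_lift R P f\<close> is the linear map out of a tensor product over \<open>R\<close> which sends \<open>m \<otimes> n\<close> to
  \<open>f m n\<close>. It is meaningful when \<open>f\<close> is bilinear into \<open>P\<close>, since then all representatives of a coset
  give the same value. Only scalars from \<open>R\<close> are used, so \<open>P\<close> may be a module over a larger ring.
\<close>

definition tensor_lift ::
  "('a, 'm) ring_scheme \<Rightarrow> ('a, 'd, 'z) module_scheme \<Rightarrow> ('b \<Rightarrow> 'c \<Rightarrow> 'd)
     \<Rightarrow> ('b \<times> 'c \<Rightarrow> 'a) set \<Rightarrow> 'd" where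
  "tensor_lift R P f U =
     the_elem ((\<lambda>u. \<Oplus>\<^bsub>P\<^esub>p\<in>{p. u p \<noteq> \<zero>\<^bsub>R\<^esub>}. u p \<odot>\<^bsub>P\<^esub> f (fst p) (snd p)) ` U)"

definition tensor_map ::
  "('a, 'm) ring_scheme \<Rightarrow> ('a, 'd, 'x) module_scheme \<Rightarrow> ('a, 'e, 'y) module_scheme
     \<Rightarrow> ('b \<Rightarrow> 'd) \<Rightarrow> ('c \<Rightarrow> 'e) \<Rightarrow> ('b \<times> 'c \<Rightarrow> 'a) set \<Rightarrow> ('d \<times> 'e \<Rightarrow> 'a) set" where
  "tensor_map R M' N' f g =
     tensor_lift R (tensor_module R M' N') (\<lambda>m n. pure_tensor R M' N' (f m) (g n))"

text \<open>The associativity isomorphism from \<open>(M \<otimes> N) \<otimes> P\<close> to \<open>M \<otimes> (N \<otimes> P)\<close>.\<close>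

definition tensor_assoc ::
  "('a, 'm) ring_scheme \<Rightarrow> ('a, 'b, 'x) module_scheme \<Rightarrow> ('a, 'c, 'y) module_scheme
     \<Rightarrow> ('a, 'd, 'z) module_scheme
     \<Rightarrow> (('b \<times> 'c \<Rightarrow> 'a) set \<times> 'd \<Rightarrow> 'a) set \<Rightarrow> ('b \<times> ('c \<times> 'd \<Rightarrow> 'a) set \<Rightarrow> 'a) set" where
  "tensor_assoc R M N P =
     (let NP = tensor_module R N P; T = tensor_module R M NP in
        tensor_lift R T (\<lambda>x p.
          tensor_lift R T (\<lambda>m n. pure_tensor R M NP m (pure_tensor R N P n p)) x))"

definition tensor_algebra ::
  "('a, 'm) ring_scheme \<Rightarrow> ('a, 'b, 'x) module_scheme \<Rightarrow> ('a, 'c, 'y) module_scheme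
     \<Rightarrow> ('a, ('b \<times> 'c \<Rightarrow> 'a) set) module" where
  "tensor_algebra R A B =
     (let T = tensor_module R A B in
        T\<lparr>monoid.mult := (\<lambda>U V. tensor_lift R T (\<lambda>a b.
             tensor_lift R T (\<lambda>c d. pure_tensor R A B (a \<otimes>\<^bsub>A\<^esub> c) (b \<otimes>\<^bsub>B\<^esub> d)) V) U),
          monoid.one := pure_tensor R A B \<one>\<^bsub>A\<^esub> \<one>\<^bsub>B\<^esub>\<rparr>)"


section \<open>Algebras and Hopf algebras\<close>

text \<open>The library locale \<open>algebra\<close> is restricted to commutative algebras.\<close>

locale assoc_algebra = module R A + ring A for R and A (structure) +
  assumes smult_mult_left:
      "\<lbrakk>r \<in> carrier R; x \<in> carrier A; y \<in> carrier A\<rbrakk> \<Longrightarrow> (r \<odot> x) \<otimes> y = r \<odot> (x \<otimes> y)"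
    and smult_mult_right:
      "\<lbrakk>r \<in> carrier R; x \<in> carrier A; y \<in> carrier A\<rbrakk> \<Longrightarrow> x \<otimes> (r \<odot> y) = r \<odot> (x \<otimes> y)"

definition algebra_hom ::
  "('a, 'm) ring_scheme \<Rightarrow> ('a, 'b, 'x) module_scheme \<Rightarrow> ('a, 'c, 'y) module_scheme
     \<Rightarrow> ('b \<Rightarrow> 'c) set" where
  "algebra_hom R A B = ring_hom A B \<inter> module_hom R A B"

text \<open>A ring as an algebra over itself, or over any subring.\<close>

definition self_algebra :: "('a, 'm) ring_scheme \<Rightarrow> ('a, 'a) module" where
  "self_algebra R =
     \<lparr>carrier = carrier R, monoid.mult = monoid.mult R, monoid.one = monoid.one R,
      ring.zero = ring.zero R, ring.add = ring.add R, smult = monoid.mult R\<rparr>"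

record ('a, 'h) hopf = "('a, 'h) module" +
  comult :: "'h \<Rightarrow> ('h \<times> 'h \<Rightarrow> 'a) set"
  counit :: "'h \<Rightarrow> 'a"
  antipode :: "'h \<Rightarrow> 'h"

locale hopf_algebra = assoc_algebra R H
  for R and H :: "('a, 'h, 'x) hopf_scheme" (structure) +
  assumes comult_hom: "comult H \<in> algebra_hom R H (tensor_algebra R H H)"
    and counit_hom: "counit H \<in> algebra_hom R H (self_algebra R)"
    and coassoc: "h \<in> carrier H \<Longrightarrow>
        tensor_assoc R H H H (tensor_map R (tensor_module R H H) H (comult H) id (comult H h))
          = tensor_map R H (tensor_module R H H) id (comult H) (comult H h)"
    and counit_left: "h \<in> carrier H \<Longrightarrow>
        tensor_lift R H (\<lambda>a b. counit H a \<odot> b) (comult H h) = h"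
    and counit_right: "h \<in> carrier H \<Longrightarrow>
        tensor_lift R H (\<lambda>a b. counit H b \<odot> a) (comult H h) = h"
    and antipode_linear: "antipode H \<in> module_hom R H H"
    and antipode_left: "h \<in> carrier H \<Longrightarrow>
        tensor_lift R H (\<lambda>a b. antipode H a \<otimes> b) (comult H h) = counit H h \<odot> \<one>"
    and antipode_right: "h \<in> carrier H \<Longrightarrow>
        tensor_lift R H (\<lambda>a b. a \<otimes> antipode H b) (comult H h) = counit H h \<odot> \<one>"

definition hopf_hom ::
  "('a, 'm) ring_scheme \<Rightarrow> ('a, 'h, 'x) hopf_scheme \<Rightarrow> ('a, 'g, 'y) hopf_scheme
     \<Rightarrow> ('h \<Rightarrow> 'g) set" where
  "hopf_hom R H H' =
     {f \<in> algebra_hom R H H'. \<forall>h\<in>carrier H.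
        comult H' (f h) = tensor_map R H' H' f f (comult H h)
        \<and> counit H' (f h) = counit H h
        \<and> antipode H' (f h) = f (antipode H h)}"

definition hopf_isomorphic ::
  "('a, 'm) ring_scheme \<Rightarrow> ('a, 'h, 'x) hopf_scheme \<Rightarrow> ('a, 'g, 'y) hopf_scheme \<Rightarrow> bool" where
  "hopf_isomorphic R H H' \<longleftrightarrow> (\<exists>f\<in>hopf_hom R H H'. bij_betw f (carrier H) (carrier H'))"

definition left_ideal :: "'b set \<Rightarrow> ('b, 'm) ring_scheme \<Rightarrow> bool" where
  "left_ideal I A \<longleftrightarrow>
     additive_subgroup I A \<and> (\<forall>a\<in>carrier A. \<forall>x\<in>I. a \<otimes>\<^bsub>A\<^esub> x \<in> I)"

definition simple_left_ideal :: "'b set \<Rightarrow> ('b, 'm) ring_scheme \<Rightarrow> bool" where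
  "simple_left_ideal S A \<longleftrightarrow>
     left_ideal S A \<and> S \<noteq> {\<zero>\<^bsub>A\<^esub>} \<and>
     (\<forall>I. left_ideal I A \<and> I \<subseteq> S \<longrightarrow> I = {\<zero>\<^bsub>A\<^esub>} \<or> I = S)"

text \<open>
  A ring is semisimple if its left regular module is a direct sum of simple submodules. The family
  may be taken to be finite, since the unit lies in a finite partial sum. For a unital algebra
  the left ideals are automatically linear subspaces.
\<close>

definition semisimple_ring :: "('b, 'm) ring_scheme \<Rightarrow> bool" where
  "semisimple_ring A \<longleftrightarrow>
     (\<exists>\<S>. finite \<S> \<and> (\<forall>S\<in>\<S>. simple_left_ideal S A) \<and>
          (\<forall>x\<in>carrier A. \<exists>!f. f \<in> (\<Pi>\<^sub>E S\<in>\<S>. S) \<and> x = (\<Oplus>\<^bsub>A\<^esub>S\<in>\<S>. f S)))"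


section \<open>Field extensions, extension of scalars and forms\<close>

definition field_extension :: "'a ring \<Rightarrow> 'a ring \<Rightarrow> bool" where
  "field_extension k L \<longleftrightarrow>
     field L \<and> subfield (carrier k) L \<and> k = L\<lparr>carrier := carrier k\<rparr>"

definition finite_extension :: "'a ring \<Rightarrow> 'a ring \<Rightarrow> bool" where
  "finite_extension k L \<longleftrightarrow> field_extension k L \<and> vectorspace.fin_dim k (self_algebra L)"

definition ext_degree :: "'a ring \<Rightarrow> 'a ring \<Rightarrow> nat" where
  "ext_degree k L = vectorspace.dim k (self_algebra L)"

definition Gal :: "'a ring \<Rightarrow> 'a ring \<Rightarrow> ('a \<Rightarrow> 'a) monoid" where
  "Gal k L = BijGroup (carrier L)
     \<lparr>carrier := {\<sigma> \<in> Bij (carrier L). \<sigma> \<in> ring_hom L L \<and> (\<forall>x\<in>carrier k. \<sigma> x = x)}\<rparr>"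

text \<open>A finite extension is Galois if the fixed field of its automorphism group is the base field.\<close>

definition finite_galois_extension :: "'a ring \<Rightarrow> 'a ring \<Rightarrow> bool" where
  "finite_galois_extension k L \<longleftrightarrow>
     finite_extension k L \<and>
     {x \<in> carrier L. \<forall>\<sigma>\<in>carrier (Gal k L). \<sigma> x = x} = carrier k"

text \<open>
  The \<open>L\<close>-Hopf algebra \<open>H \<otimes>\<^sub>k L\<close>. Its comultiplication sends \<open>h \<otimes> l\<close> to the sum of the
  \<open>(h\<^sub>1 \<otimes> 1) \<otimes>\<^sub>L (h\<^sub>2 \<otimes> l)\<close>.
\<close>

definition base_change_algebra ::
  "'a ring \<Rightarrow> 'a ring \<Rightarrow> ('a, 'h, 'x) module_scheme \<Rightarrow> ('a, ('h \<times> 'a \<Rightarrow> 'a) set) module" where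
  "base_change_algebra k L A =
     (tensor_algebra k A (self_algebra L))
       \<lparr>smult := (\<lambda>c. tensor_lift k (tensor_module k A (self_algebra L))
          (\<lambda>a l. pure_tensor k A (self_algebra L) a (c \<otimes>\<^bsub>L\<^esub> l)))\<rparr>"

definition base_change ::
  "'a ring \<Rightarrow> 'a ring \<Rightarrow> ('a, 'h, 'x) hopf_scheme \<Rightarrow> ('a, ('h \<times> 'a \<Rightarrow> 'a) set) hopf" where
  "base_change k L H =
     (let B = base_change_algebra k L H;
          BB = tensor_module L B B;
          pt = pure_tensor k H (self_algebra L) in
        module.extend B (hopf.fields
          (tensor_lift k BB (\<lambda>h l.
             tensor_lift k BB (\<lambda>h1 h2. pure_tensor L B B (pt h1 \<one>\<^bsub>L\<^esub>) (pt h2 l)) (comult H h)))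
          (tensor_lift k (self_algebra L) (\<lambda>h l. counit H h \<otimes>\<^bsub>L\<^esub> l))
          (tensor_map k H (self_algebra L) (antipode H) id)))"

text \<open>
  HOL cannot quantify over types, so the extension field is sought among the rings on the type of
  elements of \<open>k\<close>. That type may be larger than the carrier of \<open>k\<close>.
\<close>

definition is_form_of ::
  "'a ring \<Rightarrow> ('a, 'h, 'x) hopf_scheme \<Rightarrow> ('a, 'g, 'y) hopf_scheme \<Rightarrow> bool" where
  "is_form_of k H H' \<longleftrightarrow>
     (\<exists>F. field_extension k F \<and> hopf_isomorphic F (base_change k F H) (base_change k F H'))"


section \<open>Functions on a finite group\<close>

definition fun_algebra ::
  "('g, 'n) monoid_scheme \<Rightarrow> ('a, 'm) ring_scheme \<Rightarrow> ('a, 'g \<Rightarrow> 'a) module" where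
  "fun_algebra \<Gamma> R =
     \<lparr>carrier = carrier \<Gamma> \<rightarrow>\<^sub>E carrier R,
      monoid.mult = (\<lambda>f g. \<lambda>x\<in>carrier \<Gamma>. f x \<otimes>\<^bsub>R\<^esub> g x),
      monoid.one = (\<lambda>x\<in>carrier \<Gamma>. \<one>\<^bsub>R\<^esub>),
      ring.zero = (\<lambda>x\<in>carrier \<Gamma>. \<zero>\<^bsub>R\<^esub>),
      ring.add = (\<lambda>f g. \<lambda>x\<in>carrier \<Gamma>. f x \<oplus>\<^bsub>R\<^esub> g x),
      smult = (\<lambda>r f. \<lambda>x\<in>carrier \<Gamma>. r \<otimes>\<^bsub>R\<^esub> f x)\<rparr>"

definition point_fun ::
  "('g, 'n) monoid_scheme \<Rightarrow> ('a, 'm) ring_scheme \<Rightarrow> 'g \<Rightarrow> 'g \<Rightarrow> 'a" where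
  "point_fun \<Gamma> R x = (\<lambda>y\<in>carrier \<Gamma>. if y = x then \<one>\<^bsub>R\<^esub> else \<zero>\<^bsub>R\<^esub>)"

text \<open>
  \<open>Fun(\<Gamma>, R)\<close> for finite \<open>\<Gamma>\<close>. Under the identification of \<open>Fun(\<Gamma>, R) \<otimes> Fun(\<Gamma>, R)\<close> with
  \<open>Fun(\<Gamma> \<times> \<Gamma>, R)\<close>, the comultiplication of \<open>f\<close> is the function \<open>(x, y) \<mapsto> f (x y)\<close>, which is
  expanded here in the basis of tensors of point functions.
\<close>

definition fun_hopf ::
  "('g, 'n) monoid_scheme \<Rightarrow> ('a, 'm) ring_scheme \<Rightarrow> ('a, 'g \<Rightarrow> 'a) hopf" where
  "fun_hopf \<Gamma> R =
     (let A = fun_algebra \<Gamma> R; T = tensor_module R A A in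
        module.extend A (hopf.fields
          (\<lambda>f. \<Oplus>\<^bsub>T\<^esub>p\<in>carrier \<Gamma> \<times> carrier \<Gamma>.
             f (fst p \<otimes>\<^bsub>\<Gamma>\<^esub> snd p) \<odot>\<^bsub>T\<^esub>
               pure_tensor R A A (point_fun \<Gamma> R (fst p)) (point_fun \<Gamma> R (snd p)))
          (\<lambda>f. f \<one>\<^bsub>\<Gamma>\<^esub>)
          (\<lambda>f. \<lambda>x\<in>carrier \<Gamma>. f (inv\<^bsub>\<Gamma>\<^esub> x))))"

text \<open>
  \<open>Q \<ltimes> N\<close> for an action \<open>\<phi>\<close> of \<open>Q\<close> on \<open>N\<close>. The pair \<open>(a, g)\<close> stands for the product \<open>a g\<close>,
  and \<open>b g b\<inverse>\<close> is \<open>\<phi> b g\<close>.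
\<close>

definition semidirect_product ::
  "('q, 'm) monoid_scheme \<Rightarrow> ('g, 'n) monoid_scheme \<Rightarrow> ('q \<Rightarrow> 'g \<Rightarrow> 'g) \<Rightarrow> ('q \<times> 'g) monoid" where
  "semidirect_product Q N \<phi> =
     \<lparr>carrier = carrier Q \<times> carrier N,
      monoid.mult = (\<lambda>(a, g) (b, h). (a \<otimes>\<^bsub>Q\<^esub> b, \<phi> (inv\<^bsub>Q\<^esub> b) g \<otimes>\<^bsub>N\<^esub> h)),
      monoid.one = (\<one>\<^bsub>Q\<^esub>, \<one>\<^bsub>N\<^esub>)\<rparr>"

definition inversion_semidirect :: "('g, 'n) monoid_scheme \<Rightarrow> (int \<times> 'g) monoid" where
  "inversion_semidirect G =
     semidirect_product (integer_mod_group 2) G (\<lambda>a g. if a = 0 then g else inv\<^bsub>G\<^esub> g)"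

end

theory Submission
  imports Defs
begin

text \<open>
  Let \<open>G\<close> be the Galois group and \<open>\<Gamma>\<close> the semidirect product of \<open>\<int>/2\<close> with \<open>G\<close>. The Hopf algebra \<open>H\<close>
  consists of the functions \<open>\<Gamma> \<rightarrow> L\<close> which are equivariant for a twisted action of \<open>G\<close> on \<open>\<Gamma>\<close>: an
  element \<open>\<tau>\<close> of \<open>G\<close> fixes the subgroup \<open>G\<close> of \<open>\<Gamma>\<close> and moves \<open>(1, \<sigma>)\<close> to \<open>(1, \<tau> \<sigma>)\<close>. This is an
  action by automorphisms of \<open>\<Gamma>\<close>. The product of \<open>(1, \<sigma>)\<close> and \<open>(1, \<rho>)\<close> is \<open>(0, \<sigma>\<inverse> \<rho>)\<close>, which does not
  change when \<open>\<sigma>\<close> and \<open>\<rho>\<close> are multiplied by \<open>\<tau>\<close> from the left; the product of \<open>(0, \<sigma>)\<close> and \<open>(1, \<rho>)\<close>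
  is \<open>(1, \<sigma>\<inverse> \<rho>)\<close>, and here the commutativity of \<open>G\<close> enters. Hence equivariance is preserved by all
  operations of \<open>Fun(\<Gamma>, L)\<close>, and \<open>H\<close> is a descent of \<open>Fun(\<Gamma>, L)\<close> to \<open>k\<close>.

  On the subgroup \<open>G\<close> an equivariant function takes arbitrary values in \<open>k\<close>. On the other coset it is
  determined by its value at \<open>(1, 1)\<close>, which may be any element of \<open>L\<close>. As an algebra \<open>H\<close> is thus
  \<open>k\<^sup>G \<times> L\<close>, which is commutative and semisimple, has \<open>L\<close> as a quotient, and has dimension
  \<open>|G| + [L : k] = 2 [L : k]\<close>.

  Descent is made explicit by two families \<open>h\<close> and \<open>c\<close> of functions on \<open>\<Gamma>\<close>, indexed by \<open>\<Gamma>\<close>, with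
  \<open>\<Sum>\<^sub>i h\<^sub>i(x) c\<^sub>i(y) = \<delta>\<^sub>x\<^sub>y\<close>. Every function \<open>f : \<Gamma> \<rightarrow> L\<close> is then the sum of the \<open>h\<^sub>i\<close> with coefficients
  \<open>\<Sum>\<^sub>y c\<^sub>i(y) f(y)\<close>. If \<open>f\<close> and \<open>c\<^sub>i\<close> are equivariant, this coefficient is fixed by \<open>G\<close> and so lies in \<open>k\<close>.
  For \<open>Fun(\<Gamma>, k)\<close> the point functions serve as both families. For \<open>H\<close> the families are built from
  elements \<open>z\<^sub>\<rho>\<close> and \<open>b\<^sub>\<rho>\<close> of \<open>L\<close> with \<open>\<Sum>\<^sub>\<rho> \<sigma>(z\<^sub>\<rho>) \<tau>(b\<^sub>\<rho>) = \<delta>\<^sub>\<sigma>\<^sub>\<tau>\<close> (lemma \<open>galois_dual_bases\<close>). The locale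
  \<open>function_form\<close> covers both cases, and the Hopf algebra structure and its behaviour under extension
  of scalars are treated there once.

  The expansion in the \<open>h\<^sub>i\<close> shows that a tensor is determined by the values of its coordinates (lemma
  \<open>tensor_separation\<close>). Elements of \<open>H \<otimes> H\<close> may therefore be regarded as functions on \<open>\<Gamma> \<times> \<Gamma>\<close>, elements
  of \<open>H \<otimes> H \<otimes> H\<close> as functions of three variables, and elements of \<open>H \<otimes> L\<close> as functions \<open>\<Gamma> \<rightarrow> L\<close>. The
  comultiplication sends \<open>f\<close> to \<open>(x, y) \<mapsto> f(x y)\<close>, and the Hopf algebra axioms become the group axioms
  of \<open>\<Gamma>\<close>. The map \<open>f \<otimes> l \<mapsto> (x \<mapsto> f(x) l)\<close> is an isomorphism from \<open>H \<otimes> L\<close> onto \<open>Fun(\<Gamma>, L)\<close>. The same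
  holds for \<open>Fun(\<Gamma>, k)\<close> in place of \<open>H\<close>, and the two are compared through this common target.
\<close>

section \<open>Linear maps and quotient modules\<close>

lemma module_hom_mem: "f \<in> module_hom R M N \<Longrightarrow> x \<in> carrier M \<Longrightarrow> f x \<in> carrier N"
  by (auto simp: module_hom_def)

lemma module_homI:
  assumes "\<And>x. x \<in> carrier M \<Longrightarrow> f x \<in> carrier N"
    and "\<And>x y. x \<in> carrier M \<Longrightarrow> y \<in> carrier M \<Longrightarrow> f (x \<oplus>\<^bsub>M\<^esub> y) = f x \<oplus>\<^bsub>N\<^esub> f y"
    and "\<And>r x. r \<in> carrier R \<Longrightarrow> x \<in> carrier M \<Longrightarrow> f (r \<odot>\<^bsub>M\<^esub> x) = r \<odot>\<^bsub>N\<^esub> f x"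
  shows "f \<in> module_hom R M N"
  using assms by (auto simp: module_hom_def)

lemma module_hom_id: "id \<in> module_hom R M M"
  by (auto simp: module_hom_def)

lemma module_hom_zero:
  assumes "module R M" "module R P" "f \<in> module_hom R M P"
  shows "f \<zero>\<^bsub>M\<^esub> = \<zero>\<^bsub>P\<^esub>"
proof -
  interpret mod_hom R M P f using assms by (simp add: mod_hom_def mod_hom_axioms_def)
  show ?thesis by simp
qed

lemma module_hom_finsum:
  assumes "module R M" "module R P" "f \<in> module_hom R M P" "g \<in> I \<rightarrow> carrier M"
  shows "f (\<Oplus>\<^bsub>M\<^esub>i\<in>I. g i) = (\<Oplus>\<^bsub>P\<^esub>i\<in>I. f (g i))"
proof -
  interpret mod_hom R M P f using assms(1-3) by (simp add: mod_hom_def mod_hom_axioms_def)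
  show ?thesis using assms(4)
  proof (induct I rule: infinite_finite_induct)
    case (insert a A)
    then have g: "g a \<in> carrier M" "g \<in> A \<rightarrow> carrier M" by auto
    then have "f (finsum M g (insert a A)) = f (g a) \<oplus>\<^bsub>P\<^esub> f (finsum M g A)"
      using insert.hyps by simp
    also have "\<dots> = (\<Oplus>\<^bsub>P\<^esub>i\<in>insert a A. f (g i))"
      using insert g by (subst N.M.finsum_insert) (auto simp: Pi_def)
    finally show ?case .
  qed auto
qed

lemma free_module_sel [simp]:
  "carrier (free_module R A) = {u. (\<forall>p\<in>A. u p \<in> carrier R) \<and> (\<forall>p. p \<notin> A \<longrightarrow> u p = \<zero>\<^bsub>R\<^esub>)
                    \<and> finite {p. u p \<noteq> \<zero>\<^bsub>R\<^esub>}}"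
  "\<zero>\<^bsub>free_module R A\<^esub> = (\<lambda>_. \<zero>\<^bsub>R\<^esub>)"
  "u \<oplus>\<^bsub>free_module R A\<^esub> v = (\<lambda>p. u p \<oplus>\<^bsub>R\<^esub> v p)"
  "r \<odot>\<^bsub>free_module R A\<^esub> u = (\<lambda>p. r \<otimes>\<^bsub>R\<^esub> u p)"
  by (simp_all add: free_module_def)

lemma free_module_val:
  assumes "cring R" "u \<in> carrier (free_module R A)"
  shows "u p \<in> carrier R"
proof -
  interpret cring R by fact
  show ?thesis using assms(2) by (cases "p \<in> A") auto
qed

lemma free_module_module:
  fixes A :: "'p set"
  assumes "cring R"
  shows "module R (free_module R A)"
proof -
  interpret cring R by fact
  have val: "u p \<in> carrier R" if "u \<in> carrier (free_module R A)" for u p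
    using free_module_val[OF assms that] .
  have sup_add: "finite {p. u p \<oplus>\<^bsub>R\<^esub> v p \<noteq> \<zero>\<^bsub>R\<^esub>}"
    if "finite {p. u p \<noteq> \<zero>\<^bsub>R\<^esub>}" "finite {p. v p \<noteq> \<zero>\<^bsub>R\<^esub>}" for u v :: "'p \<Rightarrow> 'a"
    by (rule finite_subset[of _ "{p. u p \<noteq> \<zero>\<^bsub>R\<^esub>} \<union> {p. v p \<noteq> \<zero>\<^bsub>R\<^esub>}"]) (use that in auto)
  have sup_smult: "finite {p. r \<otimes>\<^bsub>R\<^esub> u p \<noteq> \<zero>\<^bsub>R\<^esub>}"
    if "finite {p. u p \<noteq> \<zero>\<^bsub>R\<^esub>}" "r \<in> carrier R" for r and u :: "'p \<Rightarrow> 'a"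
    by (rule finite_subset[of _ "{p. u p \<noteq> \<zero>\<^bsub>R\<^esub>}"]) (use that in auto)
  have neg: "\<exists>w\<in>carrier (free_module R A). u \<oplus>\<^bsub>free_module R A\<^esub> w = \<zero>\<^bsub>free_module R A\<^esub>"
    if u: "u \<in> carrier (free_module R A)" for u
  proof (rule bexI[of _ "\<lambda>p. \<ominus>\<^bsub>R\<^esub> u p"])
    show "(\<lambda>p. \<ominus>\<^bsub>R\<^esub> u p) \<in> carrier (free_module R A)"
      using u by (auto elim!: finite_subset[rotated])
    show "u \<oplus>\<^bsub>free_module R A\<^esub> (\<lambda>p. \<ominus>\<^bsub>R\<^esub> u p) = \<zero>\<^bsub>free_module R A\<^esub>"
      using val[OF u] by (auto simp: r_neg)
  qed
  have car: "u \<oplus>\<^bsub>free_module R A\<^esub> v \<in> carrier (free_module R A)"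
      "r \<odot>\<^bsub>free_module R A\<^esub> u \<in> carrier (free_module R A)"
    if "u \<in> carrier (free_module R A)" "v \<in> carrier (free_module R A)" "r \<in> carrier R" for u v r
    using that by (auto simp: sup_add sup_smult)
  have zero: "(\<lambda>_. \<zero>\<^bsub>R\<^esub>) \<in> carrier (free_module R A)" by auto
  show ?thesis
  proof (rule module_criteria)
    show "\<forall>v\<in>carrier (free_module R A). \<exists>w\<in>carrier (free_module R A).
        v \<oplus>\<^bsub>free_module R A\<^esub> w = \<zero>\<^bsub>free_module R A\<^esub>"
      using neg by blast
    show "\<forall>v w. v \<in> carrier (free_module R A) \<and> w \<in> carrier (free_module R A) \<longrightarrow>
        v \<oplus>\<^bsub>free_module R A\<^esub> w \<in> carrier (free_module R A)"
      using car(1) by blast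
    show "\<forall>c v. c \<in> carrier R \<and> v \<in> carrier (free_module R A) \<longrightarrow>
        c \<odot>\<^bsub>free_module R A\<^esub> v \<in> carrier (free_module R A)"
      using car(2) by blast
  qed (use zero assms in \<open>auto simp: val a_ac m_assoc l_distr r_distr intro!: ext
         simp del: free_module_sel(1)\<close>)
qed

lemma free_gen_carrier:
  assumes "cring R" "p \<in> A"
  shows "free_gen R p \<in> carrier (free_module R A)"
proof -
  interpret cring R by fact
  have "{q. free_gen R p q \<noteq> \<zero>\<^bsub>R\<^esub>} \<subseteq> {p}" by (auto simp: free_gen_def)
  then have "finite {q. free_gen R p q \<noteq> \<zero>\<^bsub>R\<^esub>}" by (rule finite_subset) simp
  then show ?thesis using assms(2) by (auto simp: free_gen_def)
qed

lemma free_module_induct [consumes 2, case_names zero step]: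
  assumes "cring R" "u \<in> carrier (free_module R A)"
    and "Q \<zero>\<^bsub>free_module R A\<^esub>"
    and step: "\<And>u r p. u \<in> carrier (free_module R A) \<Longrightarrow> r \<in> carrier R \<Longrightarrow> p \<in> A \<Longrightarrow> Q u \<Longrightarrow>
      Q ((r \<odot>\<^bsub>free_module R A\<^esub> free_gen R p) \<oplus>\<^bsub>free_module R A\<^esub> u)"
  shows "Q u"
proof -
  interpret cring R by fact
  define S where "S = {p. u p \<noteq> \<zero>\<^bsub>R\<^esub>}"
  have "finite S" using assms(2) by (simp add: S_def)
  then show ?thesis using assms(2) S_def
  proof (induction S arbitrary: u rule: finite_induct)
    case empty
    then have "u = \<zero>\<^bsub>free_module R A\<^esub>" by auto
    then show ?case using assms(3) by simp
  next
    case (insert p S)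
    define v where "v = u(p := \<zero>\<^bsub>R\<^esub>)"
    have supp: "S = {q. v q \<noteq> \<zero>\<^bsub>R\<^esub>}" using insert by (auto simp: v_def)
    have p: "p \<in> A" "u p \<in> carrier R" using insert.prems by auto
    have v: "v \<in> carrier (free_module R A)"
      using insert.prems insert.hyps supp by (auto simp: v_def)
    have "u = (u p \<odot>\<^bsub>free_module R A\<^esub> free_gen R p) \<oplus>\<^bsub>free_module R A\<^esub> v"
      using free_module_val[OF assms(1) insert.prems(1)] by (auto simp: v_def free_gen_def)
    then show ?case using step[OF v p(2,1) insert.IH[OF v supp]] by simp
  qed
qed

text \<open>
  The sum of two cosets is their elementwise sum, and a multiple of a coset is a union over all of its
  representatives. The formulas below therefore express that the choice of representatives does not
  matter.
\<close>

lemma quotient_module_facts: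
  assumes F: "module R F" and K: "submodule R K F"
  shows quotient_module_add: "\<And>u v. u \<in> carrier F \<Longrightarrow> v \<in> carrier F \<Longrightarrow>
      (K +>\<^bsub>F\<^esub> u) \<oplus>\<^bsub>quotient_module F K\<^esub> (K +>\<^bsub>F\<^esub> v) = K +>\<^bsub>F\<^esub> (u \<oplus>\<^bsub>F\<^esub> v)"
    and quotient_module_smult: "\<And>r u. r \<in> carrier R \<Longrightarrow> u \<in> carrier F \<Longrightarrow>
      r \<odot>\<^bsub>quotient_module F K\<^esub> (K +>\<^bsub>F\<^esub> u) = K +>\<^bsub>F\<^esub> (r \<odot>\<^bsub>F\<^esub> u)"
    and quotient_module_zero: "\<zero>\<^bsub>quotient_module F K\<^esub> = K +>\<^bsub>F\<^esub> \<zero>\<^bsub>F\<^esub>"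
    and quotient_module_module: "module R (quotient_module F K)"
    and quotient_module_coset_mem: "\<And>u v. u \<in> carrier F \<Longrightarrow> v \<in> K +>\<^bsub>F\<^esub> u \<Longrightarrow>
      v \<in> carrier F \<and> v \<ominus>\<^bsub>F\<^esub> u \<in> K"
    and quotient_module_coset_eq: "\<And>u v. u \<in> carrier F \<Longrightarrow> v \<in> carrier F \<Longrightarrow> v \<ominus>\<^bsub>F\<^esub> u \<in> K \<Longrightarrow>
      K +>\<^bsub>F\<^esub> v = K +>\<^bsub>F\<^esub> u"
    and quotient_module_coset_self: "\<And>u. u \<in> carrier F \<Longrightarrow> u \<in> K +>\<^bsub>F\<^esub> u"
    and quotient_module_coset_zero: "\<And>u. u \<in> carrier F \<Longrightarrow> u \<in> K \<Longrightarrow>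
      K +>\<^bsub>F\<^esub> u = \<zero>\<^bsub>quotient_module F K\<^esub>"
proof -
  interpret F: module R F by fact
  interpret K: submodule R K F by fact
  have neg: "\<ominus>\<^bsub>F\<^esub> x \<in> K" if "x \<in> K" for x
    using that K.smult_closed[of "\<ominus>\<^bsub>R\<^esub> \<one>\<^bsub>R\<^esub>" x] K.subset
    by (metis F.R.add.inv_closed F.R.one_closed F.smult_minus_1 subsetD)
  have "subgroup K (add_monoid F)"
    using K.subset neg by (intro F.add.subgroupI) (auto simp: a_inv_def intro: K.zero_closed)
  then have "additive_subgroup K F" by (rule additive_subgroupI)
  then interpret A: abelian_subgroup K F by (rule abelian_subgroupI3) (rule F.abelian_group_axioms)
  have zero: "\<zero>\<^bsub>quotient_module F K\<^esub> = K +>\<^bsub>F\<^esub> \<zero>\<^bsub>F\<^esub>"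
    using K.subset by (auto simp: quotient_module_def a_r_coset_def' subset_iff)
  show "\<zero>\<^bsub>quotient_module F K\<^esub> = K +>\<^bsub>F\<^esub> \<zero>\<^bsub>F\<^esub>" by (rule zero)
  have add: "(K +>\<^bsub>F\<^esub> u) \<oplus>\<^bsub>quotient_module F K\<^esub> (K +>\<^bsub>F\<^esub> v) = K +>\<^bsub>F\<^esub> (u \<oplus>\<^bsub>F\<^esub> v)"
    if "u \<in> carrier F" "v \<in> carrier F" for u v
    using A.a_rcos_sum[OF that] by (simp add: quotient_module_def)
  then show "\<And>u v. u \<in> carrier F \<Longrightarrow> v \<in> carrier F \<Longrightarrow>
      (K +>\<^bsub>F\<^esub> u) \<oplus>\<^bsub>quotient_module F K\<^esub> (K +>\<^bsub>F\<^esub> v) = K +>\<^bsub>F\<^esub> (u \<oplus>\<^bsub>F\<^esub> v)" .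
  have self: "u \<in> K +>\<^bsub>F\<^esub> u" if "u \<in> carrier F" for u using A.a_rcos_self[OF that] .
  then show "\<And>u. u \<in> carrier F \<Longrightarrow> u \<in> K +>\<^bsub>F\<^esub> u" .
  have mem: "v \<in> carrier F \<and> v \<ominus>\<^bsub>F\<^esub> u \<in> K" if "u \<in> carrier F" and v: "v \<in> K +>\<^bsub>F\<^esub> u" for u v
  proof -
    obtain z where "z \<in> K" "v = z \<oplus>\<^bsub>F\<^esub> u" using v by (auto simp: a_r_coset_def')
    moreover have "z \<in> carrier F" using \<open>z \<in> K\<close> K.subset by auto
    ultimately show ?thesis using that(1)
      by (simp add: a_minus_def F.M.a_assoc F.M.r_neg)
  qed
  then show "\<And>u v. u \<in> carrier F \<Longrightarrow> v \<in> K +>\<^bsub>F\<^esub> u \<Longrightarrow> v \<in> carrier F \<and> v \<ominus>\<^bsub>F\<^esub> u \<in> K" .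
  have coset0: "K +>\<^bsub>F\<^esub> u = K" if "u \<in> K" for u using A.a_rcos_const[OF that] .
  then show "\<And>u. u \<in> carrier F \<Longrightarrow> u \<in> K \<Longrightarrow> K +>\<^bsub>F\<^esub> u = \<zero>\<^bsub>quotient_module F K\<^esub>"
    by (simp add: quotient_module_def)
  have cong: "K +>\<^bsub>F\<^esub> v = K +>\<^bsub>F\<^esub> u" if "u \<in> carrier F" "v \<in> carrier F" "v \<ominus>\<^bsub>F\<^esub> u \<in> K" for u v
  proof -
    have "v = (v \<ominus>\<^bsub>F\<^esub> u) \<oplus>\<^bsub>F\<^esub> u" using that by (simp add: a_minus_def F.M.a_assoc F.M.l_neg)
    then have "v \<in> K +>\<^bsub>F\<^esub> u" using that(3) by (auto simp: a_r_coset_def')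
    then show ?thesis using A.a_repr_independence'[OF _ that(1)] by metis
  qed
  then show "\<And>u v. u \<in> carrier F \<Longrightarrow> v \<in> carrier F \<Longrightarrow> v \<ominus>\<^bsub>F\<^esub> u \<in> K \<Longrightarrow>
      K +>\<^bsub>F\<^esub> v = K +>\<^bsub>F\<^esub> u" .
  have smult: "r \<odot>\<^bsub>quotient_module F K\<^esub> (K +>\<^bsub>F\<^esub> u) = K +>\<^bsub>F\<^esub> (r \<odot>\<^bsub>F\<^esub> u)"
    if r: "r \<in> carrier R" and u: "u \<in> carrier F" for r u
  proof -
    have "K +>\<^bsub>F\<^esub> (r \<odot>\<^bsub>F\<^esub> v) = K +>\<^bsub>F\<^esub> (r \<odot>\<^bsub>F\<^esub> u)" if "v \<in> K +>\<^bsub>F\<^esub> u" for v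
    proof (rule cong)
      have v: "v \<in> carrier F" "v \<ominus>\<^bsub>F\<^esub> u \<in> K" using mem[OF u that] by auto
      have "(r \<odot>\<^bsub>F\<^esub> v) \<ominus>\<^bsub>F\<^esub> (r \<odot>\<^bsub>F\<^esub> u) = r \<odot>\<^bsub>F\<^esub> (v \<ominus>\<^bsub>F\<^esub> u)"
        using r u v(1) by (simp add: a_minus_def F.smult_r_distr F.smult_r_minus)
      then show "(r \<odot>\<^bsub>F\<^esub> v) \<ominus>\<^bsub>F\<^esub> (r \<odot>\<^bsub>F\<^esub> u) \<in> K" using r v(2) by simp
      show "r \<odot>\<^bsub>F\<^esub> u \<in> carrier F" "r \<odot>\<^bsub>F\<^esub> v \<in> carrier F" using r u v by auto
    qed
    then have "(\<Union>v\<in>K +>\<^bsub>F\<^esub> u. K +>\<^bsub>F\<^esub> (r \<odot>\<^bsub>F\<^esub> v)) = (\<Union>v\<in>K +>\<^bsub>F\<^esub> u. K +>\<^bsub>F\<^esub> (r \<odot>\<^bsub>F\<^esub> u))"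
      by (intro SUP_cong refl)
    also have "\<dots> = K +>\<^bsub>F\<^esub> (r \<odot>\<^bsub>F\<^esub> u)" using self[OF u] by blast
    finally show ?thesis by (simp add: quotient_module_def)
  qed
  then show "\<And>r u. r \<in> carrier R \<Longrightarrow> u \<in> carrier F \<Longrightarrow>
      r \<odot>\<^bsub>quotient_module F K\<^esub> (K +>\<^bsub>F\<^esub> u) = K +>\<^bsub>F\<^esub> (r \<odot>\<^bsub>F\<^esub> u)" .
  have car: "carrier (quotient_module F K) = (\<lambda>u. K +>\<^bsub>F\<^esub> u) ` carrier F"
    by (simp add: quotient_module_def)
  show "module R (quotient_module F K)"
  proof (rule module_criteria)
    show "\<forall>v\<in>carrier (quotient_module F K). \<exists>neg_v\<in>carrier (quotient_module F K).
        v \<oplus>\<^bsub>quotient_module F K\<^esub> neg_v = \<zero>\<^bsub>quotient_module F K\<^esub>"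
    proof
      fix v assume "v \<in> carrier (quotient_module F K)"
      then obtain u where u: "u \<in> carrier F" "v = K +>\<^bsub>F\<^esub> u" by (auto simp: car)
      then show "\<exists>neg_v\<in>carrier (quotient_module F K).
        v \<oplus>\<^bsub>quotient_module F K\<^esub> neg_v = \<zero>\<^bsub>quotient_module F K\<^esub>"
        by (intro bexI[of _ "K +>\<^bsub>F\<^esub> (\<ominus>\<^bsub>F\<^esub> u)"]) (auto simp: car zero add F.M.r_neg)
    qed
  qed (unfold car ball_simps, auto simp: zero add smult F.M.a_ac F.smult_l_distr F.smult_r_distr
        F.smult_assoc1 F.R.cring_axioms)
qed

declare free_module_sel [simp del]

section \<open>The universal property of the tensor product\<close>

definition bilinear_map ::
  "('a, 'm) ring_scheme \<Rightarrow> ('a, 'b, 'x) module_scheme \<Rightarrow> ('a, 'c, 'y) module_scheme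
     \<Rightarrow> ('a, 'd, 'z) module_scheme \<Rightarrow> ('b \<Rightarrow> 'c \<Rightarrow> 'd) \<Rightarrow> bool" where
  "bilinear_map R M N P f \<longleftrightarrow>
     (\<forall>n\<in>carrier N. (\<lambda>m. f m n) \<in> module_hom R M P) \<and>
     (\<forall>m\<in>carrier M. f m \<in> module_hom R N P)"

lemma bilinear_mapI:
  assumes "\<And>m n. m \<in> carrier M \<Longrightarrow> n \<in> carrier N \<Longrightarrow> f m n \<in> carrier P"
    and "\<And>m m' n. m \<in> carrier M \<Longrightarrow> m' \<in> carrier M \<Longrightarrow> n \<in> carrier N \<Longrightarrow>
      f (m \<oplus>\<^bsub>M\<^esub> m') n = f m n \<oplus>\<^bsub>P\<^esub> f m' n"
    and "\<And>m n n'. m \<in> carrier M \<Longrightarrow> n \<in> carrier N \<Longrightarrow> n' \<in> carrier N \<Longrightarrow>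
      f m (n \<oplus>\<^bsub>N\<^esub> n') = f m n \<oplus>\<^bsub>P\<^esub> f m n'"
    and "\<And>r m n. r \<in> carrier R \<Longrightarrow> m \<in> carrier M \<Longrightarrow> n \<in> carrier N \<Longrightarrow>
      f (r \<odot>\<^bsub>M\<^esub> m) n = r \<odot>\<^bsub>P\<^esub> f m n"
    and "\<And>r m n. r \<in> carrier R \<Longrightarrow> m \<in> carrier M \<Longrightarrow> n \<in> carrier N \<Longrightarrow>
      f m (r \<odot>\<^bsub>N\<^esub> n) = r \<odot>\<^bsub>P\<^esub> f m n"
  shows "bilinear_map R M N P f"
  using assms by (simp add: bilinear_map_def module_hom_def)

lemma bilinear_mapD:
  assumes "bilinear_map R M N P f"
  shows "\<And>m n. m \<in> carrier M \<Longrightarrow> n \<in> carrier N \<Longrightarrow> f m n \<in> carrier P"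
    and "\<And>m m' n. m \<in> carrier M \<Longrightarrow> m' \<in> carrier M \<Longrightarrow> n \<in> carrier N \<Longrightarrow>
      f (m \<oplus>\<^bsub>M\<^esub> m') n = f m n \<oplus>\<^bsub>P\<^esub> f m' n"
    and "\<And>m n n'. m \<in> carrier M \<Longrightarrow> n \<in> carrier N \<Longrightarrow> n' \<in> carrier N \<Longrightarrow>
      f m (n \<oplus>\<^bsub>N\<^esub> n') = f m n \<oplus>\<^bsub>P\<^esub> f m n'"
    and "\<And>r m n. r \<in> carrier R \<Longrightarrow> m \<in> carrier M \<Longrightarrow> n \<in> carrier N \<Longrightarrow>
      f (r \<odot>\<^bsub>M\<^esub> m) n = r \<odot>\<^bsub>P\<^esub> f m n"
    and "\<And>r m n. r \<in> carrier R \<Longrightarrow> m \<in> carrier M \<Longrightarrow> n \<in> carrier N \<Longrightarrow>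
      f m (r \<odot>\<^bsub>N\<^esub> n) = r \<odot>\<^bsub>P\<^esub> f m n"
  using assms by (auto simp: bilinear_map_def module_hom_def Pi_def)

context
  fixes R :: "('a, 'm) ring_scheme" and M :: "('a, 'b, 'x) module_scheme"
    and N :: "('a, 'c, 'y) module_scheme"
  assumes M: "module R M" and N: "module R N"
begin

interpretation M: module R M by (rule M)
interpretation N: module R N by (rule N)
interpretation F: module R "free_module R (carrier M \<times> carrier N)"
  by (rule free_module_module) (rule M.R.cring_axioms)

lemma tensor_gen_carrier:
  "m \<in> carrier M \<Longrightarrow> n \<in> carrier N \<Longrightarrow>
     free_gen R (m, n) \<in> carrier (free_module R (carrier M \<times> carrier N))"
  by (rule free_gen_carrier) (auto intro: M.R.cring_axioms)

lemma tensor_rels_subset: "tensor_rels R M N \<subseteq> carrier (free_module R (carrier M \<times> carrier N))"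
  unfolding tensor_rels_def Let_def
  by (safe; intro F.M.minus_closed F.M.a_closed F.smult_closed tensor_gen_carrier
       M.M.a_closed N.M.a_closed M.smult_closed N.smult_closed; assumption)

lemma tensor_kernel_submodule:
  "submodule R (tensor_kernel R M N) (free_module R (carrier M \<times> carrier N))"
  unfolding tensor_kernel_def by (rule F.span_is_submodule) (rule tensor_rels_subset)

lemma tensor_rels_kernel: "x \<in> tensor_rels R M N \<Longrightarrow> x \<in> tensor_kernel R M N"
  unfolding tensor_kernel_def using F.in_own_span[OF tensor_rels_subset] by blast

lemmas quotient_facts =
  quotient_module_facts[OF F.module_axioms tensor_kernel_submodule, folded tensor_module_def]

lemma tensor_module_module: "module R (tensor_module R M N)"
  by (rule quotient_facts)

lemma tensor_carrier_iff:
  "t \<in> carrier (tensor_module R M N) \<longleftrightarrow>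
     (\<exists>u\<in>carrier (free_module R (carrier M \<times> carrier N)).
        t = tensor_kernel R M N +>\<^bsub>free_module R (carrier M \<times> carrier N)\<^esub> u)"
  by (auto simp: tensor_module_def quotient_module_def)

text \<open>
  Each law of bilinearity is one of the families of relations that are divided out.
\<close>

lemma pure_tensor_bilinear:
  "bilinear_map R M N (tensor_module R M N) (pure_tensor R M N)"
proof (rule bilinear_mapI)
  let ?F = "free_module R (carrier M \<times> carrier N)"
  note e = tensor_gen_carrier
  show "\<And>m n. m \<in> carrier M \<Longrightarrow> n \<in> carrier N \<Longrightarrow>
      pure_tensor R M N m n \<in> carrier (tensor_module R M N)"
    using e by (auto simp: tensor_carrier_iff pure_tensor_def)
  let ?K = "tensor_kernel R M N"
  have rel: "?K +>\<^bsub>?F\<^esub> v = ?K +>\<^bsub>?F\<^esub> u"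
    if "u \<in> carrier ?F" "v \<in> carrier ?F" "v \<ominus>\<^bsub>?F\<^esub> u \<in> tensor_rels R M N" for u v
    by (rule quotient_facts(6)[OF that(1,2) tensor_rels_kernel[OF that(3)]])
  show "pure_tensor R M N (m \<oplus>\<^bsub>M\<^esub> m') n = pure_tensor R M N m n \<oplus>\<^bsub>tensor_module R M N\<^esub> pure_tensor R M N m' n"
    if that: "m \<in> carrier M" "m' \<in> carrier M" "n \<in> carrier N" for m m' n
  proof -
    have "?K +>\<^bsub>?F\<^esub> free_gen R (m \<oplus>\<^bsub>M\<^esub> m', n) = ?K +>\<^bsub>?F\<^esub> (free_gen R (m, n) \<oplus>\<^bsub>?F\<^esub> free_gen R (m', n))"
      by (rule rel; (intro F.M.a_closed F.smult_closed e M.M.a_closed N.M.a_closed M.smult_closed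
            N.smult_closed that)?)
        (use that in \<open>unfold tensor_rels_def Let_def, blast\<close>)
    also have "\<dots> = (?K +>\<^bsub>?F\<^esub> free_gen R (m, n)) \<oplus>\<^bsub>tensor_module R M N\<^esub> (?K +>\<^bsub>?F\<^esub> free_gen R (m', n))"
      by (rule quotient_facts(1)[symmetric]; intro e that)
    finally show ?thesis by (simp only: pure_tensor_def)
  qed
  show "pure_tensor R M N m (n \<oplus>\<^bsub>N\<^esub> n') = pure_tensor R M N m n \<oplus>\<^bsub>tensor_module R M N\<^esub> pure_tensor R M N m n'"
    if that: "m \<in> carrier M" "n \<in> carrier N" "n' \<in> carrier N" for m n n'
  proof -
    have "?K +>\<^bsub>?F\<^esub> free_gen R (m, n \<oplus>\<^bsub>N\<^esub> n') = ?K +>\<^bsub>?F\<^esub> (free_gen R (m, n) \<oplus>\<^bsub>?F\<^esub> free_gen R (m, n'))"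
      by (rule rel; (intro F.M.a_closed F.smult_closed e M.M.a_closed N.M.a_closed M.smult_closed
            N.smult_closed that)?)
        (use that in \<open>unfold tensor_rels_def Let_def, blast\<close>)
    also have "\<dots> = (?K +>\<^bsub>?F\<^esub> free_gen R (m, n)) \<oplus>\<^bsub>tensor_module R M N\<^esub> (?K +>\<^bsub>?F\<^esub> free_gen R (m, n'))"
      by (rule quotient_facts(1)[symmetric]; intro e that)
    finally show ?thesis by (simp only: pure_tensor_def)
  qed
  show "pure_tensor R M N (r \<odot>\<^bsub>M\<^esub> m) n = r \<odot>\<^bsub>tensor_module R M N\<^esub> pure_tensor R M N m n"
    if that: "r \<in> carrier R" "m \<in> carrier M" "n \<in> carrier N" for r m n
  proof -
    have "?K +>\<^bsub>?F\<^esub> free_gen R (r \<odot>\<^bsub>M\<^esub> m, n) = ?K +>\<^bsub>?F\<^esub> (r \<odot>\<^bsub>?F\<^esub> free_gen R (m, n))"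
      by (rule rel; (intro F.M.a_closed F.smult_closed e M.M.a_closed N.M.a_closed M.smult_closed
            N.smult_closed that)?)
        (use that in \<open>unfold tensor_rels_def Let_def, blast\<close>)
    also have "\<dots> = r \<odot>\<^bsub>tensor_module R M N\<^esub> (?K +>\<^bsub>?F\<^esub> free_gen R (m, n))"
      by (rule quotient_facts(2)[symmetric]; intro e that)
    finally show ?thesis by (simp only: pure_tensor_def)
  qed
  show "pure_tensor R M N m (r \<odot>\<^bsub>N\<^esub> n) = r \<odot>\<^bsub>tensor_module R M N\<^esub> pure_tensor R M N m n"
    if that: "r \<in> carrier R" "m \<in> carrier M" "n \<in> carrier N" for r m n
  proof -
    have "?K +>\<^bsub>?F\<^esub> free_gen R (m, r \<odot>\<^bsub>N\<^esub> n) = ?K +>\<^bsub>?F\<^esub> (r \<odot>\<^bsub>?F\<^esub> free_gen R (m, n))"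
      by (rule rel; (intro F.M.a_closed F.smult_closed e M.M.a_closed N.M.a_closed M.smult_closed
            N.smult_closed that)?)
        (use that in \<open>unfold tensor_rels_def Let_def, blast\<close>)
    also have "\<dots> = r \<odot>\<^bsub>tensor_module R M N\<^esub> (?K +>\<^bsub>?F\<^esub> free_gen R (m, n))"
      by (rule quotient_facts(2)[symmetric]; intro e that)
    finally show ?thesis by (simp only: pure_tensor_def)
  qed
qed

lemmas pure_tensor_closed = bilinear_mapD(1)[OF pure_tensor_bilinear]
lemmas pure_tensor_smult_left = bilinear_mapD(4)[OF pure_tensor_bilinear]

text \<open>
  A scalar in front of a pure tensor can be moved into the first factor, so that every tensor is a sum
  of pure tensors, and proofs by induction need no step for scalar multiples.
\<close>

lemma tensor_induct [consumes 1, case_names pure add]: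
  assumes t: "t \<in> carrier (tensor_module R M N)"
    and pure: "\<And>m n. m \<in> carrier M \<Longrightarrow> n \<in> carrier N \<Longrightarrow> Q (pure_tensor R M N m n)"
    and add: "\<And>s t. s \<in> carrier (tensor_module R M N) \<Longrightarrow> t \<in> carrier (tensor_module R M N) \<Longrightarrow>
      Q s \<Longrightarrow> Q t \<Longrightarrow> Q (s \<oplus>\<^bsub>tensor_module R M N\<^esub> t)"
  shows "Q t"
proof -
  let ?F = "free_module R (carrier M \<times> carrier N)"
  interpret T: module R "tensor_module R M N" by (rule tensor_module_module)
  obtain u where u: "u \<in> carrier ?F" and tu: "t = tensor_kernel R M N +>\<^bsub>?F\<^esub> u"
    using t unfolding tensor_carrier_iff by blast
  have "tensor_kernel R M N +>\<^bsub>?F\<^esub> u \<in> carrier (tensor_module R M N) \<and>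
    Q (tensor_kernel R M N +>\<^bsub>?F\<^esub> u)"
    using M.R.cring_axioms u
  proof (induction u rule: free_module_induct)
    case zero
    have "tensor_kernel R M N +>\<^bsub>?F\<^esub> \<zero>\<^bsub>?F\<^esub> = \<zero>\<^bsub>tensor_module R M N\<^esub>"
      by (rule quotient_facts(3)[symmetric])
    also have "\<dots> = \<zero>\<^bsub>R\<^esub> \<odot>\<^bsub>tensor_module R M N\<^esub> pure_tensor R M N \<zero>\<^bsub>M\<^esub> \<zero>\<^bsub>N\<^esub>"
      by (rule T.lmult_0[symmetric]) (simp add: pure_tensor_closed)
    also have "\<dots> = pure_tensor R M N (\<zero>\<^bsub>R\<^esub> \<odot>\<^bsub>M\<^esub> \<zero>\<^bsub>M\<^esub>) \<zero>\<^bsub>N\<^esub>"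
      by (rule pure_tensor_smult_left[symmetric]) auto
    finally show ?case using pure by (simp add: pure_tensor_closed)
  next
    case (step u r p)
    obtain m n where p: "p = (m, n)" "m \<in> carrier M" "n \<in> carrier N" using step.hyps by auto
    have e: "free_gen R (m, n) \<in> carrier ?F" using p by (simp only: tensor_gen_carrier)
    have "tensor_kernel R M N +>\<^bsub>?F\<^esub> ((r \<odot>\<^bsub>?F\<^esub> free_gen R p) \<oplus>\<^bsub>?F\<^esub> u) =
      (r \<odot>\<^bsub>tensor_module R M N\<^esub> pure_tensor R M N m n) \<oplus>\<^bsub>tensor_module R M N\<^esub>
        (tensor_kernel R M N +>\<^bsub>?F\<^esub> u)"
      unfolding p(1) pure_tensor_def using step.hyps e
      by (simp only: quotient_facts(1,2) F.smult_closed)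
    also have "\<dots> = pure_tensor R M N (r \<odot>\<^bsub>M\<^esub> m) n \<oplus>\<^bsub>tensor_module R M N\<^esub>
        (tensor_kernel R M N +>\<^bsub>?F\<^esub> u)"
      using step.hyps p by (simp only: pure_tensor_smult_left)
    finally show ?case using step p
      by (simp only:) (auto intro!: add pure pure_tensor_closed)
  qed
  then show ?thesis using tu by simp
qed

text \<open>
  A bilinear map extends linearly to the free module on pairs. The extension kills the relations,
  hence the submodule that they span, so it is constant on the cosets that make up the tensor
  product, and \<^const>\<open>tensor_lift\<close> reads off this constant.
\<close>

lemma tensor_lift_coset:
  assumes P: "module R P" and f: "bilinear_map R M N P f"
  obtains fl where "fl \<in> module_hom R (free_module R (carrier M \<times> carrier N)) P"
    and "\<And>m n. m \<in> carrier M \<Longrightarrow> n \<in> carrier N \<Longrightarrow> fl (free_gen R (m, n)) = f m n"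
    and "\<And>u. u \<in> carrier (free_module R (carrier M \<times> carrier N)) \<Longrightarrow> tensor_lift R P f
      (tensor_kernel R M N +>\<^bsub>free_module R (carrier M \<times> carrier N)\<^esub> u) = fl u"
proof -
  define F where "F = free_module R (carrier M \<times> carrier N)"
  define fl where "fl = (\<lambda>u. \<Oplus>\<^bsub>P\<^esub>p\<in>{p. u p \<noteq> \<zero>\<^bsub>R\<^esub>}. u p \<odot>\<^bsub>P\<^esub> f (fst p) (snd p))"
  interpret P: module R P by fact
  note f = bilinear_mapD[OF f]
  have ev: "fl u = (\<Oplus>\<^bsub>P\<^esub>p\<in>S. u p \<odot>\<^bsub>P\<^esub> f (fst p) (snd p))"
    and ev_closed: "(\<lambda>p. u p \<odot>\<^bsub>P\<^esub> f (fst p) (snd p)) \<in> S \<rightarrow> carrier P"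
    if "u \<in> carrier F" "finite S" "{p. u p \<noteq> \<zero>\<^bsub>R\<^esub>} \<subseteq> S" "S \<subseteq> carrier M \<times> carrier N" for u S
  proof -
    show "(\<lambda>p. u p \<odot>\<^bsub>P\<^esub> f (fst p) (snd p)) \<in> S \<rightarrow> carrier P"
      using that f(1) by (auto simp: F_def free_module_sel)
    then show "fl u = (\<Oplus>\<^bsub>P\<^esub>p\<in>S. u p \<odot>\<^bsub>P\<^esub> f (fst p) (snd p))"
      unfolding fl_def using that f(1)
      by (intro P.M.add.finprod_mono_neutral_cong_left) auto
  qed
  have supp: "{p. u p \<noteq> \<zero>\<^bsub>R\<^esub>} \<subseteq> carrier M \<times> carrier N" "finite {p. u p \<noteq> \<zero>\<^bsub>R\<^esub>}"
    if "u \<in> carrier F" for u using that by (auto simp: F_def free_module_sel)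
  have val: "u p \<in> carrier R" if "u \<in> carrier F" for u p
    by (rule free_module_val[OF M.R.cring_axioms that[unfolded F_def]])
  interpret G: module R F unfolding F_def by (rule F.module_axioms)
  have hom: "fl \<in> module_hom R F P"
  proof (rule module_homI)
    show "fl u \<in> carrier P" if "u \<in> carrier F" for u
      using ev[OF that supp(2)[OF that] order_refl supp(1)[OF that]]
        ev_closed[OF that supp(2)[OF that] order_refl supp(1)[OF that]]
      by (simp add: P.M.finsum_closed)
    show "fl (u \<oplus>\<^bsub>F\<^esub> v) = fl u \<oplus>\<^bsub>P\<^esub> fl v" if uv: "u \<in> carrier F" "v \<in> carrier F" for u v
    proof -
      define S where "S = {p. u p \<noteq> \<zero>\<^bsub>R\<^esub>} \<union> {p. v p \<noteq> \<zero>\<^bsub>R\<^esub>}"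
      have S: "finite S" "S \<subseteq> carrier M \<times> carrier N" using supp[OF uv(1)] supp[OF uv(2)]
        by (auto simp: S_def)
      have uvS: "{p. u p \<noteq> \<zero>\<^bsub>R\<^esub>} \<subseteq> S" "{p. v p \<noteq> \<zero>\<^bsub>R\<^esub>} \<subseteq> S" by (auto simp: S_def)
      have uvS': "{p. (u \<oplus>\<^bsub>F\<^esub> v) p \<noteq> \<zero>\<^bsub>R\<^esub>} \<subseteq> S" by (auto simp: S_def F_def free_module_sel(3))
      have uv': "u \<oplus>\<^bsub>F\<^esub> v \<in> carrier F" using uv by (rule G.M.a_closed)
      have "fl (u \<oplus>\<^bsub>F\<^esub> v) = (\<Oplus>\<^bsub>P\<^esub>p\<in>S. (u \<oplus>\<^bsub>F\<^esub> v) p \<odot>\<^bsub>P\<^esub> f (fst p) (snd p))"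
        by (rule ev[OF uv' S(1) uvS' S(2)])
      also have "\<dots> = (\<Oplus>\<^bsub>P\<^esub>p\<in>S. u p \<odot>\<^bsub>P\<^esub> f (fst p) (snd p) \<oplus>\<^bsub>P\<^esub> v p \<odot>\<^bsub>P\<^esub> f (fst p) (snd p))"
        using val uv S(2) f(1) by (intro P.M.finsum_cong')
          (auto simp: F_def P.smult_l_distr free_module_sel(3))
      also have "\<dots> = fl u \<oplus>\<^bsub>P\<^esub> fl v"
        using ev_closed[OF uv(1) S(1) uvS(1) S(2)] ev_closed[OF uv(2) S(1) uvS(2) S(2)]
        by (simp add: ev[OF uv(1) S(1) uvS(1) S(2)] ev[OF uv(2) S(1) uvS(2) S(2)] P.M.finsum_addf)
      finally show ?thesis .
    qed
    show "fl (r \<odot>\<^bsub>F\<^esub> u) = r \<odot>\<^bsub>P\<^esub> fl u" if r: "r \<in> carrier R" and u: "u \<in> carrier F" for r u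
    proof -
      let ?S = "{p. u p \<noteq> \<zero>\<^bsub>R\<^esub>}"
      have ru: "r \<odot>\<^bsub>F\<^esub> u \<in> carrier F" using r u by (rule G.smult_closed)
      have "{p. (r \<odot>\<^bsub>F\<^esub> u) p \<noteq> \<zero>\<^bsub>R\<^esub>} \<subseteq> ?S" using r by (auto simp: F_def free_module_sel(4))
      then have "fl (r \<odot>\<^bsub>F\<^esub> u) = (\<Oplus>\<^bsub>P\<^esub>p\<in>?S. (r \<odot>\<^bsub>F\<^esub> u) p \<odot>\<^bsub>P\<^esub> f (fst p) (snd p))"
        by (rule ev[OF ru supp(2)[OF u] _ supp(1)[OF u]])
      also have "\<dots> = (\<Oplus>\<^bsub>P\<^esub>p\<in>?S. r \<odot>\<^bsub>P\<^esub> (u p \<odot>\<^bsub>P\<^esub> f (fst p) (snd p)))"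
        using val u r supp(1)[OF u] f(1) by (intro P.M.finsum_cong')
          (auto simp: F_def P.smult_assoc1 free_module_sel(4))
      also have "\<dots> = r \<odot>\<^bsub>P\<^esub> fl u"
        unfolding fl_def using r ev_closed[OF u supp(2)[OF u] order_refl supp(1)[OF u]]
        by (simp add: P.finsum_smult)
      finally show ?thesis .
    qed
  qed
  have gen: "fl (free_gen R (m, n)) = f m n" if mn: "m \<in> carrier M" "n \<in> carrier N" for m n
  proof -
    have "fl (free_gen R (m, n)) = (\<Oplus>\<^bsub>P\<^esub>p\<in>{(m, n)}. free_gen R (m, n) p \<odot>\<^bsub>P\<^esub> f (fst p) (snd p))"
      by (rule ev) (use mn tensor_gen_carrier in \<open>auto simp: F_def free_gen_def\<close>)
    also have "\<dots> = f m n" using mn f(1) by (simp add: free_gen_def)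
    finally show ?thesis .
  qed
  interpret fl: mod_hom R F P fl
    by unfold_locales (rule hom)
  have "tensor_rels R M N \<subseteq> fl.ker"
  proof
    fix x assume x: "x \<in> tensor_rels R M N"
    have e: "\<And>m n. m \<in> carrier M \<Longrightarrow> n \<in> carrier N \<Longrightarrow> free_gen R (m, n) \<in> carrier F"
      unfolding F_def by (rule tensor_gen_carrier)
    have "fl x = \<zero>\<^bsub>P\<^esub>"
      using x unfolding tensor_rels_def Let_def F_def[symmetric]
      by (elim UnE; clarsimp simp: e gen f fl.f_minus fl.f_add fl.f_smult)
    moreover have "x \<in> carrier F" unfolding F_def using x tensor_rels_subset by (rule rev_subsetD)
    ultimately show "x \<in> fl.ker" by (simp add: fl.ker_def)
  qed
  then have ker: "tensor_kernel R M N \<subseteq> fl.ker"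
    unfolding tensor_kernel_def F_def[symmetric] by (rule G.span_is_subset) (rule fl.ker_is_submodule)
  have lift: "tensor_lift R P f (tensor_kernel R M N +>\<^bsub>F\<^esub> u) = fl u" if u: "u \<in> carrier F" for u
  proof -
    have eq: "fl v = fl u" if "v \<in> tensor_kernel R M N +>\<^bsub>F\<^esub> u" for v
    proof -
      have v: "v \<in> carrier F" "v \<ominus>\<^bsub>F\<^esub> u \<in> tensor_kernel R M N"
        using quotient_facts(5)[folded F_def, OF u that] by simp_all
      then have "fl v \<ominus>\<^bsub>P\<^esub> fl u = \<zero>\<^bsub>P\<^esub>" using ker u by (auto simp: fl.ker_def)
      then show ?thesis using v(1) u by simp
    qed
    have "fl ` (tensor_kernel R M N +>\<^bsub>F\<^esub> u) = (\<lambda>_. fl u) ` (tensor_kernel R M N +>\<^bsub>F\<^esub> u)"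
      by (rule image_cong[OF refl eq])
    moreover have "u \<in> tensor_kernel R M N +>\<^bsub>F\<^esub> u" by (rule quotient_facts(7)[folded F_def, OF u])
    ultimately have "fl ` (tensor_kernel R M N +>\<^bsub>F\<^esub> u) = {fl u}" by blast
    then show ?thesis by (simp add: tensor_lift_def fl_def)
  qed
  show thesis by (rule that[OF hom[unfolded F_def] gen lift[unfolded F_def]])
qed

lemma tensor_lift_hom:
  assumes P: "module R P" and f: "bilinear_map R M N P f"
  shows "tensor_lift R P f \<in> module_hom R (tensor_module R M N) P"
proof (rule module_homI)
  let ?F = "free_module R (carrier M \<times> carrier N)"
  let ?c = "\<lambda>u. tensor_kernel R M N +>\<^bsub>?F\<^esub> u"
  obtain fl where hom: "fl \<in> module_hom R ?F P"
    and lift: "\<And>u. u \<in> carrier ?F \<Longrightarrow> tensor_lift R P f (?c u) = fl u"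
    using tensor_lift_coset[OF P f] by metis
  show "tensor_lift R P f t \<in> carrier P" if t: "t \<in> carrier (tensor_module R M N)" for t
  proof -
    obtain u where u: "u \<in> carrier ?F" "t = ?c u" using t unfolding tensor_carrier_iff by blast
    show ?thesis unfolding u(2) lift[OF u(1)] by (rule module_hom_mem[OF hom u(1)])
  qed
  show "tensor_lift R P f (s \<oplus>\<^bsub>tensor_module R M N\<^esub> t) =
      tensor_lift R P f s \<oplus>\<^bsub>P\<^esub> tensor_lift R P f t"
    if s: "s \<in> carrier (tensor_module R M N)" and t: "t \<in> carrier (tensor_module R M N)" for s t
  proof -
    obtain u where u: "u \<in> carrier ?F" "s = ?c u" using s unfolding tensor_carrier_iff by blast
    obtain v where v: "v \<in> carrier ?F" "t = ?c v" using t unfolding tensor_carrier_iff by blast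
    show ?thesis
      unfolding u(2) v(2) quotient_facts(1)[OF u(1) v(1)] lift[OF u(1)] lift[OF v(1)]
        lift[OF F.M.a_closed[OF u(1) v(1)]]
      by (rule module_hom_add[OF hom u(1) v(1)])
  qed
  show "tensor_lift R P f (r \<odot>\<^bsub>tensor_module R M N\<^esub> t) = r \<odot>\<^bsub>P\<^esub> tensor_lift R P f t"
    if r: "r \<in> carrier R" and t: "t \<in> carrier (tensor_module R M N)" for r t
  proof -
    obtain u where u: "u \<in> carrier ?F" "t = ?c u" using t unfolding tensor_carrier_iff by blast
    show ?thesis
      unfolding u(2) quotient_facts(2)[OF r u(1)] lift[OF u(1)] lift[OF F.smult_closed[OF r u(1)]]
      by (rule module_hom_smult[OF hom r u(1)])
  qed
qed

lemma tensor_lift_pure: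
  assumes P: "module R P" and f: "bilinear_map R M N P f"
    and m: "m \<in> carrier M" and n: "n \<in> carrier N"
  shows "tensor_lift R P f (pure_tensor R M N m n) = f m n"
proof -
  obtain fl where "\<And>m n. m \<in> carrier M \<Longrightarrow> n \<in> carrier N \<Longrightarrow> fl (free_gen R (m, n)) = f m n"
    and "\<And>u. u \<in> carrier (free_module R (carrier M \<times> carrier N)) \<Longrightarrow> tensor_lift R P f
      (tensor_kernel R M N +>\<^bsub>free_module R (carrier M \<times> carrier N)\<^esub> u) = fl u"
    using tensor_lift_coset[OF P f] by metis
  then show ?thesis unfolding pure_tensor_def using tensor_gen_carrier[OF m n] m n by simp
qed

end

section \<open>Functoriality\<close>

text \<open>
  A Hopf algebra and its underlying algebra are different records, but they have the same tensor
  products, since only the module structure of the factors enters.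
\<close>

lemma tensor_module_cong:
  fixes M :: "('a, 'b, 'x) module_scheme" and M' :: "('a, 'b, 'x1) module_scheme"
    and N :: "('a, 'c, 'y) module_scheme" and N' :: "('a, 'c, 'y1) module_scheme"
  assumes "carrier M = carrier M'" "ring.add M = ring.add M'" "smult M = smult M'"
    and "carrier N = carrier N'" "ring.add N = ring.add N'" "smult N = smult N'"
  shows "tensor_module R M N = tensor_module R M' N'"
proof -
  have "tensor_kernel R M N = tensor_kernel R M' N'"
    by (simp add: tensor_kernel_def tensor_rels_def assms)
  then show ?thesis by (simp add: tensor_module_def assms)
qed

lemma tensor_map_bilinear:
  assumes "module R M'" "module R N'" "f \<in> module_hom R M M'" "g \<in> module_hom R N N'"
  shows "bilinear_map R M N (tensor_module R M' N') (\<lambda>m n. pure_tensor R M' N' (f m) (g n))"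
proof -
  note b = bilinear_mapD[OF pure_tensor_bilinear[OF assms(1,2)]]
  note f = module_hom_mem[OF assms(3)] module_hom_add[OF assms(3)] module_hom_smult[OF assms(3)]
  note g = module_hom_mem[OF assms(4)] module_hom_add[OF assms(4)] module_hom_smult[OF assms(4)]
  show ?thesis by (rule bilinear_mapI) (simp_all add: b f g)
qed

lemma tensor_map_hom:
  assumes "module R M" "module R N" "module R M'" "module R N'"
    and "f \<in> module_hom R M M'" "g \<in> module_hom R N N'"
  shows "tensor_map R M' N' f g \<in> module_hom R (tensor_module R M N) (tensor_module R M' N')"
  unfolding tensor_map_def
  by (rule tensor_lift_hom[OF assms(1,2) tensor_module_module[OF assms(3,4)]
        tensor_map_bilinear[OF assms(3-6)]])

lemma tensor_map_pure:
  assumes "module R M" "module R N" "module R M'" "module R N'"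
    and "f \<in> module_hom R M M'" "g \<in> module_hom R N N'"
    and "m \<in> carrier M" "n \<in> carrier N"
  shows "tensor_map R M' N' f g (pure_tensor R M N m n) = pure_tensor R M' N' (f m) (g n)"
  unfolding tensor_map_def
  by (rule tensor_lift_pure[OF assms(1,2) tensor_module_module[OF assms(3,4)]
        tensor_map_bilinear[OF assms(3-6)] assms(7,8)])

lemma module_hom_comp:
  "f \<in> module_hom R M N \<Longrightarrow> g \<in> module_hom R N P \<Longrightarrow> (\<lambda>x. g (f x)) \<in> module_hom R M P"
  by (auto simp: module_hom_def Pi_def)

lemma bilinear_map_comp:
  "bilinear_map R M N P f \<Longrightarrow> g \<in> module_hom R P Q \<Longrightarrow> bilinear_map R M N Q (\<lambda>m n. g (f m n))"
  by (auto simp: bilinear_map_def intro: module_hom_comp)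

lemma bilinear_map_comp2:
  assumes "bilinear_map R M' N' P b" "f \<in> module_hom R M M'" "g \<in> module_hom R N N'"
  shows "bilinear_map R M N P (\<lambda>m n. b (f m) (g n))"
proof -
  note b = bilinear_mapD[OF assms(1)]
  note f = module_hom_mem[OF assms(2)] module_hom_add[OF assms(2)] module_hom_smult[OF assms(2)]
  note g = module_hom_mem[OF assms(3)] module_hom_add[OF assms(3)] module_hom_smult[OF assms(3)]
  show ?thesis by (rule bilinear_mapI) (simp_all add: b f g)
qed

lemma tensor_hom_unique:
  assumes "module R M" "module R N" "module R P"
    and "f \<in> module_hom R (tensor_module R M N) P" "g \<in> module_hom R (tensor_module R M N) P"
    and "\<And>m n. m \<in> carrier M \<Longrightarrow> n \<in> carrier N \<Longrightarrow>
      f (pure_tensor R M N m n) = g (pure_tensor R M N m n)"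
    and "t \<in> carrier (tensor_module R M N)"
  shows "f t = g t"
  by (rule tensor_induct[OF assms(1,2,7)])
    (simp_all add: assms(6) module_hom_add[OF assms(4)] module_hom_add[OF assms(5)])

lemma tensor_lift_comp:
  assumes "module R M" "module R N" "module R P" "module R Q"
    and "bilinear_map R M N P f" "g \<in> module_hom R P Q"
    and "\<And>m n. m \<in> carrier M \<Longrightarrow> n \<in> carrier N \<Longrightarrow> f' m n = g (f m n)"
    and "t \<in> carrier (tensor_module R M N)"
  shows "g (tensor_lift R P f t) = tensor_lift R Q f' t"
proof -
  interpret M: module R M by fact
  interpret N: module R N by fact
  note gf = bilinear_mapD[OF bilinear_map_comp[OF assms(5,6)]]
  have b: "bilinear_map R M N Q f'"
    by (rule bilinear_mapI) (simp_all add: assms(7) gf)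
  show ?thesis
    by (rule tensor_hom_unique[OF assms(1,2,4) module_hom_comp[OF tensor_lift_hom[OF assms(1-3,5)] assms(6)]
          tensor_lift_hom[OF assms(1,2,4) b] _ assms(8)])
      (simp add: tensor_lift_pure[OF assms(1-3,5)] tensor_lift_pure[OF assms(1,2,4) b] assms(7))
qed

lemma tensor_map_comp:
  assumes "module R M" "module R M'" "module R M''"
    and "f \<in> module_hom R M M'" "g \<in> module_hom R M' M''"
    and "t \<in> carrier (tensor_module R M M)"
  shows "tensor_map R M'' M'' g g (tensor_map R M' M' f f t) =
    tensor_map R M'' M'' (\<lambda>x. g (f x)) (\<lambda>x. g (f x)) t"
proof -
  note gf = module_hom_comp[OF assms(4,5)]
  show ?thesis
    by (rule tensor_hom_unique[OF assms(1,1) tensor_module_module[OF assms(3,3)]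
          module_hom_comp[OF tensor_map_hom[OF assms(1,1,2,2,4,4)] tensor_map_hom[OF assms(2,2,3,3,5,5)]]
          tensor_map_hom[OF assms(1,1,3,3) gf gf] _ assms(6)])
      (simp add: tensor_map_pure[OF assms(1,1,2,2,4,4)] tensor_map_pure[OF assms(2,2,3,3,5,5)]
         tensor_map_pure[OF assms(1,1,3,3) gf gf] module_hom_mem[OF assms(4)])
qed

section \<open>Tensor products of algebras\<close>

lemma tensor_algebra_sel [simp]:
  "carrier (tensor_algebra R A B) = carrier (tensor_module R A B)"
  "ring.add (tensor_algebra R A B) = ring.add (tensor_module R A B)"
  "ring.zero (tensor_algebra R A B) = ring.zero (tensor_module R A B)"
  "smult (tensor_algebra R A B) = smult (tensor_module R A B)"
  "monoid.one (tensor_algebra R A B) = pure_tensor R A B \<one>\<^bsub>A\<^esub> \<one>\<^bsub>B\<^esub>"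
  by (simp_all add: tensor_algebra_def Let_def)

context
  fixes R :: "('a, 'm) ring_scheme" and A :: "('a, 'b, 'x) module_scheme"
    and B :: "('a, 'c, 'y) module_scheme"
  assumes A: "module R A" and B: "module R B"
    and multA: "bilinear_map R A A A (monoid.mult A)"
    and multB: "bilinear_map R B B B (monoid.mult B)"
begin

interpretation A: module R A by (rule A)
interpretation B: module R B by (rule B)
interpretation T: module R "tensor_module R A B" by (rule tensor_module_module[OF A B])

lemma tensor_mult_inner_bilinear:
  assumes "a \<in> carrier A" "b \<in> carrier B"
  shows "bilinear_map R A B (tensor_module R A B)
    (\<lambda>c d. pure_tensor R A B (a \<otimes>\<^bsub>A\<^esub> c) (b \<otimes>\<^bsub>B\<^esub> d))"
  by (rule tensor_map_bilinear[OF A B]; rule module_homI)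
    (simp_all add: assms bilinear_mapD[OF multA] bilinear_mapD[OF multB])

lemmas tensor_mult_inner_pure =
  tensor_lift_pure[OF A B T.module_axioms tensor_mult_inner_bilinear]

lemmas tensor_mult_inner_hom =
  tensor_lift_hom[OF A B T.module_axioms tensor_mult_inner_bilinear]

text \<open>
  The product of a tensor algebra is a lift of lifts. Its inner part is bilinear in \<open>(a, b)\<close> for a
  pure tensor \<open>V\<close>, and all the laws are additive in \<open>V\<close>.
\<close>

lemma tensor_mult_outer_bilinear:
  assumes V: "V \<in> carrier (tensor_module R A B)"
  shows "bilinear_map R A B (tensor_module R A B) (\<lambda>a b. tensor_lift R (tensor_module R A B)
    (\<lambda>c d. pure_tensor R A B (a \<otimes>\<^bsub>A\<^esub> c) (b \<otimes>\<^bsub>B\<^esub> d)) V)"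
proof -
  note inner = module_hom_mem[OF tensor_mult_inner_hom] module_hom_add[OF tensor_mult_inner_hom]
    module_hom_smult[OF tensor_mult_inner_hom]
  note mult = bilinear_mapD[OF multA] bilinear_mapD[OF multB]
  note pure = bilinear_mapD[OF pure_tensor_bilinear[OF A B]]
  show ?thesis
    using V
  proof (induction V rule: tensor_induct[OF A B, consumes 1, case_names pure add])
    case (pure c d)
    show ?case
      by (rule bilinear_mapI) (simp_all add: tensor_mult_inner_pure pure mult bilinear_mapD[OF pure_tensor_bilinear[OF A B]])
  next
    case (add s t)
    note s = bilinear_mapD[OF add.IH(1)] and t = bilinear_mapD[OF add.IH(2)]
    show ?case
      by (rule bilinear_mapI) (simp_all add: inner add.hyps s t T.M.a_ac T.smult_r_distr)
  qed
qed

lemma tensor_algebra_mult: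
  "U \<otimes>\<^bsub>tensor_algebra R A B\<^esub> V = tensor_lift R (tensor_module R A B) (\<lambda>a b.
     tensor_lift R (tensor_module R A B)
       (\<lambda>c d. pure_tensor R A B (a \<otimes>\<^bsub>A\<^esub> c) (b \<otimes>\<^bsub>B\<^esub> d)) V) U"
  by (simp add: tensor_algebra_def Let_def)

lemma tensor_algebra_mult_pure:
  assumes "a \<in> carrier A" "b \<in> carrier B" "c \<in> carrier A" "d \<in> carrier B"
  shows "pure_tensor R A B a b \<otimes>\<^bsub>tensor_algebra R A B\<^esub> pure_tensor R A B c d =
    pure_tensor R A B (a \<otimes>\<^bsub>A\<^esub> c) (b \<otimes>\<^bsub>B\<^esub> d)"
  unfolding tensor_algebra_mult using assms
  by (subst tensor_lift_pure[OF A B T.module_axioms tensor_mult_outer_bilinear])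
    (simp_all add: pure_tensor_closed[OF A B] tensor_mult_inner_pure)

lemma tensor_algebra_mult_bilinear:
  "bilinear_map R (tensor_module R A B) (tensor_module R A B) (tensor_module R A B)
     (monoid.mult (tensor_algebra R A B))"
proof -
  note outer = tensor_lift_hom[OF A B T.module_axioms tensor_mult_outer_bilinear]
  note outer_pure = tensor_lift_pure[OF A B T.module_axioms tensor_mult_outer_bilinear]
  note left = module_hom_mem[OF outer] module_hom_add[OF outer] module_hom_smult[OF outer]
  note inner = module_hom_mem[OF tensor_mult_inner_hom] module_hom_add[OF tensor_mult_inner_hom]
    module_hom_smult[OF tensor_mult_inner_hom]
  show ?thesis
    unfolding tensor_algebra_mult[abs_def]
  proof (rule bilinear_mapI)
    fix U V W assume UVW: "U \<in> carrier (tensor_module R A B)" "V \<in> carrier (tensor_module R A B)"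
      "W \<in> carrier (tensor_module R A B)"
    show "tensor_lift R (tensor_module R A B) (\<lambda>a b. tensor_lift R (tensor_module R A B)
        (\<lambda>c d. pure_tensor R A B (a \<otimes>\<^bsub>A\<^esub> c) (b \<otimes>\<^bsub>B\<^esub> d)) (V \<oplus>\<^bsub>tensor_module R A B\<^esub> W)) U =
      tensor_lift R (tensor_module R A B) (\<lambda>a b. tensor_lift R (tensor_module R A B)
        (\<lambda>c d. pure_tensor R A B (a \<otimes>\<^bsub>A\<^esub> c) (b \<otimes>\<^bsub>B\<^esub> d)) V) U \<oplus>\<^bsub>tensor_module R A B\<^esub>
      tensor_lift R (tensor_module R A B) (\<lambda>a b. tensor_lift R (tensor_module R A B)
        (\<lambda>c d. pure_tensor R A B (a \<otimes>\<^bsub>A\<^esub> c) (b \<otimes>\<^bsub>B\<^esub> d)) W) U"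
      using UVW(1)
    proof (induction U rule: tensor_induct[OF A B, consumes 1, case_names pure add])
      case (pure a b)
      then show ?case using UVW by (simp add: outer_pure inner T.M.a_closed)
    next
      case (add s t)
      then show ?case using UVW by (simp add: left T.M.a_ac T.M.a_closed)
    qed
  next
    fix r U V assume UV: "U \<in> carrier (tensor_module R A B)" "V \<in> carrier (tensor_module R A B)"
      "r \<in> carrier R"
    show "tensor_lift R (tensor_module R A B) (\<lambda>a b. tensor_lift R (tensor_module R A B)
        (\<lambda>c d. pure_tensor R A B (a \<otimes>\<^bsub>A\<^esub> c) (b \<otimes>\<^bsub>B\<^esub> d)) (r \<odot>\<^bsub>tensor_module R A B\<^esub> V)) U =
      r \<odot>\<^bsub>tensor_module R A B\<^esub> tensor_lift R (tensor_module R A B) (\<lambda>a b. tensor_lift R (tensor_module R A B)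
        (\<lambda>c d. pure_tensor R A B (a \<otimes>\<^bsub>A\<^esub> c) (b \<otimes>\<^bsub>B\<^esub> d)) V) U"
      using UV(1)
    proof (induction U rule: tensor_induct[OF A B, consumes 1, case_names pure add])
      case (pure a b)
      then show ?case using UV by (simp add: outer_pure inner)
    next
      case (add s t)
      then show ?case using UV by (simp add: left T.smult_r_distr)
    qed
  qed (simp_all add: left)
qed

end

section \<open>Field extensions and extension of scalars\<close>

lemma self_algebra_sel [simp]:
  "carrier (self_algebra R) = carrier R"
  "monoid.mult (self_algebra R) = monoid.mult R" "monoid.one (self_algebra R) = monoid.one R"
  "ring.zero (self_algebra R) = ring.zero R" "ring.add (self_algebra R) = ring.add R"
  "smult (self_algebra R) = monoid.mult R"
  by (simp_all add: self_algebra_def)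

lemma cring_self_module: "cring R \<Longrightarrow> module R (self_algebra R)"
proof -
  assume "cring R"
  then interpret R: cring R .
  have "abelian_group (self_algebra R)"
    by (rule abelian_groupI) (auto simp: R.a_ac intro!: bexI[of _ "\<ominus>\<^bsub>R\<^esub> _"] R.l_neg)
  then show ?thesis
    by (intro moduleI) (auto simp: R.l_distr R.r_distr R.m_assoc R.cring_axioms)
qed

lemma finsum_self_algebra [simp]: "finsum (self_algebra R) = finsum R"
  by (simp add: finsum_def finprod_def fun_eq_iff)

text \<open>
  The \<open>k\<close>-module \<open>M\<close> is described by \<open>L\<close>-valued coordinates \<open>p x\<close>: suitable \<open>L\<close>-linear combinations
  of them are \<open>k\<close>-valued, and serve as coefficients with respect to the family \<open>h\<close>.
\<close>

definition coordinates ::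
  "'a ring \<Rightarrow> 'a ring \<Rightarrow> ('a, 'b, 'y) module_scheme \<Rightarrow> 'x set \<Rightarrow> ('x \<Rightarrow> 'b \<Rightarrow> 'a)
     \<Rightarrow> 'i set \<Rightarrow> ('i \<Rightarrow> 'b) \<Rightarrow> ('i \<Rightarrow> 'x \<Rightarrow> 'a) \<Rightarrow> bool"
  where "coordinates k L M S p I h c \<longleftrightarrow>
    (\<forall>x\<in>S. p x \<in> module_hom k M (self_algebra L)) \<and> (\<forall>i\<in>I. h i \<in> carrier M) \<and>
    (\<forall>i\<in>I. \<forall>x\<in>S. c i x \<in> carrier L) \<and>
    (\<forall>m\<in>carrier M. \<forall>i\<in>I. (\<Oplus>\<^bsub>L\<^esub>x\<in>S. c i x \<otimes>\<^bsub>L\<^esub> p x m) \<in> carrier k) \<and>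
    (\<forall>m\<in>carrier M. m = (\<Oplus>\<^bsub>M\<^esub>i\<in>I. (\<Oplus>\<^bsub>L\<^esub>x\<in>S. c i x \<otimes>\<^bsub>L\<^esub> p x m) \<odot>\<^bsub>M\<^esub> h i))"

locale extension =
  fixes k :: "'a ring" and L :: "'a ring" (structure)
  assumes ext: "field_extension k L"
begin

sublocale L: field L using ext by (simp add: field_extension_def)

lemma k_eq: "k = L\<lparr>carrier := carrier k\<rparr>" using ext by (simp add: field_extension_def)

lemma k_sub: "subfield (carrier k) L" using ext by (simp add: field_extension_def)

lemma k_ops [simp]: "monoid.mult k = monoid.mult L" "monoid.one k = monoid.one L"
  "ring.add k = ring.add L" "ring.zero k = ring.zero L"
  by (subst k_eq; simp)+

lemma k_field: "field k" by (subst k_eq) (rule L.subfield_iff(2)[OF k_sub])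

sublocale k: field k by (rule k_field)

lemma k_in_L: "x \<in> carrier k \<Longrightarrow> x \<in> carrier L"
  using subfieldE(3)[OF k_sub] by blast

lemma k_closed [simp]:
  "\<one> \<in> carrier k" "\<zero> \<in> carrier k"
  "a \<in> carrier k \<Longrightarrow> b \<in> carrier k \<Longrightarrow> a \<oplus> b \<in> carrier k"
  "a \<in> carrier k \<Longrightarrow> b \<in> carrier k \<Longrightarrow> a \<otimes> b \<in> carrier k"
  using k.one_closed k.zero_closed k.a_closed k.m_closed by simp_all

lemma restrict_scalars: "module L P \<Longrightarrow> module k P"
  by (rule moduleI)
    (auto simp: module.smult_l_distr module.smult_r_distr module.smult_assoc1 module.smult_one k_in_L
       module.smult_closed module_def k.cring_axioms)

lemma L_self_module: "module L (self_algebra L)"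
  by (rule cring_self_module[OF L.cring_axioms])

lemma L_module: "module k (self_algebra L)"
  by (rule restrict_scalars[OF L_self_module])

lemma mult_coordinates_bilinear:
  assumes "p \<in> module_hom k M (self_algebra L)" "q \<in> module_hom k N (self_algebra L)"
  shows "bilinear_map k M N (self_algebra L) (\<lambda>m n. p m \<otimes> q n)"
proof -
  note p = module_hom_mem[OF assms(1)] module_hom_add[OF assms(1)] module_hom_smult[OF assms(1)]
  note q = module_hom_mem[OF assms(2)] module_hom_add[OF assms(2)] module_hom_smult[OF assms(2)]
  show ?thesis
    by (rule bilinear_mapI) (use p q in \<open>simp_all add: L.l_distr L.r_distr L.m_ac k_in_L\<close>)
qed

text \<open>
  Applying the \<open>i\<close>-th coefficient to the first factor gives maps \<open>\<nu>\<^sub>i\<close> from \<open>M \<otimes> N\<close> to \<open>N\<close>, and \<open>t\<close> is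
  the sum of the tensors \<open>h\<^sub>i \<otimes> \<nu>\<^sub>i(t)\<close>. The coordinates of \<open>\<nu>\<^sub>i(t)\<close> are \<open>L\<close>-linear combinations of the
  values of \<open>t\<close> which are assumed to vanish, so \<open>\<nu>\<^sub>i(t) = 0\<close> for all \<open>i\<close>.
\<close>

lemma tensor_separation:
  assumes M: "module k M" and N: "module k N"
    and coord: "coordinates k L M S p I h c"
    and q: "\<And>y. y \<in> Y \<Longrightarrow> q y \<in> module_hom k N (self_algebra L)"
    and sep: "\<And>n. n \<in> carrier N \<Longrightarrow> (\<And>y. y \<in> Y \<Longrightarrow> q y n = \<zero>) \<Longrightarrow> n = \<zero>\<^bsub>N\<^esub>"
    and t: "t \<in> carrier (tensor_module k M N)"
    and zero: "\<And>x y. x \<in> S \<Longrightarrow> y \<in> Y \<Longrightarrow>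
      tensor_lift k (self_algebra L) (\<lambda>m n. p x m \<otimes> q y n) t = \<zero>"
  shows "t = \<zero>\<^bsub>tensor_module k M N\<^esub>"
proof -
  let ?T = "tensor_module k M N"
  interpret M: module k M by (rule M)
  interpret N: module k N by (rule N)
  interpret T: module k ?T by (rule tensor_module_module[OF M N])
  define C where "C i m = (\<Oplus>x\<in>S. c i x \<otimes> p x m)" for i m
  have p: "\<And>x. x \<in> S \<Longrightarrow> p x \<in> module_hom k M (self_algebra L)"
    and h: "\<And>i. i \<in> I \<Longrightarrow> h i \<in> carrier M"
    and c: "\<And>i x. i \<in> I \<Longrightarrow> x \<in> S \<Longrightarrow> c i x \<in> carrier L"
    and Ck: "\<And>i m. i \<in> I \<Longrightarrow> m \<in> carrier M \<Longrightarrow> C i m \<in> carrier k"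
    and expand: "\<And>m. m \<in> carrier M \<Longrightarrow> m = (\<Oplus>\<^bsub>M\<^esub>i\<in>I. C i m \<odot>\<^bsub>M\<^esub> h i)"
    using coord unfolding coordinates_def C_def by blast+
  have pL: "p x m \<in> carrier L" if "x \<in> S" "m \<in> carrier M" for x m
    using module_hom_mem[OF p] that by simp
  have C_add: "C i (m \<oplus>\<^bsub>M\<^esub> m') = C i m \<oplus> C i m'"
    if "i \<in> I" "m \<in> carrier M" "m' \<in> carrier M" for i m m'
  proof -
    have "C i (m \<oplus>\<^bsub>M\<^esub> m') = (\<Oplus>x\<in>S. c i x \<otimes> p x m \<oplus> c i x \<otimes> p x m')"
      unfolding C_def using that
      by (intro L.finsum_cong') (auto simp: module_hom_add[OF p] L.r_distr c pL)
    then show ?thesis using that unfolding C_def by (simp add: L.finsum_addf c pL Pi_def)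
  qed
  have C_smult: "C i (r \<odot>\<^bsub>M\<^esub> m) = r \<otimes> C i m"
    if "i \<in> I" "m \<in> carrier M" "r \<in> carrier k" for i m r
  proof -
    have "C i (r \<odot>\<^bsub>M\<^esub> m) = (\<Oplus>x\<in>S. r \<otimes> (c i x \<otimes> p x m))"
      unfolding C_def using that
      by (intro L.finsum_cong') (auto simp: module_hom_smult[OF p] L.m_ac c pL k_in_L)
    also have "\<dots> = r \<otimes> C i m"
      using module_hom_finsum[OF L_self_module L_self_module, of "\<lambda>x. r \<otimes> x" "\<lambda>x. c i x \<otimes> p x m" S] that
      by (simp add: C_def module_hom_def L.r_distr L.m_ac k_in_L c pL Pi_def)
    finally show ?thesis .
  qed
  define \<nu> where "\<nu> i = tensor_lift k N (\<lambda>m n. C i m \<odot>\<^bsub>N\<^esub> n)" for i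
  have bil: "bilinear_map k M N N (\<lambda>m n. C i m \<odot>\<^bsub>N\<^esub> n)" if "i \<in> I" for i
  proof (rule bilinear_mapI)
    fix r m n assume *: "r \<in> carrier k" "m \<in> carrier M" "n \<in> carrier N"
    show "C i (r \<odot>\<^bsub>M\<^esub> m) \<odot>\<^bsub>N\<^esub> n = r \<odot>\<^bsub>N\<^esub> (C i m \<odot>\<^bsub>N\<^esub> n)"
      using N.smult_assoc1[of r "C i m" n] * that by (simp add: C_smult Ck)
    show "C i m \<odot>\<^bsub>N\<^esub> (r \<odot>\<^bsub>N\<^esub> n) = r \<odot>\<^bsub>N\<^esub> (C i m \<odot>\<^bsub>N\<^esub> n)"
      using N.smult_assoc1[of r "C i m" n] N.smult_assoc1[of "C i m" r n] * that
      by (simp add: Ck k_in_L L.m_comm)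
  next
    fix m m' n assume *: "m \<in> carrier M" "m' \<in> carrier M" "n \<in> carrier N"
    show "C i (m \<oplus>\<^bsub>M\<^esub> m') \<odot>\<^bsub>N\<^esub> n = C i m \<odot>\<^bsub>N\<^esub> n \<oplus>\<^bsub>N\<^esub> C i m' \<odot>\<^bsub>N\<^esub> n"
      using N.smult_l_distr[of "C i m" "C i m'" n] * that by (simp add: C_add Ck)
  qed (use that in \<open>simp_all add: Ck N.smult_r_distr\<close>)
  note \<nu>_hom = tensor_lift_hom[OF M N N bil, folded \<nu>_def]
  note \<nu>_pure = tensor_lift_pure[OF M N N bil, folded \<nu>_def]
  note pure = bilinear_mapD[OF pure_tensor_bilinear[OF M N]]
  have expandT: "s = (\<Oplus>\<^bsub>?T\<^esub>i\<in>I. pure_tensor k M N (h i) (\<nu> i s))" if "s \<in> carrier ?T" for s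
  proof (rule tensor_induct[OF M N that])
    fix m n assume m: "m \<in> carrier M" and n: "n \<in> carrier N"
    have "pure_tensor k M N m n = pure_tensor k M N (\<Oplus>\<^bsub>M\<^esub>i\<in>I. C i m \<odot>\<^bsub>M\<^esub> h i) n"
      using expand[OF m] by simp
    also have "\<dots> = (\<Oplus>\<^bsub>?T\<^esub>i\<in>I. pure_tensor k M N (C i m \<odot>\<^bsub>M\<^esub> h i) n)"
      using m n h Ck pure_tensor_bilinear[OF M N] unfolding bilinear_map_def
      by (intro module_hom_finsum[OF M T.module_axioms, where f = "\<lambda>m. pure_tensor k M N m n"]) auto
    also have "\<dots> = (\<Oplus>\<^bsub>?T\<^esub>i\<in>I. pure_tensor k M N (h i) (\<nu> i (pure_tensor k M N m n)))"
      using m n h Ck by (intro T.M.finsum_cong') (auto simp: pure \<nu>_pure)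
    finally show "pure_tensor k M N m n =
      (\<Oplus>\<^bsub>?T\<^esub>i\<in>I. pure_tensor k M N (h i) (\<nu> i (pure_tensor k M N m n)))" .
  next
    fix s t assume st: "s \<in> carrier ?T" "t \<in> carrier ?T"
      and IH: "s = (\<Oplus>\<^bsub>?T\<^esub>i\<in>I. pure_tensor k M N (h i) (\<nu> i s))"
        "t = (\<Oplus>\<^bsub>?T\<^esub>i\<in>I. pure_tensor k M N (h i) (\<nu> i t))"
    have \<nu>N: "\<nu> i s \<in> carrier N" "\<nu> i t \<in> carrier N" if "i \<in> I" for i
      using module_hom_mem[OF \<nu>_hom] that st by auto
    have "(\<Oplus>\<^bsub>?T\<^esub>i\<in>I. pure_tensor k M N (h i) (\<nu> i (s \<oplus>\<^bsub>?T\<^esub> t))) =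
      (\<Oplus>\<^bsub>?T\<^esub>i\<in>I. pure_tensor k M N (h i) (\<nu> i s) \<oplus>\<^bsub>?T\<^esub> pure_tensor k M N (h i) (\<nu> i t))"
      using h \<nu>N st by (intro T.M.finsum_cong') (auto simp: pure module_hom_add[OF \<nu>_hom])
    also have "\<dots> = s \<oplus>\<^bsub>?T\<^esub> t"
      using h \<nu>N pure(1) by (subst T.M.finsum_addf) (auto simp: IH[symmetric])
    finally show "s \<oplus>\<^bsub>?T\<^esub> t = (\<Oplus>\<^bsub>?T\<^esub>i\<in>I. pure_tensor k M N (h i) (\<nu> i (s \<oplus>\<^bsub>?T\<^esub> t)))" ..
  qed
  define E where "E x y = tensor_lift k (self_algebra L) (\<lambda>m n. p x m \<otimes> q y n)" for x y
  note E_hom = tensor_lift_hom[OF M N L_module mult_coordinates_bilinear[OF p q], folded E_def]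
  note E_pure = tensor_lift_pure[OF M N L_module mult_coordinates_bilinear[OF p q], folded E_def]
  have q\<nu>: "q y (\<nu> i s) = (\<Oplus>x\<in>S. c i x \<otimes> E x y s)"
    if i: "i \<in> I" and y: "y \<in> Y" and s: "s \<in> carrier ?T" for i y s
  proof (rule tensor_induct[OF M N s])
    have qL: "q y n \<in> carrier L" if "n \<in> carrier N" for n using module_hom_mem[OF q[OF y] that] by simp
    fix m n assume m: "m \<in> carrier M" and n: "n \<in> carrier N"
    have "q y (\<nu> i (pure_tensor k M N m n)) = C i m \<otimes> q y n"
      using m n i y by (simp add: \<nu>_pure Ck module_hom_smult[OF q])
    also have "\<dots> = (\<Oplus>x\<in>S. (c i x \<otimes> p x m) \<otimes> q y n)"
      unfolding C_def
      using module_hom_finsum[OF L_self_module L_self_module, of "\<lambda>z. z \<otimes> q y n" "\<lambda>x. c i x \<otimes> p x m" S]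
        i m qL[OF n]
      by (simp add: module_hom_def L.l_distr L.m_assoc c pL Pi_def)
    also have "\<dots> = (\<Oplus>x\<in>S. c i x \<otimes> E x y (pure_tensor k M N m n))"
      using i y m n qL[OF n] by (intro L.finsum_cong') (auto simp: E_pure c pL L.m_assoc)
    finally show "q y (\<nu> i (pure_tensor k M N m n)) =
      (\<Oplus>x\<in>S. c i x \<otimes> E x y (pure_tensor k M N m n))" .
  next
    fix s t assume st: "s \<in> carrier ?T" "t \<in> carrier ?T"
      and IH: "q y (\<nu> i s) = (\<Oplus>x\<in>S. c i x \<otimes> E x y s)"
        "q y (\<nu> i t) = (\<Oplus>x\<in>S. c i x \<otimes> E x y t)"
    have EL: "E x y s \<in> carrier L" "E x y t \<in> carrier L" if "x \<in> S" for x
      using module_hom_mem[OF E_hom[OF that y]] st by auto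
    have "q y (\<nu> i (s \<oplus>\<^bsub>?T\<^esub> t)) = q y (\<nu> i s) \<oplus> q y (\<nu> i t)"
      using st i y by (simp add: module_hom_add[OF \<nu>_hom] module_hom_add[OF q] module_hom_mem[OF \<nu>_hom])
    also have "\<dots> = (\<Oplus>x\<in>S. c i x \<otimes> E x y s \<oplus> c i x \<otimes> E x y t)"
      unfolding IH using i by (simp add: L.finsum_addf c EL Pi_def)
    also have "\<dots> = (\<Oplus>x\<in>S. c i x \<otimes> E x y (s \<oplus>\<^bsub>?T\<^esub> t))"
      using i y st EL by (intro L.finsum_cong') (auto simp: module_hom_add[OF E_hom] c L.r_distr)
    finally show "q y (\<nu> i (s \<oplus>\<^bsub>?T\<^esub> t)) = (\<Oplus>x\<in>S. c i x \<otimes> E x y (s \<oplus>\<^bsub>?T\<^esub> t))" .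
  qed
  have "\<nu> i t = \<zero>\<^bsub>N\<^esub>" if i: "i \<in> I" for i
  proof (rule sep)
    show "\<nu> i t \<in> carrier N" using module_hom_mem[OF \<nu>_hom[OF i] t] .
    show "q y (\<nu> i t) = \<zero>" if y: "y \<in> Y" for y
      unfolding q\<nu>[OF i y t] by (rule L.add.finprod_one_eqI) (simp add: E_def zero[OF _ y] c[OF i])
  qed
  moreover have "pure_tensor k M N m \<zero>\<^bsub>N\<^esub> = \<zero>\<^bsub>?T\<^esub>" if "m \<in> carrier M" for m
    using pure(5)[of "\<zero>\<^bsub>k\<^esub>" m "\<zero>\<^bsub>N\<^esub>"] that pure(1) by (simp del: k_ops)
  ultimately have "(\<Oplus>\<^bsub>?T\<^esub>i\<in>I. pure_tensor k M N (h i) (\<nu> i t)) = \<zero>\<^bsub>?T\<^esub>"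
    using h by (intro T.M.add.finprod_one_eqI) simp
  then show ?thesis using expandT[OF t] by simp
qed

lemma base_change_algebra_sel [simp]:
  "carrier (base_change_algebra k L A) = carrier (tensor_module k A (self_algebra L))"
  "ring.add (base_change_algebra k L A) = ring.add (tensor_module k A (self_algebra L))"
  "ring.zero (base_change_algebra k L A) = ring.zero (tensor_module k A (self_algebra L))"
  "monoid.mult (base_change_algebra k L A) = monoid.mult (tensor_algebra k A (self_algebra L))"
  "monoid.one (base_change_algebra k L A) = monoid.one (tensor_algebra k A (self_algebra L))"
  by (simp_all add: base_change_algebra_def)

lemma base_change_smult:
  "c \<odot>\<^bsub>base_change_algebra k L A\<^esub> t = tensor_lift k (tensor_module k A (self_algebra L))
     (\<lambda>a l. pure_tensor k A (self_algebra L) a (c \<otimes> l)) t"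
  by (simp add: base_change_algebra_def)

context
  fixes A :: "('a, 'b, 'x) module_scheme"
  assumes A: "module k A"
begin

interpretation A: module k A by (rule A)
interpretation T: module k "tensor_module k A (self_algebra L)"
  by (rule tensor_module_module[OF A L_module])

lemma base_change_smult_bilinear:
  assumes "c \<in> carrier L"
  shows "bilinear_map k A (self_algebra L) (tensor_module k A (self_algebra L))
    (\<lambda>a l. pure_tensor k A (self_algebra L) a (c \<otimes> l))"
  by (rule tensor_map_bilinear[OF A L_module]; rule module_homI)
    (use assms in \<open>simp_all add: L.r_distr L.m_ac k_in_L\<close>)

lemma base_change_smult_hom:
  assumes "c \<in> carrier L"
  shows "smult (base_change_algebra k L A) c \<in>
    module_hom k (tensor_module k A (self_algebra L)) (tensor_module k A (self_algebra L))"
  using tensor_lift_hom[OF A L_module T.module_axioms base_change_smult_bilinear[OF assms]]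
  by (simp add: base_change_smult[abs_def])

lemma base_change_smult_pure:
  assumes "c \<in> carrier L" "a \<in> carrier A" "l \<in> carrier L"
  shows "c \<odot>\<^bsub>base_change_algebra k L A\<^esub> pure_tensor k A (self_algebra L) a l =
    pure_tensor k A (self_algebra L) a (c \<otimes> l)"
  using tensor_lift_pure[OF A L_module T.module_axioms base_change_smult_bilinear[OF assms(1)], of a l] assms
  by (simp add: base_change_smult[abs_def])

lemma base_change_smult_restrict:
  assumes r: "r \<in> carrier k" and t: "t \<in> carrier (tensor_module k A (self_algebra L))"
  shows "r \<odot>\<^bsub>base_change_algebra k L A\<^esub> t = r \<odot>\<^bsub>tensor_module k A (self_algebra L)\<^esub> t"
proof (rule tensor_induct[OF A L_module t])
  note pure = bilinear_mapD[OF pure_tensor_bilinear[OF A L_module]]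
  show "r \<odot>\<^bsub>base_change_algebra k L A\<^esub> pure_tensor k A (self_algebra L) a l =
      r \<odot>\<^bsub>tensor_module k A (self_algebra L)\<^esub> pure_tensor k A (self_algebra L) a l"
    if "a \<in> carrier A" "l \<in> carrier (self_algebra L)" for a l
    using pure(5)[of r a l] that r by (simp add: base_change_smult_pure k_in_L)
qed (use r in \<open>simp add: module_hom_add[OF base_change_smult_hom] k_in_L T.smult_r_distr\<close>)

lemma base_change_module: "module L (base_change_algebra k L A)"
proof (rule moduleI)
  note pure = bilinear_mapD[OF pure_tensor_bilinear[OF A L_module]]
  note hom = module_hom_mem[OF base_change_smult_hom] module_hom_add[OF base_change_smult_hom]
  let ?B = "base_change_algebra k L A"
  show "cring L" by (rule L.cring_axioms)
  show "abelian_group ?B"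
    by (rule abelian_groupI) (auto simp: T.M.a_ac intro!: bexI[of _ "\<ominus>\<^bsub>_\<^esub> _"] T.M.l_neg)
  show "c \<odot>\<^bsub>?B\<^esub> t \<in> carrier ?B" if "c \<in> carrier L" "t \<in> carrier ?B" for c t
    using that hom(1) by simp
  show "c \<odot>\<^bsub>?B\<^esub> (s \<oplus>\<^bsub>?B\<^esub> t) = c \<odot>\<^bsub>?B\<^esub> s \<oplus>\<^bsub>?B\<^esub> c \<odot>\<^bsub>?B\<^esub> t"
    if "c \<in> carrier L" "s \<in> carrier ?B" "t \<in> carrier ?B" for c s t
    using that hom(2) by simp
  show "(c \<oplus> d) \<odot>\<^bsub>?B\<^esub> t = c \<odot>\<^bsub>?B\<^esub> t \<oplus>\<^bsub>?B\<^esub> d \<odot>\<^bsub>?B\<^esub> t"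
    if cd: "c \<in> carrier L" "d \<in> carrier L" and "t \<in> carrier ?B" for c d t
  proof -
    have t: "t \<in> carrier (tensor_module k A (self_algebra L))" using that by simp
    show ?thesis
      by (rule tensor_induct[OF A L_module t])
        (use cd in \<open>simp_all add: base_change_smult_pure L.l_distr pure[simplified] hom T.M.a_ac\<close>)
  qed
  show "(c \<otimes> d) \<odot>\<^bsub>?B\<^esub> t = c \<odot>\<^bsub>?B\<^esub> (d \<odot>\<^bsub>?B\<^esub> t)"
    if cd: "c \<in> carrier L" "d \<in> carrier L" and "t \<in> carrier ?B" for c d t
  proof -
    have t: "t \<in> carrier (tensor_module k A (self_algebra L))" using that by simp
    show ?thesis
      by (rule tensor_induct[OF A L_module t])
        (use cd in \<open>simp_all add: base_change_smult_pure L.m_assoc hom\<close>)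
  qed
  show "\<one> \<odot>\<^bsub>?B\<^esub> t = t" if "t \<in> carrier ?B" for t
  proof -
    have t: "t \<in> carrier (tensor_module k A (self_algebra L))" using that by simp
    show ?thesis
      by (rule tensor_induct[OF A L_module t]) (simp_all add: base_change_smult_pure hom)
  qed
qed

end

end

section \<open>Associativity of the tensor product\<close>

context
  fixes R :: "('a, 'm) ring_scheme" and M :: "('a, 'b, 'x) module_scheme"
    and N :: "('a, 'c, 'y) module_scheme" and P :: "('a, 'd, 'z) module_scheme"
  assumes M: "module R M" and N: "module R N" and P: "module R P"
begin

interpretation M: module R M by (rule M)
interpretation N: module R N by (rule N)
interpretation P: module R P by (rule P)

lemma MN: "module R (tensor_module R M N)" by (rule tensor_module_module[OF M N])
lemma NP: "module R (tensor_module R N P)" by (rule tensor_module_module[OF N P])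
lemma MNP: "module R (tensor_module R M (tensor_module R N P))"
  by (rule tensor_module_module[OF M NP])

interpretation T: module R "tensor_module R M (tensor_module R N P)" by (rule MNP)

lemma tensor_assoc_inner_bilinear:
  assumes "p \<in> carrier P"
  shows "bilinear_map R M N (tensor_module R M (tensor_module R N P))
    (\<lambda>m n. pure_tensor R M (tensor_module R N P) m (pure_tensor R N P n p))"
  by (rule tensor_map_bilinear[OF M NP]; rule module_homI)
    (simp_all add: assms bilinear_mapD[OF pure_tensor_bilinear[OF N P]])

lemmas tensor_assoc_inner_pure = tensor_lift_pure[OF M N MNP tensor_assoc_inner_bilinear]
lemmas tensor_assoc_inner_hom = tensor_lift_hom[OF M N MNP tensor_assoc_inner_bilinear]

lemma tensor_assoc_outer_bilinear:
  "bilinear_map R (tensor_module R M N) P (tensor_module R M (tensor_module R N P))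
    (\<lambda>u p. tensor_lift R (tensor_module R M (tensor_module R N P))
      (\<lambda>m n. pure_tensor R M (tensor_module R N P) m (pure_tensor R N P n p)) u)"
proof (rule bilinear_mapI)
  note inner = module_hom_mem[OF tensor_assoc_inner_hom] module_hom_add[OF tensor_assoc_inner_hom]
    module_hom_smult[OF tensor_assoc_inner_hom]
  note pure = bilinear_mapD[OF pure_tensor_bilinear[OF N P]]
    bilinear_mapD[OF pure_tensor_bilinear[OF M NP]]
  let ?T = "tensor_module R M (tensor_module R N P)"
  let ?f = "\<lambda>u p. tensor_lift R ?T
      (\<lambda>m n. pure_tensor R M (tensor_module R N P) m (pure_tensor R N P n p)) u"
  show "?f u (p \<oplus>\<^bsub>P\<^esub> p') = ?f u p \<oplus>\<^bsub>?T\<^esub> ?f u p'"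
    if u: "u \<in> carrier (tensor_module R M N)" and p: "p \<in> carrier P" "p' \<in> carrier P" for u p p'
    by (rule tensor_induct[OF M N u]) (use p in \<open>simp_all add: tensor_assoc_inner_pure pure inner T.M.a_ac\<close>)
  show "?f u (r \<odot>\<^bsub>P\<^esub> p) = r \<odot>\<^bsub>?T\<^esub> ?f u p"
    if u: "u \<in> carrier (tensor_module R M N)" and p: "p \<in> carrier P" "r \<in> carrier R" for u p r
    by (rule tensor_induct[OF M N u]) (use p in \<open>simp_all add: tensor_assoc_inner_pure pure inner T.smult_r_distr\<close>)
  show "\<And>m m' n. m \<in> carrier (tensor_module R M N) \<Longrightarrow> m' \<in> carrier (tensor_module R M N) \<Longrightarrow>
      n \<in> carrier P \<Longrightarrow> ?f (m \<oplus>\<^bsub>tensor_module R M N\<^esub> m') n = ?f m n \<oplus>\<^bsub>?T\<^esub> ?f m' n"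
    "\<And>r m n. r \<in> carrier R \<Longrightarrow> m \<in> carrier (tensor_module R M N) \<Longrightarrow>
      n \<in> carrier P \<Longrightarrow> ?f (r \<odot>\<^bsub>tensor_module R M N\<^esub> m) n = r \<odot>\<^bsub>?T\<^esub> ?f m n"
    "\<And>m n. m \<in> carrier (tensor_module R M N) \<Longrightarrow> n \<in> carrier P \<Longrightarrow> ?f m n \<in> carrier ?T"
    by (simp_all add: inner)
qed

lemma tensor_assoc_hom:
  "tensor_assoc R M N P \<in> module_hom R (tensor_module R (tensor_module R M N) P)
     (tensor_module R M (tensor_module R N P))"
  unfolding tensor_assoc_def Let_def
  by (rule tensor_lift_hom[OF MN P MNP tensor_assoc_outer_bilinear])

lemma tensor_assoc_pure:
  assumes "u \<in> carrier (tensor_module R M N)" "p \<in> carrier P"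
  shows "tensor_assoc R M N P (pure_tensor R (tensor_module R M N) P u p) =
    tensor_lift R (tensor_module R M (tensor_module R N P))
      (\<lambda>m n. pure_tensor R M (tensor_module R N P) m (pure_tensor R N P n p)) u"
  unfolding tensor_assoc_def Let_def
  by (rule tensor_lift_pure[OF MN P MNP tensor_assoc_outer_bilinear assms])

end

lemma tensor_lift_cong:
  assumes "module R M" "module R N" "module R P" "bilinear_map R M N P f"
    and "\<And>m n. m \<in> carrier M \<Longrightarrow> n \<in> carrier N \<Longrightarrow> f' m n = f m n"
    and "t \<in> carrier (tensor_module R M N)"
  shows "tensor_lift R P f t = tensor_lift R P f' t"
  by (rule tensor_lift_comp[OF assms(1-3,3,4) _ _ assms(6), of "\<lambda>x. x"])
    (simp_all add: module_hom_def assms(5))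

section \<open>Function algebras\<close>

lemma fun_algebra_sel:
  "carrier (fun_algebra \<Gamma> R) = carrier \<Gamma> \<rightarrow>\<^sub>E carrier R"
  "f \<otimes>\<^bsub>fun_algebra \<Gamma> R\<^esub> g = (\<lambda>x\<in>carrier \<Gamma>. f x \<otimes>\<^bsub>R\<^esub> g x)"
  "\<one>\<^bsub>fun_algebra \<Gamma> R\<^esub> = (\<lambda>x\<in>carrier \<Gamma>. \<one>\<^bsub>R\<^esub>)"
  "\<zero>\<^bsub>fun_algebra \<Gamma> R\<^esub> = (\<lambda>x\<in>carrier \<Gamma>. \<zero>\<^bsub>R\<^esub>)"
  "f \<oplus>\<^bsub>fun_algebra \<Gamma> R\<^esub> g = (\<lambda>x\<in>carrier \<Gamma>. f x \<oplus>\<^bsub>R\<^esub> g x)"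
  "r \<odot>\<^bsub>fun_algebra \<Gamma> R\<^esub> f = (\<lambda>x\<in>carrier \<Gamma>. r \<otimes>\<^bsub>R\<^esub> f x)"
  by (simp_all add: fun_algebra_def)

text \<open>
  A \<open>k\<close>-algebra of \<open>L\<close>-valued functions on a finite group, together with a family \<open>h\<close> of its elements
  and a dual family \<open>c\<close>. Pairing with \<open>c\<close> is what brings the values in \<open>L\<close> down to coefficients in \<open>k\<close>.
\<close>

locale function_module = extension k L + G: group \<Gamma>
  for k :: "'a ring" and L :: "'a ring" (structure) and \<Gamma> :: "('g, 'n) monoid_scheme" +
  fixes H :: "('a, 'g \<Rightarrow> 'a, 'x) module_scheme" and h c :: "'g \<Rightarrow> 'g \<Rightarrow> 'a"
  assumes fin: "finite (carrier \<Gamma>)"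
    and carrier_sub: "carrier H \<subseteq> carrier \<Gamma> \<rightarrow>\<^sub>E carrier L"
    and ops: "monoid.mult H = monoid.mult (fun_algebra \<Gamma> L)" "monoid.one H = monoid.one (fun_algebra \<Gamma> L)"
      "ring.add H = ring.add (fun_algebra \<Gamma> L)" "ring.zero H = ring.zero (fun_algebra \<Gamma> L)"
      "smult H = smult (fun_algebra \<Gamma> L)"
    and closed: "\<And>f g. f \<in> carrier H \<Longrightarrow> g \<in> carrier H \<Longrightarrow> f \<otimes>\<^bsub>H\<^esub> g \<in> carrier H"
      "\<And>f g. f \<in> carrier H \<Longrightarrow> g \<in> carrier H \<Longrightarrow> f \<oplus>\<^bsub>H\<^esub> g \<in> carrier H"
      "\<And>r f. r \<in> carrier k \<Longrightarrow> f \<in> carrier H \<Longrightarrow> r \<odot>\<^bsub>H\<^esub> f \<in> carrier H"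
      "\<one>\<^bsub>H\<^esub> \<in> carrier H" "\<zero>\<^bsub>H\<^esub> \<in> carrier H"
    and h: "\<And>i. i \<in> carrier \<Gamma> \<Longrightarrow> h i \<in> carrier H"
    and c: "\<And>i x. i \<in> carrier \<Gamma> \<Longrightarrow> x \<in> carrier \<Gamma> \<Longrightarrow> c i x \<in> carrier L"
    and coef: "\<And>i f. i \<in> carrier \<Gamma> \<Longrightarrow> f \<in> carrier H \<Longrightarrow>
      (\<Oplus>x\<in>carrier \<Gamma>. c i x \<otimes> f x) \<in> carrier k"
    and dual: "\<And>x y. x \<in> carrier \<Gamma> \<Longrightarrow> y \<in> carrier \<Gamma> \<Longrightarrow>
      (\<Oplus>i\<in>carrier \<Gamma>. h i x \<otimes> c i y) = (if x = y then \<one> else \<zero>)"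
begin

lemma val [simp]: "f \<in> carrier H \<Longrightarrow> x \<in> carrier \<Gamma> \<Longrightarrow> f x \<in> carrier L"
  using carrier_sub by blast

lemma fun_eqI:
  assumes "f \<in> carrier H" "g \<in> carrier H" "\<And>x. x \<in> carrier \<Gamma> \<Longrightarrow> f x = g x"
  shows "f = g"
  using assms carrier_sub by (intro PiE_ext[of f "carrier \<Gamma>" "\<lambda>_. carrier L" g]) auto

lemma eval_ops [simp]:
  assumes "x \<in> carrier \<Gamma>"
  shows "(f \<otimes>\<^bsub>H\<^esub> g) x = f x \<otimes> g x" "\<one>\<^bsub>H\<^esub> x = \<one>" "(f \<oplus>\<^bsub>H\<^esub> g) x = f x \<oplus> g x"
    "\<zero>\<^bsub>H\<^esub> x = \<zero>" "(r \<odot>\<^bsub>H\<^esub> f) x = r \<otimes> f x"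
  using assms by (simp_all add: ops fun_algebra_sel)

declare closed [simp]

lemma H_abelian_group: "abelian_group H"
proof (rule abelian_groupI)
  show "\<exists>g\<in>carrier H. g \<oplus>\<^bsub>H\<^esub> f = \<zero>\<^bsub>H\<^esub>" if "f \<in> carrier H" for f
  proof
    \<comment> \<open>The negative of a function is its multiple by the scalar \<open>-1\<close> of \<open>k\<close>.\<close>
    have m: "\<ominus>\<^bsub>k\<^esub> \<one>\<^bsub>k\<^esub> \<in> carrier k" by (rule k.a_inv_closed) (rule k.one_closed)
    have "\<ominus>\<^bsub>k\<^esub> \<one>\<^bsub>k\<^esub> \<oplus> \<one> = \<zero>"
      using k.l_neg[OF k.one_closed] by simp
    then have z: "(\<ominus>\<^bsub>k\<^esub> \<one>\<^bsub>k\<^esub>) \<otimes> z \<oplus> z = \<zero>" if "z \<in> carrier L" for z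
      using L.l_distr[of "\<ominus>\<^bsub>k\<^esub> \<one>\<^bsub>k\<^esub>" "\<one>" z] that k_in_L[OF m] by simp
    show "(\<ominus>\<^bsub>k\<^esub> \<one>\<^bsub>k\<^esub>) \<odot>\<^bsub>H\<^esub> f \<in> carrier H" using m that by simp
    then show "((\<ominus>\<^bsub>k\<^esub> \<one>\<^bsub>k\<^esub>) \<odot>\<^bsub>H\<^esub> f) \<oplus>\<^bsub>H\<^esub> f = \<zero>\<^bsub>H\<^esub>"
      using that z by (intro fun_eqI) (simp_all del: k_ops)
  qed
qed (auto intro!: fun_eqI simp: L.a_ac)

lemma H_module: "module k H"
  by (rule moduleI)
    (auto intro!: fun_eqI simp: L.l_distr L.r_distr L.m_assoc k_in_L H_abelian_group k.cring_axioms)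

lemma H_cring: "cring H"
proof -
  interpret abelian_group H by (rule H_abelian_group)
  show ?thesis
    by (intro cringI abelian_group_axioms comm_monoidI)
      (auto intro!: fun_eqI simp: L.l_distr L.r_distr L.m_ac)
qed

lemma H_assoc_algebra: "assoc_algebra k H"
proof -
  interpret module k H by (rule H_module)
  interpret H: cring H by (rule H_cring)
  show ?thesis
    by unfold_locales (auto intro!: fun_eqI simp: L.m_ac k_in_L)
qed

lemma H_mult_bilinear: "bilinear_map k H H H (monoid.mult H)"
  by (rule bilinear_mapI) (auto intro!: fun_eqI simp: L.l_distr L.r_distr L.m_ac k_in_L)

lemma eval_hom: "x \<in> carrier \<Gamma> \<Longrightarrow> (\<lambda>f. f x) \<in> module_hom k H (self_algebra L)"
  by (rule module_homI) auto

text \<open>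
  Duality says that the matrices \<open>h\<^sub>i(x)\<close> and \<open>c\<^sub>i(y)\<close> are inverse to each other, hence a completeness
  relation: the expansion holds for every function with values in \<open>L\<close>, whether or not it lies in \<open>H\<close>.
\<close>

lemma dual_expand:
  assumes x: "x \<in> carrier \<Gamma>" and F: "\<And>y. y \<in> carrier \<Gamma> \<Longrightarrow> F y \<in> carrier L"
  shows "(\<Oplus>i\<in>carrier \<Gamma>. h i x \<otimes> (\<Oplus>y\<in>carrier \<Gamma>. c i y \<otimes> F y)) = F x"
proof -
  have "(\<Oplus>i\<in>carrier \<Gamma>. h i x \<otimes> (\<Oplus>y\<in>carrier \<Gamma>. c i y \<otimes> F y)) =
      (\<Oplus>i\<in>carrier \<Gamma>. \<Oplus>y\<in>carrier \<Gamma>. h i x \<otimes> c i y \<otimes> F y)"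
  proof (rule L.finsum_cong'[OF refl])
    fix i assume i: "i \<in> carrier \<Gamma>"
    have "h i x \<otimes> (\<Oplus>y\<in>carrier \<Gamma>. c i y \<otimes> F y) =
        (\<Oplus>y\<in>carrier \<Gamma>. h i x \<otimes> (c i y \<otimes> F y))"
      using x h[OF i] c[OF i] F fin by (intro L.finsum_rdistr) auto
    also have "\<dots> = (\<Oplus>y\<in>carrier \<Gamma>. h i x \<otimes> c i y \<otimes> F y)"
      using x h[OF i] c[OF i] F by (intro L.finsum_cong') (auto simp: L.m_assoc)
    finally show "h i x \<otimes> (\<Oplus>y\<in>carrier \<Gamma>. c i y \<otimes> F y) =
        (\<Oplus>y\<in>carrier \<Gamma>. h i x \<otimes> c i y \<otimes> F y)" .
  qed (use x h c F in auto)
  also have "\<dots> = (\<Oplus>y\<in>carrier \<Gamma>. \<Oplus>i\<in>carrier \<Gamma>. h i x \<otimes> c i y \<otimes> F y)"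
    using x h c F fin by (intro L.finsum_finsum_swap) auto
  also have "\<dots> = (\<Oplus>y\<in>carrier \<Gamma>. if x = y then F y else \<zero>)"
  proof (rule L.finsum_cong'[OF refl])
    show "(\<Oplus>i\<in>carrier \<Gamma>. h i x \<otimes> c i y \<otimes> F y) = (if x = y then F y else \<zero>)"
      if y: "y \<in> carrier \<Gamma>" for y
      using L.finsum_ldistr[of "carrier \<Gamma>" "F y" "\<lambda>i. h i x \<otimes> c i y"] x y h c F fin dual[OF x y]
      by (auto simp: Pi_def)
  qed (use F in auto)
  also have "\<dots> = F x" using x F fin by (intro L.add.finprod_singleton) auto
  finally show ?thesis .
qed

text \<open>
  For members of \<open>H\<close> the coefficients lie in \<open>k\<close>, so that the expansion takes place in the \<open>k\<close>-module
  \<open>H\<close> itself.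
\<close>

lemma H_coordinates: "coordinates k L H (carrier \<Gamma>) (\<lambda>x f. f x) (carrier \<Gamma>) h c"
proof -
  interpret H: module k H by (rule H_module)
  have "f = (\<Oplus>\<^bsub>H\<^esub>i\<in>carrier \<Gamma>. (\<Oplus>y\<in>carrier \<Gamma>. c i y \<otimes> f y) \<odot>\<^bsub>H\<^esub> h i)"
    if f: "f \<in> carrier H" for f
  proof (rule fun_eqI[OF f])
    let ?s = "\<Oplus>\<^bsub>H\<^esub>i\<in>carrier \<Gamma>. (\<Oplus>y\<in>carrier \<Gamma>. c i y \<otimes> f y) \<odot>\<^bsub>H\<^esub> h i"
    show "?s \<in> carrier H" using h coef f by (intro H.M.finsum_closed) auto
    fix x assume x: "x \<in> carrier \<Gamma>"
    have "?s x = (\<Oplus>i\<in>carrier \<Gamma>. ((\<Oplus>y\<in>carrier \<Gamma>. c i y \<otimes> f y) \<odot>\<^bsub>H\<^esub> h i) x)"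
      using module_hom_finsum[OF H_module L_module eval_hom[OF x],
          of "\<lambda>i. (\<Oplus>y\<in>carrier \<Gamma>. c i y \<otimes> f y) \<odot>\<^bsub>H\<^esub> h i" "carrier \<Gamma>"] h coef f by simp
    also have "\<dots> = (\<Oplus>i\<in>carrier \<Gamma>. h i x \<otimes> (\<Oplus>y\<in>carrier \<Gamma>. c i y \<otimes> f y))"
      using x h coef f k_in_L by (intro L.finsum_cong') (auto simp: L.m_comm)
    also have "\<dots> = f x" using f by (intro dual_expand[OF x]) auto
    finally show "f x = ?s x" ..
  qed
  then show ?thesis
    unfolding coordinates_def using eval_hom h c coef by blast
qed

text \<open>
  \<open>ev x y\<close> is the value at \<open>(x, y)\<close> of an element of \<open>H \<otimes> H\<close>, regarded as a function of two variables.
  By \<open>tensor_separation\<close> these values determine the element.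
\<close>

definition ev :: "'g \<Rightarrow> 'g \<Rightarrow> (('g \<Rightarrow> 'a) \<times> ('g \<Rightarrow> 'a) \<Rightarrow> 'a) set \<Rightarrow> 'a" where
  "ev x y = tensor_lift k (self_algebra L) (\<lambda>a b. a x \<otimes> b y)"

lemma ev_bilinear:
  assumes "x \<in> carrier \<Gamma>" "y \<in> carrier \<Gamma>"
  shows "bilinear_map k H H (self_algebra L) (\<lambda>a b. a x \<otimes> b y)"
  by (rule mult_coordinates_bilinear[OF eval_hom eval_hom]) (use assms in auto)

lemma ev_hom:
  assumes "x \<in> carrier \<Gamma>" "y \<in> carrier \<Gamma>"
  shows "ev x y \<in> module_hom k (tensor_module k H H) (self_algebra L)"
  unfolding ev_def by (rule tensor_lift_hom[OF H_module H_module L_module ev_bilinear[OF assms]])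

lemma ev_pure:
  assumes "x \<in> carrier \<Gamma>" "y \<in> carrier \<Gamma>" "f \<in> carrier H" "g \<in> carrier H"
  shows "ev x y (pure_tensor k H H f g) = f x \<otimes> g y"
  unfolding ev_def by (rule tensor_lift_pure[OF H_module H_module L_module ev_bilinear[OF assms(1,2)] assms(3,4)])

lemma HH_module: "module k (tensor_module k H H)"
  by (rule tensor_module_module[OF H_module H_module])

lemma ev_zero:
  assumes "t \<in> carrier (tensor_module k H H)"
    and "\<And>x y. x \<in> carrier \<Gamma> \<Longrightarrow> y \<in> carrier \<Gamma> \<Longrightarrow> ev x y t = \<zero>"
  shows "t = \<zero>\<^bsub>tensor_module k H H\<^esub>"
proof (rule tensor_separation[OF H_module H_module H_coordinates, where Y = "carrier \<Gamma>" and q = "\<lambda>y g. g y"])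
  interpret H: module k H by (rule H_module)
  show "g = \<zero>\<^bsub>H\<^esub>" if "g \<in> carrier H" "\<And>y. y \<in> carrier \<Gamma> \<Longrightarrow> g y = \<zero>" for g
    using that by (intro fun_eqI) auto
qed (use assms in \<open>simp_all add: eval_hom ev_def\<close>)

lemma ev_inj:
  assumes s: "s \<in> carrier (tensor_module k H H)" and t: "t \<in> carrier (tensor_module k H H)"
    and eq: "\<And>x y. x \<in> carrier \<Gamma> \<Longrightarrow> y \<in> carrier \<Gamma> \<Longrightarrow> ev x y s = ev x y t"
  shows "s = t"
proof -
  interpret T: module k "tensor_module k H H" by (rule HH_module)
  have "s \<ominus>\<^bsub>tensor_module k H H\<^esub> t = \<zero>\<^bsub>tensor_module k H H\<^esub>"
  proof (rule ev_zero)
    fix x y assume xy: "x \<in> carrier \<Gamma>" "y \<in> carrier \<Gamma>"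
    interpret mod_hom k "tensor_module k H H" "self_algebra L" "ev x y"
      by (simp add: mod_hom_def mod_hom_axioms_def HH_module L_module ev_hom xy)
    interpret SL: module k "self_algebra L" by (rule L_module)
    have "ev x y (s \<ominus>\<^bsub>tensor_module k H H\<^esub> t) = ev x y s \<ominus>\<^bsub>self_algebra L\<^esub> ev x y t"
      using s t by (rule f_minus)
    also have "\<dots> = \<zero>\<^bsub>self_algebra L\<^esub>" using eq[OF xy] module_hom_mem[OF ev_hom[OF xy] t]
      by (subst abelian_group.minus_other_side[OF module.axioms(2)[OF L_module]]) simp_all
    finally show "ev x y (s \<ominus>\<^bsub>tensor_module k H H\<^esub> t) = \<zero>" by simp
  qed (use s t in simp)
  then show ?thesis using s t by simp
qed

lemma ev_mult:
  assumes x: "x \<in> carrier \<Gamma>" and y: "y \<in> carrier \<Gamma>"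
    and s: "s \<in> carrier (tensor_module k H H)" and t: "t \<in> carrier (tensor_module k H H)"
  shows "ev x y (s \<otimes>\<^bsub>tensor_algebra k H H\<^esub> t) = ev x y s \<otimes> ev x y t"
proof -
  interpret T: module k "tensor_module k H H" by (rule HH_module)
  note mult = bilinear_mapD[OF tensor_algebra_mult_bilinear[OF H_module H_module H_mult_bilinear H_mult_bilinear]]
  note mult_pure = tensor_algebra_mult_pure[OF H_module H_module H_mult_bilinear H_mult_bilinear]
  note hom = module_hom_mem[OF ev_hom[OF x y], simplified] module_hom_add[OF ev_hom[OF x y], simplified]
  note pure = bilinear_mapD[OF pure_tensor_bilinear[OF H_module H_module]]
  show ?thesis
  proof (rule tensor_induct[OF H_module H_module s])
    fix a b assume ab: "a \<in> carrier H" "b \<in> carrier H"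
    show "ev x y (pure_tensor k H H a b \<otimes>\<^bsub>tensor_algebra k H H\<^esub> t) =
        ev x y (pure_tensor k H H a b) \<otimes> ev x y t"
      by (rule tensor_induct[OF H_module H_module t])
        (use ab x y in \<open>simp_all add: mult_pure mult(1,3) pure(1) hom ev_pure L.m_ac L.r_distr\<close>)
  qed (use t in \<open>simp add: mult(1,2) hom L.l_distr\<close>)
qed

text \<open>
  Expanding \<open>F\<close> in its first variable writes it as the sum of \<open>h\<^sub>i(x) p\<^sub>i(y)\<close>, where \<open>p\<^sub>i\<close> is the \<open>i\<close>-th
  coefficient as a function of the second variable. If each \<open>p\<^sub>i\<close> lies in \<open>H\<close>, this is the sum of the
  tensors \<open>h\<^sub>i \<otimes> p\<^sub>i\<close>.
\<close>

lemma two_variable_function: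
  assumes F: "\<And>x y. x \<in> carrier \<Gamma> \<Longrightarrow> y \<in> carrier \<Gamma> \<Longrightarrow> F x y \<in> carrier L"
    and part: "\<And>i. i \<in> carrier \<Gamma> \<Longrightarrow>
      (\<lambda>y\<in>carrier \<Gamma>. \<Oplus>x\<in>carrier \<Gamma>. c i x \<otimes> F x y) \<in> carrier H"
  shows "\<exists>t\<in>carrier (tensor_module k H H). \<forall>x\<in>carrier \<Gamma>. \<forall>y\<in>carrier \<Gamma>. ev x y t = F x y"
proof -
  interpret T: module k "tensor_module k H H" by (rule HH_module)
  let ?p = "\<lambda>i. \<lambda>y\<in>carrier \<Gamma>. \<Oplus>x\<in>carrier \<Gamma>. c i x \<otimes> F x y"
  have mem: "(\<lambda>i. pure_tensor k H H (h i) (?p i)) \<in> carrier \<Gamma> \<rightarrow> carrier (tensor_module k H H)"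
    using h part bilinear_mapD(1)[OF pure_tensor_bilinear[OF H_module H_module]] by blast
  have "ev x y (\<Oplus>\<^bsub>tensor_module k H H\<^esub>i\<in>carrier \<Gamma>. pure_tensor k H H (h i) (?p i)) = F x y"
    if x: "x \<in> carrier \<Gamma>" and y: "y \<in> carrier \<Gamma>" for x y
  proof -
    have "ev x y (\<Oplus>\<^bsub>tensor_module k H H\<^esub>i\<in>carrier \<Gamma>. pure_tensor k H H (h i) (?p i)) =
        (\<Oplus>i\<in>carrier \<Gamma>. ev x y (pure_tensor k H H (h i) (?p i)))"
      using module_hom_finsum[OF HH_module L_module ev_hom[OF x y] mem] by simp
    also have "\<dots> = (\<Oplus>i\<in>carrier \<Gamma>. h i x \<otimes> (\<Oplus>x'\<in>carrier \<Gamma>. c i x' \<otimes> F x' y))"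
    proof (rule L.finsum_cong'[OF refl])
      show "(\<lambda>i. h i x \<otimes> (\<Oplus>x'\<in>carrier \<Gamma>. c i x' \<otimes> F x' y)) \<in> carrier \<Gamma> \<rightarrow> carrier L"
        using x y h c F by (auto intro!: L.finsum_closed)
    qed (use x y h part ev_pure[OF x y] in simp)
    also have "\<dots> = F x y" using F y by (intro dual_expand[OF x]) auto
    finally show ?thesis .
  qed
  then show ?thesis using T.M.finsum_closed[OF mem] by blast
qed

end

text \<open>
  The comultiplication is not given by a formula: it is characterised by the values of its image,
  regarded as a function of two variables. In this way the locale includes both \<open>Fun(\<Gamma>, k)\<close>, where
  the comultiplication is an explicit sum, and its twisted forms.
\<close>

locale function_form = function_module k L \<Gamma> H h c
  for k :: "'a ring" and L :: "'a ring" (structure) and \<Gamma> :: "('g, 'n) monoid_scheme"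
    and H :: "('a, 'g \<Rightarrow> 'a, 'x) hopf_scheme" and h c :: "'g \<Rightarrow> 'g \<Rightarrow> 'a" +
  assumes counit: "\<And>f. f \<in> carrier H \<Longrightarrow> counit H f = f \<one>\<^bsub>\<Gamma>\<^esub>"
      "\<And>f. f \<in> carrier H \<Longrightarrow> f \<one>\<^bsub>\<Gamma>\<^esub> \<in> carrier k"
    and antipode: "\<And>f. f \<in> carrier H \<Longrightarrow> antipode H f = (\<lambda>x\<in>carrier \<Gamma>. f (inv\<^bsub>\<Gamma>\<^esub> x))"
      "\<And>f. f \<in> carrier H \<Longrightarrow> antipode H f \<in> carrier H"
    and comult: "\<And>f. f \<in> carrier H \<Longrightarrow> comult H f \<in> carrier (tensor_module k H H)"
      "\<And>f x y. f \<in> carrier H \<Longrightarrow> x \<in> carrier \<Gamma> \<Longrightarrow> y \<in> carrier \<Gamma> \<Longrightarrow>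
        tensor_lift k (self_algebra L) (\<lambda>a b. a x \<otimes> b y) (comult H f) = f (x \<otimes>\<^bsub>\<Gamma>\<^esub> y)"
begin

lemma ev_comult:
  "f \<in> carrier H \<Longrightarrow> x \<in> carrier \<Gamma> \<Longrightarrow> y \<in> carrier \<Gamma> \<Longrightarrow> ev x y (comult H f) = f (x \<otimes>\<^bsub>\<Gamma>\<^esub> y)"
  unfolding ev_def by (rule comult)

lemma comult_module_hom: "comult H \<in> module_hom k H (tensor_module k H H)"
proof (rule module_homI)
  interpret T: module k "tensor_module k H H" by (rule HH_module)
  show "comult H (f \<oplus>\<^bsub>H\<^esub> g) = comult H f \<oplus>\<^bsub>tensor_module k H H\<^esub> comult H g"
    if "f \<in> carrier H" "g \<in> carrier H" for f g
    by (rule ev_inj) (use that in \<open>simp_all add: comult(1) ev_comult module_hom_add[OF ev_hom]\<close>)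
  show "comult H (r \<odot>\<^bsub>H\<^esub> f) = r \<odot>\<^bsub>tensor_module k H H\<^esub> comult H f"
    if "r \<in> carrier k" "f \<in> carrier H" for r f
    by (rule ev_inj) (use that in \<open>simp_all add: comult(1) ev_comult module_hom_smult[OF ev_hom]\<close>)
qed (rule comult(1))

lemma comult_algebra_hom: "comult H \<in> algebra_hom k H (tensor_algebra k H H)"
proof -
  note mult = bilinear_mapD[OF tensor_algebra_mult_bilinear[OF H_module H_module H_mult_bilinear H_mult_bilinear]]
  note pure = bilinear_mapD[OF pure_tensor_bilinear[OF H_module H_module]]
  have "comult H \<in> ring_hom H (tensor_algebra k H H)"
  proof (rule ring_hom_memI)
    show "comult H (f \<otimes>\<^bsub>H\<^esub> g) = comult H f \<otimes>\<^bsub>tensor_algebra k H H\<^esub> comult H g"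
      if "f \<in> carrier H" "g \<in> carrier H" for f g
      by (rule ev_inj) (use that in \<open>simp_all add: comult(1) ev_comult ev_mult mult(1)\<close>)
    show "comult H \<one>\<^bsub>H\<^esub> = \<one>\<^bsub>tensor_algebra k H H\<^esub>"
      by (rule ev_inj) (simp_all add: comult(1) ev_comult ev_pure pure(1))
  qed (simp_all add: comult(1) module_hom_add[OF comult_module_hom])
  moreover have "comult H \<in> module_hom k H (tensor_algebra k H H)"
    using comult_module_hom by (simp add: module_hom_def)
  ultimately show ?thesis by (simp add: algebra_hom_def)
qed

lemma antipode_hom: "antipode H \<in> module_hom k H H"
proof (rule module_homI)
  show "antipode H (f \<oplus>\<^bsub>H\<^esub> g) = antipode H f \<oplus>\<^bsub>H\<^esub> antipode H g"
    if "f \<in> carrier H" "g \<in> carrier H" for f g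
    by (rule fun_eqI) (use that antipode(2) in \<open>simp_all add: antipode(1)\<close>)
  show "antipode H (r \<odot>\<^bsub>H\<^esub> f) = r \<odot>\<^bsub>H\<^esub> antipode H f"
    if "r \<in> carrier k" "f \<in> carrier H" for r f
    by (rule fun_eqI) (use that antipode(2) in \<open>simp_all add: antipode(1)\<close>)
qed (rule antipode(2))

lemma counit_algebra_hom: "counit H \<in> algebra_hom k H (self_algebra k)"
  unfolding algebra_hom_def
  by (intro IntI ring_hom_memI module_homI) (simp_all add: counit)

lemma counit_in_k [simp]: "f \<in> carrier H \<Longrightarrow> counit H f \<in> carrier k"
  by (simp add: counit)

text \<open>
  Both sides of the coassociativity law have the value \<open>f (x y z)\<close> at \<open>(x, y, z)\<close>, and elements of
  \<open>H \<otimes> (H \<otimes> H)\<close> are determined by their values as functions of three variables.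
\<close>

lemma comult_coassoc:
  assumes f: "f \<in> carrier H"
  shows "tensor_assoc k H H H (tensor_map k (tensor_module k H H) H (comult H) id (comult H f)) =
    tensor_map k H (tensor_module k H H) id (comult H) (comult H f)"
proof -
  let ?HH = "tensor_module k H H"
  let ?T = "tensor_module k H ?HH"
  have T: "module k ?T" by (rule tensor_module_module[OF H_module HH_module])
  interpret T: module k ?T by (rule T)
  interpret SL: module k "self_algebra L" by (rule L_module)
  define ev3 where "ev3 x y z = tensor_lift k (self_algebra L) (\<lambda>a u. a x \<otimes> ev y z u)"
    for x y z :: 'g
  have bil3: "bilinear_map k H ?HH (self_algebra L) (\<lambda>a u. a x \<otimes> ev y z u)"
    if "x \<in> carrier \<Gamma>" "y \<in> carrier \<Gamma>" "z \<in> carrier \<Gamma>" for x y z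
    by (rule mult_coordinates_bilinear[OF eval_hom[OF that(1)] ev_hom[OF that(2,3)]])
  note ev3_hom = tensor_lift_hom[OF H_module HH_module L_module bil3, folded ev3_def]
  note ev3_pure = tensor_lift_pure[OF H_module HH_module L_module bil3, folded ev3_def]
  have ev3_inj: "s = t" if s: "s \<in> carrier ?T" and t: "t \<in> carrier ?T"
    and eq: "\<And>x y z. x \<in> carrier \<Gamma> \<Longrightarrow> y \<in> carrier \<Gamma> \<Longrightarrow> z \<in> carrier \<Gamma> \<Longrightarrow> ev3 x y z s = ev3 x y z t" for s t
  proof -
    have "s \<ominus>\<^bsub>?T\<^esub> t = \<zero>\<^bsub>?T\<^esub>"
    proof (rule tensor_separation[OF H_module HH_module H_coordinates,
        where Y = "carrier \<Gamma> \<times> carrier \<Gamma>" and q = "\<lambda>(y, z). ev y z"])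
      fix x p assume x: "x \<in> carrier \<Gamma>" and "p \<in> carrier \<Gamma> \<times> carrier \<Gamma>"
      then obtain y z where p: "p = (y, z)" "y \<in> carrier \<Gamma>" "z \<in> carrier \<Gamma>" by auto
      interpret mod_hom k ?T "self_algebra L" "ev3 x y z"
        by (simp add: mod_hom_def mod_hom_axioms_def T L_module ev3_hom x p)
      have "ev3 x y z (s \<ominus>\<^bsub>?T\<^esub> t) = ev3 x y z s \<ominus>\<^bsub>self_algebra L\<^esub> ev3 x y z t"
        using s t by (rule f_minus)
      also have "\<dots> = \<zero>\<^bsub>self_algebra L\<^esub>"
        using eq[OF x p(2,3)] module_hom_mem[OF ev3_hom[OF x p(2,3)] t]
        by (subst abelian_group.minus_other_side[OF module.axioms(2)[OF L_module]]) simp_all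
      finally show "tensor_lift k (self_algebra L) (\<lambda>m n. m x \<otimes> (case p of (y, z) \<Rightarrow> ev y z) n)
          (s \<ominus>\<^bsub>?T\<^esub> t) = \<zero>"
        by (simp add: p ev3_def)
    next
      fix u assume u: "u \<in> carrier ?HH"
        "\<And>p. p \<in> carrier \<Gamma> \<times> carrier \<Gamma> \<Longrightarrow> (case p of (y, z) \<Rightarrow> ev y z) u = \<zero>"
      show "u = \<zero>\<^bsub>?HH\<^esub>" by (rule ev_zero[OF u(1)]) (use u(2) in force)
    qed (use s t ev_hom in auto)
    then show ?thesis using s t by simp
  qed
  note assoc_hom = tensor_assoc_hom[OF H_module H_module H_module]
  note left_hom = tensor_map_hom[OF H_module H_module HH_module H_module comult_module_hom module_hom_id]
  note right_hom = tensor_map_hom[OF H_module H_module H_module HH_module module_hom_id comult_module_hom]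
  show ?thesis
  proof (rule ev3_inj)
    show "tensor_assoc k H H H (tensor_map k ?HH H (comult H) id (comult H f)) \<in> carrier ?T"
      by (intro module_hom_mem[OF assoc_hom] module_hom_mem[OF left_hom] comult f)
    show "tensor_map k H ?HH id (comult H) (comult H f) \<in> carrier ?T"
      by (intro module_hom_mem[OF right_hom] comult f)
    fix x y z assume xyz: "x \<in> carrier \<Gamma>" "y \<in> carrier \<Gamma>" "z \<in> carrier \<Gamma>"
    have inner: "ev3 x y z (tensor_lift k ?T (\<lambda>m n. pure_tensor k H ?HH m (pure_tensor k H H n p)) u) =
        ev x y u \<otimes> p z" if u: "u \<in> carrier ?HH" and p: "p \<in> carrier H" for u p
    proof (rule tensor_hom_unique[OF H_module H_module L_module _ _ _ u])
      show "(\<lambda>u. ev3 x y z (tensor_lift k ?T (\<lambda>m n. pure_tensor k H ?HH m (pure_tensor k H H n p)) u))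
          \<in> module_hom k ?HH (self_algebra L)"
        by (rule module_hom_comp[OF tensor_assoc_inner_hom[OF H_module H_module H_module p] ev3_hom[OF xyz]])
      show "(\<lambda>u. ev x y u \<otimes> p z) \<in> module_hom k ?HH (self_algebra L)"
        using ev_hom[OF xyz(1,2)] p xyz by (auto simp: module_hom_def Pi_def L.l_distr L.m_assoc k_in_L)
    qed (use p xyz in \<open>simp add: tensor_assoc_inner_pure[OF H_module H_module H_module] ev3_pure ev_pure
           pure_tensor_closed[OF H_module H_module] L.m_assoc\<close>)
    have "ev3 x y z (tensor_assoc k H H H (tensor_map k ?HH H (comult H) id (comult H f))) =
        ev (x \<otimes>\<^bsub>\<Gamma>\<^esub> y) z (comult H f)"
      by (rule tensor_hom_unique[OF H_module H_module L_module
            module_hom_comp[OF module_hom_comp[OF left_hom assoc_hom] ev3_hom] ev_hom])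
        (use xyz f in \<open>simp_all add: comult tensor_map_pure[OF H_module H_module HH_module H_module comult_module_hom module_hom_id]
           tensor_assoc_pure[OF H_module H_module H_module] inner ev_pure ev_comult\<close>)
    also have "\<dots> = f (x \<otimes>\<^bsub>\<Gamma>\<^esub> (y \<otimes>\<^bsub>\<Gamma>\<^esub> z))" using xyz f by (simp add: ev_comult G.m_assoc)
    also have "\<dots> = ev x (y \<otimes>\<^bsub>\<Gamma>\<^esub> z) (comult H f)" using xyz f by (simp add: ev_comult)
    also have "\<dots> = ev3 x y z (tensor_map k H ?HH id (comult H) (comult H f))"
      by (rule tensor_hom_unique[OF H_module H_module L_module ev_hom module_hom_comp[OF right_hom ev3_hom]])
        (use xyz f in \<open>simp_all add: comult tensor_map_pure[OF H_module H_module H_module HH_module module_hom_id comult_module_hom]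
           ev3_pure ev_pure ev_comult\<close>)
    finally show "ev3 x y z (tensor_assoc k H H H (tensor_map k ?HH H (comult H) id (comult H f))) =
        ev3 x y z (tensor_map k H ?HH id (comult H) (comult H f))" .
  qed
qed

text \<open>
  The counit and antipode axioms apply to the comultiplication of \<open>f\<close> a bilinear operation whose result
  at \<open>x\<close> is a product of values at two points \<open>y\<close> and \<open>z\<close>. The outcome is then \<open>f(y z)\<close>.
\<close>

lemma lift_comult_value:
  assumes f: "f \<in> carrier H" and b: "bilinear_map k H H H b"
    and x: "x \<in> carrier \<Gamma>" and y: "y \<in> carrier \<Gamma>" "z \<in> carrier \<Gamma>"
    and eq: "\<And>u v. u \<in> carrier H \<Longrightarrow> v \<in> carrier H \<Longrightarrow> b u v x = u y \<otimes> v z"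
  shows "tensor_lift k H b (comult H f) x = f (y \<otimes>\<^bsub>\<Gamma>\<^esub> z)"
  using tensor_lift_comp[OF H_module H_module H_module L_module b eval_hom[OF x],
      of "\<lambda>u v. u y \<otimes> v z" "comult H f"] ev_comult[OF f y]
  by (simp add: comult(1)[OF f] eq ev_def)

text \<open>
  The pairs of points at which the four remaining axioms are evaluated are \<open>(1, x)\<close>, \<open>(x, 1)\<close>,
  \<open>(x\<inverse>, x)\<close> and \<open>(x, x\<inverse>)\<close>.
\<close>

theorem hopf_algebra: "hopf_algebra k H"
proof (intro hopf_algebra.intro hopf_algebra_axioms.intro H_assoc_algebra
    comult_algebra_hom counit_algebra_hom antipode_hom comult_coassoc)
  interpret H: module k H by (rule H_module)
  have cl: "bilinear_map k H H H (\<lambda>a b. counit H a \<odot>\<^bsub>H\<^esub> b)"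
    by (rule bilinear_mapI; (rule fun_eqI)?) (simp_all add: counit L.l_distr L.r_distr L.m_ac k_in_L)
  have cr: "bilinear_map k H H H (\<lambda>a b. counit H b \<odot>\<^bsub>H\<^esub> a)"
    by (rule bilinear_mapI; (rule fun_eqI)?) (simp_all add: counit L.l_distr L.r_distr L.m_ac k_in_L)
  have al: "bilinear_map k H H H (\<lambda>a b. antipode H a \<otimes>\<^bsub>H\<^esub> b)"
    using bilinear_map_comp2[OF H_mult_bilinear antipode_hom module_hom_id] by simp
  have ar: "bilinear_map k H H H (\<lambda>a b. a \<otimes>\<^bsub>H\<^esub> antipode H b)"
    using bilinear_map_comp2[OF H_mult_bilinear module_hom_id antipode_hom] by simp
  note lift = module_hom_mem[OF tensor_lift_hom[OF H_module H_module H_module] comult(1)]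
  fix f assume f: "f \<in> carrier H"
  show "tensor_lift k H (\<lambda>a b. counit H a \<odot>\<^bsub>H\<^esub> b) (comult H f) = f"
    by (rule fun_eqI[OF lift[OF cl f] f], subst lift_comult_value[OF f cl, where y = "\<one>\<^bsub>\<Gamma>\<^esub>"])
      (auto simp: counit)
  show "tensor_lift k H (\<lambda>a b. counit H b \<odot>\<^bsub>H\<^esub> a) (comult H f) = f"
  proof (rule fun_eqI[OF lift[OF cr f] f])
    fix x assume x: "x \<in> carrier \<Gamma>"
    show "tensor_lift k H (\<lambda>a b. counit H b \<odot>\<^bsub>H\<^esub> a) (comult H f) x = f x"
      using x lift_comult_value[OF f cr, of x x "\<one>\<^bsub>\<Gamma>\<^esub>"] by (simp add: counit L.m_comm)
  qed
  have unit: "counit H f \<odot>\<^bsub>H\<^esub> \<one>\<^bsub>H\<^esub> \<in> carrier H" using f by simp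
  show "tensor_lift k H (\<lambda>a b. antipode H a \<otimes>\<^bsub>H\<^esub> b) (comult H f) = counit H f \<odot>\<^bsub>H\<^esub> \<one>\<^bsub>H\<^esub>"
  proof (rule fun_eqI[OF lift[OF al f] unit])
    fix x assume x: "x \<in> carrier \<Gamma>"
    then show "tensor_lift k H (\<lambda>a b. antipode H a \<otimes>\<^bsub>H\<^esub> b) (comult H f) x = (counit H f \<odot>\<^bsub>H\<^esub> \<one>\<^bsub>H\<^esub>) x"
      using lift_comult_value[OF f al x, of "inv\<^bsub>\<Gamma>\<^esub> x" x] f by (simp add: antipode counit)
  qed
  show "tensor_lift k H (\<lambda>a b. a \<otimes>\<^bsub>H\<^esub> antipode H b) (comult H f) = counit H f \<odot>\<^bsub>H\<^esub> \<one>\<^bsub>H\<^esub>"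
  proof (rule fun_eqI[OF lift[OF ar f] unit])
    fix x assume x: "x \<in> carrier \<Gamma>"
    then show "tensor_lift k H (\<lambda>a b. a \<otimes>\<^bsub>H\<^esub> antipode H b) (comult H f) x = (counit H f \<odot>\<^bsub>H\<^esub> \<one>\<^bsub>H\<^esub>) x"
      using lift_comult_value[OF f ar x, of x "inv\<^bsub>\<Gamma>\<^esub> x"] f by (simp add: antipode counit)
  qed
qed

end

section \<open>Extension of scalars splits a function form\<close>

lemma base_change_sel [simp]:
  "carrier (base_change k L H) = carrier (base_change_algebra k L H)"
  "ring.add (base_change k L H) = ring.add (base_change_algebra k L H)"
  "ring.zero (base_change k L H) = ring.zero (base_change_algebra k L H)"
  "monoid.mult (base_change k L H) = monoid.mult (base_change_algebra k L H)"
  "monoid.one (base_change k L H) = monoid.one (base_change_algebra k L H)"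
  "smult (base_change k L H) = smult (base_change_algebra k L H)"
  "comult (base_change k L H) =
     (let B = base_change_algebra k L H; BB = tensor_module L B B;
        pt = pure_tensor k H (self_algebra L) in
      tensor_lift k BB (\<lambda>h l.
             tensor_lift k BB (\<lambda>h1 h2. pure_tensor L B B (pt h1 \<one>\<^bsub>L\<^esub>) (pt h2 l)) (comult H h)))"
  "counit (base_change k L H) = tensor_lift k (self_algebra L) (\<lambda>h l. counit H h \<otimes>\<^bsub>L\<^esub> l)"
  "antipode (base_change k L H) = tensor_map k H (self_algebra L) (antipode H) id"
  by (simp_all add: base_change_def Let_def module.extend_def hopf.fields_def)

lemma fun_hopf_sel [simp]:
  "carrier (fun_hopf \<Gamma> R) = carrier \<Gamma> \<rightarrow>\<^sub>E carrier R"
  "ring.add (fun_hopf \<Gamma> R) = ring.add (fun_algebra \<Gamma> R)"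
  "ring.zero (fun_hopf \<Gamma> R) = ring.zero (fun_algebra \<Gamma> R)"
  "monoid.mult (fun_hopf \<Gamma> R) = monoid.mult (fun_algebra \<Gamma> R)"
  "monoid.one (fun_hopf \<Gamma> R) = monoid.one (fun_algebra \<Gamma> R)"
  "smult (fun_hopf \<Gamma> R) = smult (fun_algebra \<Gamma> R)"
  "comult (fun_hopf \<Gamma> R) f =
     (let A = fun_algebra \<Gamma> R; T = tensor_module R A A in
        \<Oplus>\<^bsub>T\<^esub>p\<in>carrier \<Gamma> \<times> carrier \<Gamma>.
             f (fst p \<otimes>\<^bsub>\<Gamma>\<^esub> snd p) \<odot>\<^bsub>T\<^esub>
               pure_tensor R A A (point_fun \<Gamma> R (fst p)) (point_fun \<Gamma> R (snd p)))"
  "counit (fun_hopf \<Gamma> R) f = f \<one>\<^bsub>\<Gamma>\<^esub>"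
  "antipode (fun_hopf \<Gamma> R) f = (\<lambda>x\<in>carrier \<Gamma>. f (inv\<^bsub>\<Gamma>\<^esub> x))"
  by (simp_all add: fun_hopf_def Let_def module.extend_def hopf.fields_def fun_algebra_sel)

lemma (in extension) extension_refl: "extension L L"
  by unfold_locales (simp add: field_extension_def L.field_axioms L.carrier_is_subfield)

lemma fun_algebra_module:
  assumes "cring R"
  shows "module R (fun_algebra \<Gamma> R)"
proof -
  interpret R: cring R by fact
  let ?A = "fun_algebra \<Gamma> R"
  have val [simp]: "f x \<in> carrier R" if "f \<in> carrier ?A" "x \<in> carrier \<Gamma>" for f x
    using that by (auto simp: fun_algebra_sel)
  have eqI: "f = g" if "f \<in> carrier ?A" "g \<in> carrier ?A" "\<And>x. x \<in> carrier \<Gamma> \<Longrightarrow> f x = g x" for f g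
    using that unfolding fun_algebra_sel by (intro PiE_ext[of f "carrier \<Gamma>" "\<lambda>_. carrier R" g]) auto
  have [simp]: "(f \<oplus>\<^bsub>?A\<^esub> g) x = f x \<oplus>\<^bsub>R\<^esub> g x" "\<zero>\<^bsub>?A\<^esub> x = \<zero>\<^bsub>R\<^esub>" "(r \<odot>\<^bsub>?A\<^esub> f) x = r \<otimes>\<^bsub>R\<^esub> f x"
    if "x \<in> carrier \<Gamma>" for f g r x using that by (simp_all add: fun_algebra_sel)
  have [simp]: "f \<oplus>\<^bsub>?A\<^esub> g \<in> carrier ?A" "\<zero>\<^bsub>?A\<^esub> \<in> carrier ?A"
    if "f \<in> carrier ?A" "g \<in> carrier ?A" for f g
    using that by (auto simp: fun_algebra_sel PiE_mem)
  have [simp]: "r \<odot>\<^bsub>?A\<^esub> f \<in> carrier ?A" "\<zero>\<^bsub>?A\<^esub> \<in> carrier ?A"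
    if "f \<in> carrier ?A" "r \<in> carrier R" for f r
    using that by (auto simp: fun_algebra_sel PiE_mem)
  have zero [simp]: "\<zero>\<^bsub>?A\<^esub> \<in> carrier ?A" by (auto simp: fun_algebra_sel)
  have "abelian_group ?A"
  proof (rule abelian_groupI)
    fix f assume f: "f \<in> carrier ?A"
    show "\<exists>g\<in>carrier ?A. g \<oplus>\<^bsub>?A\<^esub> f = \<zero>\<^bsub>?A\<^esub>"
    proof
      show m: "(\<ominus>\<^bsub>R\<^esub> \<one>\<^bsub>R\<^esub>) \<odot>\<^bsub>?A\<^esub> f \<in> carrier ?A" using f by simp
      show "((\<ominus>\<^bsub>R\<^esub> \<one>\<^bsub>R\<^esub>) \<odot>\<^bsub>?A\<^esub> f) \<oplus>\<^bsub>?A\<^esub> f = \<zero>\<^bsub>?A\<^esub>"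
        using f m by (intro eqI) (simp_all add: R.l_minus R.l_neg)
    qed
  qed (auto intro!: eqI simp: R.a_ac)
  then show ?thesis
    by (intro moduleI) (auto intro!: eqI simp: R.l_distr R.r_distr R.m_assoc R.cring_axioms)
qed

text \<open>For functions with values in \<open>k\<close> the family of point functions is dual to itself.\<close>

lemma fun_hopf_form:
  assumes "extension k L" "group \<Gamma>" "finite (carrier \<Gamma>)"
  shows "function_form k L \<Gamma> (fun_hopf \<Gamma> k) (point_fun \<Gamma> k) (point_fun \<Gamma> k)"
proof -
  interpret extension k L by fact
  interpret G: group \<Gamma> by fact
  let ?A = "fun_algebra \<Gamma> k"
  let ?T = "tensor_module k ?A ?A"
  note A = fun_algebra_module[OF k.cring_axioms, of \<Gamma>]
  interpret T: module k ?T by (rule tensor_module_module[OF A A])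
  have pf: "point_fun \<Gamma> k i \<in> carrier \<Gamma> \<rightarrow>\<^sub>E carrier k" for i
    by (auto simp: point_fun_def)
  have pfA: "point_fun \<Gamma> k i \<in> carrier ?A" for i using pf by (simp add: fun_algebra_sel)
  have pf_val: "point_fun \<Gamma> k i x = (if x = i then \<one>\<^bsub>L\<^esub> else \<zero>\<^bsub>L\<^esub>)" if "x \<in> carrier \<Gamma>" for i x
    using that by (simp add: point_fun_def)
  have TT: "tensor_module k (fun_hopf \<Gamma> k) (fun_hopf \<Gamma> k) = ?T"
    by (rule tensor_module_cong) (simp_all add: fun_algebra_sel)
  note pure = bilinear_mapD[OF pure_tensor_bilinear[OF A A]]
  have eval: "(\<lambda>f. f x) \<in> module_hom k ?A (self_algebra L)" if "x \<in> carrier \<Gamma>" for x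
    by (rule module_homI) (use that k_in_L in \<open>auto simp: fun_algebra_sel\<close>)
  have delta: "(\<Oplus>\<^bsub>L\<^esub>x\<in>carrier \<Gamma>. point_fun \<Gamma> k i x \<otimes>\<^bsub>L\<^esub> f x) = f i"
    if "i \<in> carrier \<Gamma>" "f \<in> carrier \<Gamma> \<rightarrow> carrier L" for i f
  proof -
    have "(\<Oplus>\<^bsub>L\<^esub>x\<in>carrier \<Gamma>. point_fun \<Gamma> k i x \<otimes>\<^bsub>L\<^esub> f x) = (\<Oplus>\<^bsub>L\<^esub>x\<in>carrier \<Gamma>. if x = i then f x else \<zero>\<^bsub>L\<^esub>)"
      by (rule L.finsum_cong') (use that pf_val in \<open>auto simp: Pi_iff\<close>)
    also have "\<dots> = f i" using that assms(3) by (intro L.add.finprod_singleton_swap) auto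
    finally show ?thesis .
  qed
  show ?thesis
  proof unfold_locales
    show "finite (carrier \<Gamma>)" by fact
    show "carrier (fun_hopf \<Gamma> k) \<subseteq> carrier \<Gamma> \<rightarrow>\<^sub>E carrier L" using k_in_L by auto
    show "monoid.mult (fun_hopf \<Gamma> k) = monoid.mult (fun_algebra \<Gamma> L)"
      "monoid.one (fun_hopf \<Gamma> k) = monoid.one (fun_algebra \<Gamma> L)"
      "ring.add (fun_hopf \<Gamma> k) = ring.add (fun_algebra \<Gamma> L)"
      "ring.zero (fun_hopf \<Gamma> k) = ring.zero (fun_algebra \<Gamma> L)"
      "smult (fun_hopf \<Gamma> k) = smult (fun_algebra \<Gamma> L)"
      by (simp_all add: fun_algebra_def)
    show "\<And>i. i \<in> carrier \<Gamma> \<Longrightarrow> point_fun \<Gamma> k i \<in> carrier (fun_hopf \<Gamma> k)" using pf by simp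
    show "\<And>i x. i \<in> carrier \<Gamma> \<Longrightarrow> x \<in> carrier \<Gamma> \<Longrightarrow> point_fun \<Gamma> k i x \<in> carrier L" by (simp add: pf_val)
    show "(\<Oplus>\<^bsub>L\<^esub>x\<in>carrier \<Gamma>. point_fun \<Gamma> k i x \<otimes>\<^bsub>L\<^esub> f x) \<in> carrier k"
      if "i \<in> carrier \<Gamma>" "f \<in> carrier (fun_hopf \<Gamma> k)" for i f
      using that k_in_L by (subst delta) auto
    show "(\<Oplus>\<^bsub>L\<^esub>i\<in>carrier \<Gamma>. point_fun \<Gamma> k i x \<otimes>\<^bsub>L\<^esub> point_fun \<Gamma> k i y) =
        (if x = y then \<one>\<^bsub>L\<^esub> else \<zero>\<^bsub>L\<^esub>)" if xy: "x \<in> carrier \<Gamma>" "y \<in> carrier \<Gamma>" for x y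
    proof -
      have "(\<Oplus>\<^bsub>L\<^esub>i\<in>carrier \<Gamma>. point_fun \<Gamma> k i x \<otimes>\<^bsub>L\<^esub> point_fun \<Gamma> k i y) =
          (\<Oplus>\<^bsub>L\<^esub>i\<in>carrier \<Gamma>. point_fun \<Gamma> k x i \<otimes>\<^bsub>L\<^esub> point_fun \<Gamma> k y i)"
        by (rule L.finsum_cong') (use xy pf_val in auto)
      also have "\<dots> = point_fun \<Gamma> k y x" using xy by (intro delta) (auto simp: pf_val)
      finally show ?thesis using xy by (simp add: pf_val)
    qed
    fix f assume f: "f \<in> carrier (fun_hopf \<Gamma> k)"
    then have fk: "f x \<in> carrier k" if "x \<in> carrier \<Gamma>" for x using that by auto
    let ?s = "\<lambda>p. f (fst p \<otimes>\<^bsub>\<Gamma>\<^esub> snd p) \<odot>\<^bsub>?T\<^esub>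
               pure_tensor k ?A ?A (point_fun \<Gamma> k (fst p)) (point_fun \<Gamma> k (snd p))"
    have s: "?s \<in> carrier \<Gamma> \<times> carrier \<Gamma> \<rightarrow> carrier ?T"
      using fk pure(1) pfA by auto
    show "comult (fun_hopf \<Gamma> k) f \<in> carrier (tensor_module k (fun_hopf \<Gamma> k) (fun_hopf \<Gamma> k))"
      unfolding TT using s by (simp add: Let_def T.M.finsum_closed)
    fix x y assume xy: "x \<in> carrier \<Gamma>" "y \<in> carrier \<Gamma>"
    let ?ev = "tensor_lift k (self_algebra L) (\<lambda>a b. a x \<otimes>\<^bsub>L\<^esub> b y)"
    have bil: "bilinear_map k ?A ?A (self_algebra L) (\<lambda>a b. a x \<otimes>\<^bsub>L\<^esub> b y)"
      by (rule mult_coordinates_bilinear[OF eval[OF xy(1)] eval[OF xy(2)]])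
    note ev_hom = tensor_lift_hom[OF A A L_module bil]
    note ev_pure = tensor_lift_pure[OF A A L_module bil]
    have "?ev (comult (fun_hopf \<Gamma> k) f) = (\<Oplus>\<^bsub>L\<^esub>p\<in>carrier \<Gamma> \<times> carrier \<Gamma>. ?ev (?s p))"
      using module_hom_finsum[OF T.module_axioms L_module ev_hom s] by (simp add: Let_def)
    also have "\<dots> = (\<Oplus>\<^bsub>L\<^esub>p\<in>carrier \<Gamma> \<times> carrier \<Gamma>.
        if p = (x, y) then f (fst p \<otimes>\<^bsub>\<Gamma>\<^esub> snd p) else \<zero>\<^bsub>L\<^esub>)"
    proof (rule L.finsum_cong'[OF refl])
      show "(\<lambda>p. if p = (x, y) then f (fst p \<otimes>\<^bsub>\<Gamma>\<^esub> snd p) else \<zero>\<^bsub>L\<^esub>)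
          \<in> carrier \<Gamma> \<times> carrier \<Gamma> \<rightarrow> carrier L" using fk k_in_L by auto
      fix p assume "p \<in> carrier \<Gamma> \<times> carrier \<Gamma>"
      then obtain p1 p2 where p: "p = (p1, p2)" "p1 \<in> carrier \<Gamma>" "p2 \<in> carrier \<Gamma>" by auto
      show "?ev (?s p) = (if p = (x, y) then f (fst p \<otimes>\<^bsub>\<Gamma>\<^esub> snd p) else \<zero>\<^bsub>L\<^esub>)"
        using p xy fk k_in_L pure(1) pfA
        by (auto simp: module_hom_smult[OF ev_hom] ev_pure pf_val)
    qed
    also have "\<dots> = f (x \<otimes>\<^bsub>\<Gamma>\<^esub> y)"
    proof -
      have "(\<lambda>p. f (fst p \<otimes>\<^bsub>\<Gamma>\<^esub> snd p)) \<in> carrier \<Gamma> \<times> carrier \<Gamma> \<rightarrow> carrier L"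
        using fk k_in_L by auto
      then show ?thesis
        using xy assms(3)
          L.add.finprod_singleton_swap[of "(x, y)" "carrier \<Gamma> \<times> carrier \<Gamma>" "\<lambda>p. f (fst p \<otimes>\<^bsub>\<Gamma>\<^esub> snd p)"]
        by simp
    qed
    finally show "?ev (comult (fun_hopf \<Gamma> k) f) = f (x \<otimes>\<^bsub>\<Gamma>\<^esub> y)" .
  qed (auto simp: fun_algebra_sel intro!: k_closed(3,4) intro: PiE_mem)
qed

lemma bilinear_map_restrict:
  assumes "extension k L" "bilinear_map L M N P f"
  shows "bilinear_map k M N P f"
proof -
  interpret extension k L by fact
  show ?thesis using assms(2) by (auto simp: bilinear_map_def module_hom_def k_in_L)
qed

context function_form
begin

text \<open>
  The splitting sends \<open>f \<otimes> l\<close> to the function \<open>x \<mapsto> f(x) l\<close>.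
\<close>

definition split_eval :: "'g \<Rightarrow> (('g \<Rightarrow> 'a) \<times> 'a \<Rightarrow> 'a) set \<Rightarrow> 'a" where
  "split_eval x = tensor_lift k (self_algebra L) (\<lambda>f l. f x \<otimes> l)"

definition split_map :: "(('g \<Rightarrow> 'a) \<times> 'a \<Rightarrow> 'a) set \<Rightarrow> 'g \<Rightarrow> 'a" where
  "split_map t = (\<lambda>x\<in>carrier \<Gamma>. split_eval x t)"

abbreviation (input) B where "B \<equiv> base_change_algebra k L H"
abbreviation (input) HL where "HL \<equiv> tensor_module k H (self_algebra L)"
abbreviation (input) pt where "pt \<equiv> pure_tensor k H (self_algebra L)"

lemma split_eval_bilinear:
  "x \<in> carrier \<Gamma> \<Longrightarrow> bilinear_map k H (self_algebra L) (self_algebra L) (\<lambda>f l. f x \<otimes> l)"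
  by (rule mult_coordinates_bilinear[OF eval_hom module_hom_id[unfolded id_def]])

lemmas split_eval_hom = tensor_lift_hom[OF H_module L_module L_module split_eval_bilinear, folded split_eval_def]
lemmas split_eval_pure = tensor_lift_pure[OF H_module L_module L_module split_eval_bilinear, folded split_eval_def, simplified]

lemma HL_module: "module k HL" by (rule tensor_module_module[OF H_module L_module])

lemma B_module: "module L B" by (rule base_change_module[OF H_module])

lemma pt_bilinear: "bilinear_map k H (self_algebra L) HL pt"
  by (rule pure_tensor_bilinear[OF H_module L_module])

lemma L_mult_bilinear: "bilinear_map k (self_algebra L) (self_algebra L) (self_algebra L) (monoid.mult L)"
  by (rule bilinear_mapI) (simp_all add: L.l_distr L.r_distr L.m_ac k_in_L)

lemma B_mult_bilinear: "bilinear_map k HL HL HL (monoid.mult B)"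
  using tensor_algebra_mult_bilinear[OF H_module L_module H_mult_bilinear] L_mult_bilinear by simp

lemma B_mult_pure:
  "f \<in> carrier H \<Longrightarrow> l \<in> carrier L \<Longrightarrow> g \<in> carrier H \<Longrightarrow> m \<in> carrier L \<Longrightarrow>
    pt f l \<otimes>\<^bsub>B\<^esub> pt g m = pt (f \<otimes>\<^bsub>H\<^esub> g) (l \<otimes> m)"
  using tensor_algebra_mult_pure[OF H_module L_module H_mult_bilinear, of f l g m] L_mult_bilinear by simp

lemma split_eval_mult:
  assumes x: "x \<in> carrier \<Gamma>" and s: "s \<in> carrier HL" and t: "t \<in> carrier HL"
  shows "split_eval x (s \<otimes>\<^bsub>B\<^esub> t) = split_eval x s \<otimes> split_eval x t"
proof -
  interpret T: module k HL by (rule HL_module)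
  note mult = bilinear_mapD[OF B_mult_bilinear]
  note hom = module_hom_mem[OF split_eval_hom[OF x], simplified] module_hom_add[OF split_eval_hom[OF x], simplified]
  note pure = bilinear_mapD[OF pt_bilinear, simplified]
  show ?thesis
  proof (rule tensor_induct[OF H_module L_module s])
    fix a l assume al: "a \<in> carrier H" "l \<in> carrier (self_algebra L)"
    show "split_eval x (pt a l \<otimes>\<^bsub>B\<^esub> t) = split_eval x (pt a l) \<otimes> split_eval x t"
    proof (rule tensor_induct[OF H_module L_module t])
      show "split_eval x (pt a l \<otimes>\<^bsub>B\<^esub> pt b m) = split_eval x (pt a l) \<otimes> split_eval x (pt b m)"
        if "b \<in> carrier H" "m \<in> carrier (self_algebra L)" for b m
        using al that x by (simp only: self_algebra_sel B_mult_pure split_eval_pure closed L.m_closed eval_ops)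
          (simp add: L.m_ac)
      show "split_eval x (pt a l \<otimes>\<^bsub>B\<^esub> (s \<oplus>\<^bsub>HL\<^esub> t)) = split_eval x (pt a l) \<otimes> split_eval x (s \<oplus>\<^bsub>HL\<^esub> t)"
        if "s \<in> carrier HL" "t \<in> carrier HL"
          "split_eval x (pt a l \<otimes>\<^bsub>B\<^esub> s) = split_eval x (pt a l) \<otimes> split_eval x s"
          "split_eval x (pt a l \<otimes>\<^bsub>B\<^esub> t) = split_eval x (pt a l) \<otimes> split_eval x t" for s t
        using al that x pure(1)[of a l] by (simp only: self_algebra_sel mult(1,3) hom L.r_distr)
    qed
  qed (use t in \<open>simp only: mult(1,2) hom L.l_distr\<close>)
qed

lemma split_eval_smult:
  assumes x: "x \<in> carrier \<Gamma>" and l: "l \<in> carrier L" and t: "t \<in> carrier HL"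
  shows "split_eval x (l \<odot>\<^bsub>B\<^esub> t) = l \<otimes> split_eval x t"
proof (rule tensor_induct[OF H_module L_module t])
  note hom = module_hom_mem[OF split_eval_hom[OF x], simplified] module_hom_add[OF split_eval_hom[OF x], simplified]
  note bc = module_hom_mem[OF base_change_smult_hom[OF H_module]] module_hom_add[OF base_change_smult_hom[OF H_module]]
  show "split_eval x (l \<odot>\<^bsub>B\<^esub> pt a m) = l \<otimes> split_eval x (pt a m)"
    if "a \<in> carrier H" "m \<in> carrier (self_algebra L)" for a m
    using that x l by (simp add: base_change_smult_pure[OF H_module] split_eval_pure L.m_lcomm)
  show "split_eval x (l \<odot>\<^bsub>B\<^esub> (s \<oplus>\<^bsub>HL\<^esub> s')) = l \<otimes> split_eval x (s \<oplus>\<^bsub>HL\<^esub> s')"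
    if "s \<in> carrier HL" "s' \<in> carrier HL"
      "split_eval x (l \<odot>\<^bsub>B\<^esub> s) = l \<otimes> split_eval x s"
      "split_eval x (l \<odot>\<^bsub>B\<^esub> s') = l \<otimes> split_eval x s'" for s s'
    using l that by (simp only: bc hom L.r_distr)
qed

lemma split_map_closed: "t \<in> carrier HL \<Longrightarrow> split_map t \<in> carrier \<Gamma> \<rightarrow>\<^sub>E carrier L"
  using module_hom_mem[OF split_eval_hom] by (auto simp: split_map_def)

lemma split_map_hom: "split_map \<in> module_hom L B (fun_hopf \<Gamma> L)"
proof (rule module_homI)
  show "split_map t \<in> carrier (fun_hopf \<Gamma> L)" if "t \<in> carrier B" for t
    using split_map_closed that by simp
qed (auto simp: split_map_def fun_algebra_sel module_hom_add[OF split_eval_hom] split_eval_smult intro!: restrict_ext)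

lemma split_map_algebra_hom: "split_map \<in> algebra_hom L B (fun_hopf \<Gamma> L)"
proof -
  have "split_map \<in> ring_hom B (fun_hopf \<Gamma> L)"
  proof (rule ring_hom_memI)
    show "split_map \<one>\<^bsub>B\<^esub> = \<one>\<^bsub>fun_hopf \<Gamma> L\<^esub>"
      by (auto simp: split_map_def fun_algebra_sel split_eval_pure intro!: restrict_ext)
    show "split_map (s \<otimes>\<^bsub>B\<^esub> t) = split_map s \<otimes>\<^bsub>fun_hopf \<Gamma> L\<^esub> split_map t"
      if "s \<in> carrier B" "t \<in> carrier B" for s t
      unfolding split_map_def fun_hopf_sel fun_algebra_sel
      using that split_eval_mult by (auto intro!: restrict_ext simp del: base_change_algebra_sel(4))
  qed (use module_hom_mem[OF split_map_hom] module_hom_add[OF split_map_hom] in auto)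
  then show ?thesis using split_map_hom by (simp add: algebra_hom_def)
qed

text \<open>
  Injectivity is \<open>tensor_separation\<close> with second factor \<open>L\<close>, whose only coordinate is the identity.
  Surjectivity is the completeness relation: the coefficients of an arbitrary function need not lie in
  \<open>k\<close>, but in \<open>H \<otimes> L\<close> they may be any elements of \<open>L\<close>.
\<close>

lemma split_map_bij: "bij_betw split_map (carrier B) (carrier (fun_hopf \<Gamma> L))"
proof (rule bij_betw_imageI)
  interpret SM: module L "fun_hopf \<Gamma> L"
  proof -
    interpret LL: function_form L L \<Gamma> "fun_hopf \<Gamma> L" "point_fun \<Gamma> L" "point_fun \<Gamma> L"
      by (rule fun_hopf_form[OF extension_refl G.group_axioms fin])
    show "module L (fun_hopf \<Gamma> L)" by (rule LL.H_module)
  qed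
  interpret mod_hom L B "fun_hopf \<Gamma> L" split_map
    by (simp add: mod_hom_def mod_hom_axioms_def B_module SM.module_axioms split_map_hom)
  interpret T: module k HL by (rule HL_module)
  interpret B: module L B by (rule B_module)
  have zero: "t = \<zero>\<^bsub>B\<^esub>" if t: "t \<in> carrier B" and z: "split_map t = \<zero>\<^bsub>fun_hopf \<Gamma> L\<^esub>" for t
  proof -
    have "split_eval x t = \<zero>" if "x \<in> carrier \<Gamma>" for x
      using fun_cong[OF z, of x] that by (simp add: split_map_def fun_algebra_sel)
    then have "t = \<zero>\<^bsub>HL\<^esub>"
      using t by (intro tensor_separation[OF H_module L_module H_coordinates,
          where Y = "{()}" and q = "\<lambda>_ l. l"]) (simp_all add: module_hom_id[unfolded id_def] split_eval_def)
    then show ?thesis by simp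
  qed
  show "inj_on split_map (carrier B)"
  proof (rule inj_onI)
    fix s t assume st: "s \<in> carrier B" "t \<in> carrier B" "split_map s = split_map t"
    have "s \<ominus>\<^bsub>B\<^esub> t = \<zero>\<^bsub>B\<^esub>"
    proof (rule zero)
      show "s \<ominus>\<^bsub>B\<^esub> t \<in> carrier B" using st by (intro abelian_group.minus_closed[OF module.axioms(2)[OF B_module]])
      have "split_map (s \<ominus>\<^bsub>B\<^esub> t) = split_map s \<ominus>\<^bsub>fun_hopf \<Gamma> L\<^esub> split_map t"
        by (rule f_minus[OF st(1,2)])
      also have "\<dots> = \<zero>\<^bsub>fun_hopf \<Gamma> L\<^esub>"
        unfolding st(3) by (subst abelian_group.minus_other_side[OF module.axioms(2)[OF SM.module_axioms]])
          (use module_hom_mem[OF split_map_hom] st in auto)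
      finally show "split_map (s \<ominus>\<^bsub>B\<^esub> t) = \<zero>\<^bsub>fun_hopf \<Gamma> L\<^esub>" .
    qed
    then show "s = t" using st(1,2) abelian_group.minus_other_side[OF module.axioms(2)[OF B_module]] by blast
  qed
  show "split_map ` carrier B = carrier (fun_hopf \<Gamma> L)"
  proof
    show "split_map ` carrier B \<subseteq> carrier (fun_hopf \<Gamma> L)"
      using module_hom_mem[OF split_map_hom] by blast
    show "carrier (fun_hopf \<Gamma> L) \<subseteq> split_map ` carrier B"
    proof
      fix F assume "F \<in> carrier (fun_hopf \<Gamma> L)"
      then have F: "F \<in> carrier \<Gamma> \<rightarrow>\<^sub>E carrier L" by simp
      have FL: "F x \<in> carrier L" if "x \<in> carrier \<Gamma>" for x using F that by auto
      define t where "t = (\<Oplus>\<^bsub>HL\<^esub>i\<in>carrier \<Gamma>. pt (h i) (\<Oplus>y\<in>carrier \<Gamma>. c i y \<otimes> F y))"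
      have CL: "(\<Oplus>y\<in>carrier \<Gamma>. c i y \<otimes> F y) \<in> carrier L" if "i \<in> carrier \<Gamma>" for i
        using c[OF that] FL by (intro L.finsum_closed) auto
      have pt: "(\<lambda>i. pt (h i) (\<Oplus>y\<in>carrier \<Gamma>. c i y \<otimes> F y)) \<in> carrier \<Gamma> \<rightarrow> carrier HL"
        using bilinear_mapD(1)[OF pt_bilinear] h CL by auto
      have t: "t \<in> carrier HL" unfolding t_def using pt by (rule T.M.finsum_closed)
      have "split_eval x t = F x" if x: "x \<in> carrier \<Gamma>" for x
      proof -
        have "split_eval x t = (\<Oplus>i\<in>carrier \<Gamma>. split_eval x (pt (h i) (\<Oplus>y\<in>carrier \<Gamma>. c i y \<otimes> F y)))"
          unfolding t_def using module_hom_finsum[OF HL_module L_module split_eval_hom[OF x] pt] by simp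
        also have "\<dots> = (\<Oplus>i\<in>carrier \<Gamma>. h i x \<otimes> (\<Oplus>y\<in>carrier \<Gamma>. c i y \<otimes> F y))"
          using x h CL by (intro L.finsum_cong') (auto simp: split_eval_pure)
        also have "\<dots> = F x" using FL by (intro dual_expand[OF x])
        finally show ?thesis .
      qed
      then have "split_map t = F" using F by (auto simp: split_map_def PiE_def extensional_def)
      then show "F \<in> split_map ` carrier B" using t by auto
    qed
  qed
qed

end

context function_form
begin

lemma module_hom_restrict: "f \<in> module_hom L M N \<Longrightarrow> f \<in> module_hom k M N"
  by (auto simp: module_hom_def k_in_L)

abbreviation (input) BB where "BB \<equiv> tensor_module L B B"

lemma BB_module: "module L BB" by (rule tensor_module_module[OF B_module B_module])

lemma BB_module_k: "module k BB" by (rule restrict_scalars[OF BB_module])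

lemma pt_hom_left:
  assumes "l \<in> carrier L"
  shows "(\<lambda>f. pt f l) \<in> module_hom k H B"
  by (rule module_homI) (use assms bilinear_mapD[OF pt_bilinear] in
    \<open>simp_all add: base_change_smult_restrict[OF H_module]\<close>)

text \<open>
  The comultiplication of \<open>H \<otimes> L\<close> is first studied for a fixed second factor: it sends \<open>f \<otimes> l\<close> to the
  image of the comultiplication of \<open>f\<close> under the map \<open>comult_fibre l\<close>, which takes \<open>f\<^sub>1 \<otimes> f\<^sub>2\<close> to the
  tensor over \<open>L\<close> of \<open>f\<^sub>1 \<otimes> 1\<close> and \<open>f\<^sub>2 \<otimes> l\<close>.
\<close>

definition comult_fibre :: "'a \<Rightarrow> (('g \<Rightarrow> 'a) \<times> ('g \<Rightarrow> 'a) \<Rightarrow> 'a) set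
    \<Rightarrow> ((('g \<Rightarrow> 'a) \<times> 'a \<Rightarrow> 'a) set \<times> (('g \<Rightarrow> 'a) \<times> 'a \<Rightarrow> 'a) set \<Rightarrow> 'a) set" where
  "comult_fibre l = tensor_lift k BB (\<lambda>f g. pure_tensor L B B (pt f \<one>) (pt g l))"

lemma comult_fibre_bilinear:
  assumes "l \<in> carrier L"
  shows "bilinear_map k H H BB (\<lambda>f g. pure_tensor L B B (pt f \<one>) (pt g l))"
  by (rule bilinear_map_comp2[OF bilinear_map_restrict[OF extension_axioms
        pure_tensor_bilinear[OF B_module B_module]] pt_hom_left[OF L.one_closed] pt_hom_left[OF assms]])

lemmas comult_fibre_hom = tensor_lift_hom[OF H_module H_module BB_module_k comult_fibre_bilinear, folded comult_fibre_def]
lemmas comult_fibre_pure = tensor_lift_pure[OF H_module H_module BB_module_k comult_fibre_bilinear, folded comult_fibre_def]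

lemma comult_base_change_bilinear:
  "bilinear_map k H (self_algebra L) BB (\<lambda>f l. comult_fibre l (comult H f))"
proof (rule bilinear_mapI)
  interpret BB: module k BB by (rule BB_module_k)
  note fibre = module_hom_mem[OF comult_fibre_hom] module_hom_add[OF comult_fibre_hom]
    module_hom_smult[OF comult_fibre_hom]
  note pBB = bilinear_mapD[OF bilinear_map_restrict[OF extension_axioms pure_tensor_bilinear[OF B_module B_module]]]
  note ptD = bilinear_mapD[OF pt_bilinear, simplified]
  have add: "comult_fibre (l \<oplus> l') s = comult_fibre l s \<oplus>\<^bsub>BB\<^esub> comult_fibre l' s"
    if l: "l \<in> carrier L" "l' \<in> carrier L" and s: "s \<in> carrier (tensor_module k H H)" for l l' s
  proof (rule tensor_induct[OF H_module H_module s])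
    fix f g assume fg: "f \<in> carrier H" "g \<in> carrier H"
    show "comult_fibre (l \<oplus> l') (pure_tensor k H H f g) =
        comult_fibre l (pure_tensor k H H f g) \<oplus>\<^bsub>BB\<^esub> comult_fibre l' (pure_tensor k H H f g)"
      using fg l pBB(3)[of "pt f \<one>" "pt g l" "pt g l'"] by (simp add: comult_fibre_pure ptD)
  qed (use l in \<open>simp add: fibre BB.M.a_ac\<close>)
  have smult: "comult_fibre (r \<otimes> l) s = r \<odot>\<^bsub>BB\<^esub> comult_fibre l s"
    if l: "l \<in> carrier L" and r: "r \<in> carrier k" and s: "s \<in> carrier (tensor_module k H H)" for l r s
  proof (rule tensor_induct[OF H_module H_module s])
    fix f g assume fg: "f \<in> carrier H" "g \<in> carrier H"
    show "comult_fibre (r \<otimes> l) (pure_tensor k H H f g) = r \<odot>\<^bsub>BB\<^esub> comult_fibre l (pure_tensor k H H f g)"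
      using fg l r k_in_L[OF r] pBB(5)[of r "pt f \<one>" "pt g l"]
      by (simp add: comult_fibre_pure ptD(1,5) base_change_smult_restrict[OF H_module])
  qed (use l r k_in_L[OF r] in \<open>simp add: fibre BB.smult_r_distr\<close>)
  show "\<And>f l l'. f \<in> carrier H \<Longrightarrow> l \<in> carrier (self_algebra L) \<Longrightarrow> l' \<in> carrier (self_algebra L) \<Longrightarrow>
      comult_fibre (l \<oplus>\<^bsub>self_algebra L\<^esub> l') (comult H f) =
      comult_fibre l (comult H f) \<oplus>\<^bsub>BB\<^esub> comult_fibre l' (comult H f)"
    by (simp add: add comult(1))
  show "\<And>r f l. r \<in> carrier k \<Longrightarrow> f \<in> carrier H \<Longrightarrow> l \<in> carrier (self_algebra L) \<Longrightarrow>
      comult_fibre (r \<odot>\<^bsub>self_algebra L\<^esub> l) (comult H f) = r \<odot>\<^bsub>BB\<^esub> comult_fibre l (comult H f)"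
    by (simp add: smult comult(1))
  show "comult_fibre l (comult H f) \<in> carrier BB"
    if "f \<in> carrier H" "l \<in> carrier (self_algebra L)" for f l
    using that by (simp only: fibre(1) comult(1) self_algebra_sel)
  show "comult_fibre l (comult H (f \<oplus>\<^bsub>H\<^esub> g)) = comult_fibre l (comult H f) \<oplus>\<^bsub>BB\<^esub> comult_fibre l (comult H g)"
    if "f \<in> carrier H" "g \<in> carrier H" "l \<in> carrier (self_algebra L)" for f g l
    using that by (simp only: module_hom_add[OF comult_module_hom] fibre(2) comult(1) self_algebra_sel)
  show "comult_fibre l (comult H (r \<odot>\<^bsub>H\<^esub> f)) = r \<odot>\<^bsub>BB\<^esub> comult_fibre l (comult H f)"
    if "r \<in> carrier k" "f \<in> carrier H" "l \<in> carrier (self_algebra L)" for r f l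
    using that by (simp only: module_hom_smult[OF comult_module_hom] fibre(3) comult(1) self_algebra_sel)
qed

lemma comult_base_change:
  "comult (base_change k L H) = tensor_lift k BB (\<lambda>f l. comult_fibre l (comult H f))"
  unfolding base_change_sel(7) Let_def comult_fibre_def by (rule refl)

lemma comult_base_change_hom: "comult (base_change k L H) \<in> module_hom k HL BB"
  unfolding comult_base_change
  by (rule tensor_lift_hom[OF H_module L_module BB_module_k comult_base_change_bilinear])

lemma comult_base_change_pure:
  assumes "f \<in> carrier H" "l \<in> carrier L"
  shows "comult (base_change k L H) (pt f l) = comult_fibre l (comult H f)"
  unfolding comult_base_change
  by (rule tensor_lift_pure[OF H_module L_module BB_module_k comult_base_change_bilinear])
    (simp_all add: assms)

lemma antipode_base_change_pure:
  assumes "f \<in> carrier H" "l \<in> carrier L"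
  shows "antipode (base_change k L H) (pt f l) = pt (antipode H f) l"
  using tensor_map_pure[OF H_module L_module H_module L_module antipode_hom module_hom_id, of f l] assms
  by simp

lemma antipode_base_change_hom: "antipode (base_change k L H) \<in> module_hom k HL HL"
  unfolding base_change_sel(9)
  by (rule tensor_map_hom[OF H_module L_module H_module L_module antipode_hom module_hom_id])

text \<open>
  Since \<open>Fun(\<Gamma>, L)\<close> is itself a function form over \<open>L\<close>, its tensor square consists of functions of two
  variables. The images of \<open>f \<otimes> l\<close> under the two ways around the square for the comultiplications both
  have the value \<open>f(x y) l\<close> at \<open>(x, y)\<close>.
\<close>

theorem split_map_hopf_hom: "split_map \<in> hopf_hom L (base_change k L H) (fun_hopf \<Gamma> L)"
proof -
  let ?F = "fun_hopf \<Gamma> L"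
  interpret LL: function_form L L \<Gamma> ?F "point_fun \<Gamma> L" "point_fun \<Gamma> L"
    by (rule fun_hopf_form[OF extension_refl G.group_axioms fin])
  note LL.k_ops [simp del]
  define tm where "tm = tensor_map L ?F ?F split_map split_map"
  have tm_hom: "tm \<in> module_hom L BB (tensor_module L ?F ?F)"
    unfolding tm_def by (rule tensor_map_hom[OF B_module B_module LL.H_module LL.H_module split_map_hom split_map_hom])
  have tm_pure: "tm (pure_tensor L B B s t) = pure_tensor L ?F ?F (split_map s) (split_map t)"
    if "s \<in> carrier B" "t \<in> carrier B" for s t
    unfolding tm_def by (rule tensor_map_pure[OF B_module B_module LL.H_module LL.H_module split_map_hom split_map_hom that])
  have sm: "split_map s \<in> carrier ?F" if "s \<in> carrier HL" for s
    using split_map_closed that by simp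
  note ptD = bilinear_mapD[OF pt_bilinear, simplified]
  have at_point: "LL.ev x y (tm (comult (base_change k L H) t)) = split_eval (x \<otimes>\<^bsub>\<Gamma>\<^esub> y) t"
    if x: "x \<in> carrier \<Gamma>" and y: "y \<in> carrier \<Gamma>" and t: "t \<in> carrier HL" for x y t
  proof -
    have ev_tm_hom: "(\<lambda>s. LL.ev x y (tm s)) \<in> module_hom k BB (self_algebra L)"
      by (rule module_hom_restrict[OF module_hom_comp[OF tm_hom LL.ev_hom[OF x y]]])
    have fibre: "LL.ev x y (tm (comult_fibre l s)) = ev x y s \<otimes> l"
      if l: "l \<in> carrier L" and s: "s \<in> carrier (tensor_module k H H)" for l s
    proof (rule tensor_hom_unique[OF H_module H_module L_module _ _ _ s])
      show "(\<lambda>s. LL.ev x y (tm (comult_fibre l s))) \<in> module_hom k (tensor_module k H H) (self_algebra L)"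
        by (rule module_hom_comp[OF comult_fibre_hom[OF l] ev_tm_hom])
      show "(\<lambda>s. ev x y s \<otimes> l) \<in> module_hom k (tensor_module k H H) (self_algebra L)"
        using ev_hom[OF x y] l by (auto simp: module_hom_def Pi_def L.l_distr L.m_assoc k_in_L)
      fix f g assume fg: "f \<in> carrier H" "g \<in> carrier H"
      show "LL.ev x y (tm (comult_fibre l (pure_tensor k H H f g))) = ev x y (pure_tensor k H H f g) \<otimes> l"
        using fg x y l sm[OF ptD(1)]
        by (simp add: comult_fibre_pure tm_pure ptD(1) LL.ev_pure ev_pure split_map_def split_eval_pure L.m_assoc)
    qed
    show ?thesis
      by (rule tensor_hom_unique[OF H_module L_module L_module
            module_hom_comp[OF comult_base_change_hom ev_tm_hom] split_eval_hom _ t])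
        (use x y in \<open>simp_all add: comult_base_change_pure fibre comult(1) ev_comult split_eval_pure del: base_change_sel\<close>)
  qed
  have comult': "comult ?F (split_map t) = tm (comult (base_change k L H) t)" if t: "t \<in> carrier HL" for t
  proof (rule LL.ev_inj)
    show "comult ?F (split_map t) \<in> carrier (tensor_module L ?F ?F)" by (rule LL.comult(1)[OF sm[OF t]])
    show "tm (comult (base_change k L H) t) \<in> carrier (tensor_module L ?F ?F)"
      by (rule module_hom_mem[OF tm_hom module_hom_mem[OF comult_base_change_hom t]])
    fix x y assume xy: "x \<in> carrier \<Gamma>" "y \<in> carrier \<Gamma>"
    show "LL.ev x y (comult ?F (split_map t)) = LL.ev x y (tm (comult (base_change k L H) t))"
      unfolding at_point[OF xy t] LL.ev_comult[OF sm[OF t] xy] using xy by (simp add: split_map_def)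
  qed
  have counit': "counit ?F (split_map t) = counit (base_change k L H) t" if t: "t \<in> carrier HL" for t
  proof -
    have "split_eval \<one>\<^bsub>\<Gamma>\<^esub> t = tensor_lift k (self_algebra L) (\<lambda>f l. counit H f \<otimes> l) t"
      unfolding split_eval_def
      by (rule tensor_lift_cong[OF H_module L_module L_module split_eval_bilinear _ t]) (simp_all add: counit)
    then show ?thesis by (simp add: split_map_def)
  qed
  have antipode': "antipode ?F (split_map t) = split_map (antipode (base_change k L H) t)"
    if t: "t \<in> carrier HL" for t
  proof -
    have "split_eval (inv\<^bsub>\<Gamma>\<^esub> x) t = split_eval x (antipode (base_change k L H) t)" if x: "x \<in> carrier \<Gamma>" for x
      by (rule tensor_hom_unique[OF H_module L_module L_module split_eval_hom
            module_hom_comp[OF antipode_base_change_hom split_eval_hom[OF x]] _ t])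
        (use x antipode(2) in \<open>simp_all add: antipode_base_change_pure split_eval_pure antipode(1) del: base_change_sel\<close>)
    then show ?thesis by (auto simp: split_map_def intro!: restrict_ext simp del: base_change_sel)
  qed
  have "split_map \<in> algebra_hom L (base_change k L H) ?F"
    using split_map_algebra_hom unfolding algebra_hom_def ring_hom_def module_hom_def by simp
  then show ?thesis
    unfolding hopf_hom_def using comult' counit' antipode' by (simp add: tm_def del: base_change_sel(7-9) fun_hopf_sel(7-9))
qed

end

section \<open>Comparing two Hopf algebras through a common target\<close>

text \<open>
  To compose a morphism with the inverse of a bijective morphism it suffices that the operations stay
  within the carriers. For extensions of scalars this is much less than the Hopf algebra axioms.
\<close>

definition hopf_closed :: "('a, 'm) ring_scheme \<Rightarrow> ('a, 'h, 'x) hopf_scheme \<Rightarrow> bool" where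
  "hopf_closed R H \<longleftrightarrow> module R H \<and> \<one>\<^bsub>H\<^esub> \<in> carrier H \<and>
     (\<forall>a\<in>carrier H. \<forall>b\<in>carrier H. a \<otimes>\<^bsub>H\<^esub> b \<in> carrier H) \<and>
     (\<forall>a\<in>carrier H. comult H a \<in> carrier (tensor_module R H H)) \<and>
     (\<forall>a\<in>carrier H. antipode H a \<in> carrier H)"

text \<open>
  The isomorphism is \<open>f\<close> followed by the inverse of \<open>g\<close>. As \<open>g\<close> is injective, its compatibility with an
  operation can be tested after applying \<open>g\<close>, where only the hypotheses on \<open>f\<close> and \<open>g\<close> are used. For the
  comultiplication, \<open>g \<otimes> g\<close> is cancelled by means of the inverse of \<open>g\<close>.
\<close>

lemma hopf_isomorphic_common_target:
  assumes A: "hopf_closed R A" and B: "hopf_closed R B" and C: "module R C"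
    and f: "f \<in> hopf_hom R A C" "bij_betw f (carrier A) (carrier C)"
    and g: "g \<in> hopf_hom R B C" "bij_betw g (carrier B) (carrier C)"
  shows "hopf_isomorphic R A B"
proof -
  have Am: "module R A" and Bm: "module R B" using A B by (auto simp: hopf_closed_def)
  interpret A: module R A by (rule Am)
  interpret B: module R B by (rule Bm)
  define g' where "g' = the_inv_into (carrier B) g"
  define \<psi> where "\<psi> a = g' (f a)" for a
  have g'_mem: "g' z \<in> carrier B" and gg': "g (g' z) = z" if "z \<in> carrier C" for z
    using that g(2) unfolding g'_def bij_betw_def
    by (auto simp: the_inv_into_into f_the_inv_into_f)
  have g'g: "g' (g b) = b" if "b \<in> carrier B" for b
    using that g(2) unfolding g'_def bij_betw_def by (simp add: the_inv_into_f_f)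
  have f_mem: "f a \<in> carrier C" if "a \<in> carrier A" for a using that f(2) by (auto simp: bij_betw_def)
  have \<psi>_mem: "\<psi> a \<in> carrier B" and g\<psi>: "g (\<psi> a) = f a" if "a \<in> carrier A" for a
    using g'_mem gg' f_mem that by (auto simp: \<psi>_def)
  have g_inj: "a = b" if "a \<in> carrier B" "b \<in> carrier B" "g a = g b" for a b
    using that g(2) by (auto simp: bij_betw_def inj_on_def)
  have fr: "f \<in> ring_hom A C" and fm: "f \<in> module_hom R A C" using f(1) by (auto simp: hopf_hom_def algebra_hom_def)
  have gr: "g \<in> ring_hom B C" and gm: "g \<in> module_hom R B C" using g(1) by (auto simp: hopf_hom_def algebra_hom_def)
  note frh = ring_hom_mult[OF fr] ring_hom_add[OF fr] ring_hom_one[OF fr] module_hom_smult[OF fm]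
  note grh = ring_hom_mult[OF gr] ring_hom_add[OF gr] ring_hom_one[OF gr] module_hom_smult[OF gm]
  have Ac: "\<one>\<^bsub>A\<^esub> \<in> carrier A" "\<And>a b. a \<in> carrier A \<Longrightarrow> b \<in> carrier A \<Longrightarrow> a \<otimes>\<^bsub>A\<^esub> b \<in> carrier A"
    "\<And>a. a \<in> carrier A \<Longrightarrow> comult A a \<in> carrier (tensor_module R A A)"
    "\<And>a. a \<in> carrier A \<Longrightarrow> antipode A a \<in> carrier A"
    using A by (auto simp: hopf_closed_def)
  have Bc: "\<one>\<^bsub>B\<^esub> \<in> carrier B" "\<And>a b. a \<in> carrier B \<Longrightarrow> b \<in> carrier B \<Longrightarrow> a \<otimes>\<^bsub>B\<^esub> b \<in> carrier B"
    "\<And>a. a \<in> carrier B \<Longrightarrow> comult B a \<in> carrier (tensor_module R B B)"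
    "\<And>a. a \<in> carrier B \<Longrightarrow> antipode B a \<in> carrier B"
    using B by (auto simp: hopf_closed_def)
  have \<psi>r: "\<psi> \<in> ring_hom A B"
    by (rule ring_hom_memI; (rule g_inj)?) (simp_all add: Ac Bc \<psi>_mem g\<psi> frh grh)
  have \<psi>m: "\<psi> \<in> module_hom R A B"
    by (rule module_homI; (rule g_inj)?) (simp_all add: Ac Bc \<psi>_mem g\<psi> frh grh)
  have g'm: "g' \<in> module_hom R C B"
  proof -
    interpret C: module R C by (rule C)
    show ?thesis by (rule module_homI; (rule g_inj)?) (simp_all add: g'_mem gg' grh)
  qed
  have "\<psi> \<in> hopf_hom R A B"
    unfolding hopf_hom_def
  proof (intro CollectI conjI ballI)
    show "\<psi> \<in> algebra_hom R A B" using \<psi>r \<psi>m by (simp add: algebra_hom_def)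
    fix a assume a: "a \<in> carrier A"
    show "counit B (\<psi> a) = counit A a"
      using f(1) g(1) a \<psi>_mem[OF a] g\<psi>[OF a] unfolding hopf_hom_def by force
    show "antipode B (\<psi> a) = \<psi> (antipode A a)"
    proof (rule g_inj)
      have "g (antipode B (\<psi> a)) = antipode C (g (\<psi> a))"
        using g(1) \<psi>_mem[OF a] by (simp add: hopf_hom_def)
      also have "\<dots> = f (antipode A a)" using f(1) a by (simp add: hopf_hom_def g\<psi>)
      finally show "g (antipode B (\<psi> a)) = g (\<psi> (antipode A a))" using a by (simp add: g\<psi> Ac)
    qed (use a Ac Bc \<psi>_mem in auto)
    let ?t = "comult B (\<psi> a)" and ?s = "tensor_map R B B \<psi> \<psi> (comult A a)"
    have t: "?t \<in> carrier (tensor_module R B B)" using Bc \<psi>_mem a by simp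
    have s: "?s \<in> carrier (tensor_module R B B)"
      by (rule module_hom_mem[OF tensor_map_hom[OF Am Am Bm Bm \<psi>m \<psi>m] Ac(3)[OF a]])
    have undo: "tensor_map R B B g' g' (tensor_map R C C g g u) = u"
      if u: "u \<in> carrier (tensor_module R B B)" for u
    proof -
      note h = module_hom_comp[OF gm g'm]
      have "tensor_map R B B (\<lambda>x. g' (g x)) (\<lambda>x. g' (g x)) u = u"
      proof (rule tensor_hom_unique[OF Bm Bm tensor_module_module[OF Bm Bm] tensor_map_hom[OF Bm Bm Bm Bm h h] _ _ u])
        show "(\<lambda>x. x) \<in> module_hom R (tensor_module R B B) (tensor_module R B B)"
          by (auto simp: module_hom_def)
      qed (simp add: tensor_map_pure[OF Bm Bm Bm Bm h h] g'g)
      then show ?thesis by (simp add: tensor_map_comp[OF Bm C Bm gm g'm u])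
    qed
    have "tensor_map R C C g g ?t = comult C (f a)"
      using g(1) \<psi>_mem[OF a] g\<psi>[OF a] unfolding hopf_hom_def by force
    also have "\<dots> = tensor_map R C C f f (comult A a)"
      using f(1) a unfolding hopf_hom_def by force
    also have "\<dots> = tensor_map R C C (\<lambda>x. g (\<psi> x)) (\<lambda>x. g (\<psi> x)) (comult A a)"
    proof -
      note h = module_hom_comp[OF \<psi>m gm]
      show ?thesis
        by (rule tensor_hom_unique[OF Am Am tensor_module_module[OF C C] tensor_map_hom[OF Am Am C C fm fm]
              tensor_map_hom[OF Am Am C C h h] _ Ac(3)[OF a]])
          (simp add: tensor_map_pure[OF Am Am C C fm fm] tensor_map_pure[OF Am Am C C h h] g\<psi>)
    qed
    also have "\<dots> = tensor_map R C C g g ?s"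
      by (rule tensor_map_comp[OF Am Bm C \<psi>m gm Ac(3)[OF a], symmetric])
    finally have "tensor_map R B B g' g' (tensor_map R C C g g ?t) =
        tensor_map R B B g' g' (tensor_map R C C g g ?s)" by (rule arg_cong)
    then show "?t = ?s" unfolding undo[OF t] undo[OF s] .
  qed
  moreover have "bij_betw \<psi> (carrier A) (carrier B)"
    unfolding \<psi>_def using bij_betw_trans[OF f(2) bij_betw_the_inv_into[OF g(2)]]
    by (simp add: g'_def comp_def)
  ultimately show ?thesis unfolding hopf_isomorphic_def by blast
qed

lemma module_cong:
  fixes M :: "('a, 'b, 'x) module_scheme" and M' :: "('a, 'b, 'y) module_scheme"
  assumes "module R M" "carrier M' = carrier M" "ring.add M' = ring.add M" "ring.zero M' = ring.zero M"
    "smult M' = smult M"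
  shows "module R M'"
proof -
  interpret M: module R M by fact
  have "\<exists>y\<in>carrier M. y \<oplus>\<^bsub>M\<^esub> x = \<zero>\<^bsub>M\<^esub>" if "x \<in> carrier M" for x
    using that M.M.l_neg by blast
  then have "abelian_group M'"
    by (intro abelian_groupI) (simp_all add: assms M.M.a_ac)
  then show ?thesis
    by (intro moduleI M.R.cring_axioms)
      (simp_all add: assms M.smult_l_distr M.smult_r_distr M.smult_assoc1)
qed

context function_form
begin

lemma base_change_hopf_closed: "hopf_closed L (base_change k L H)"
  unfolding hopf_closed_def
proof (intro conjI ballI)
  let ?H = "base_change k L H"
  show "module L ?H" by (rule module_cong[OF B_module]) simp_all
  show "\<one>\<^bsub>?H\<^esub> \<in> carrier ?H" using bilinear_mapD(1)[OF pt_bilinear] by simp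
  fix s assume s: "s \<in> carrier ?H"
  show "s \<otimes>\<^bsub>?H\<^esub> t \<in> carrier ?H" if "t \<in> carrier ?H" for t
    using bilinear_mapD(1)[OF B_mult_bilinear] s that by simp
  have "tensor_module L ?H ?H = BB" by (rule tensor_module_cong) simp_all
  then show "comult ?H s \<in> carrier (tensor_module L ?H ?H)"
    using module_hom_mem[OF comult_base_change_hom] s by (simp del: base_change_sel(7))
  show "antipode ?H s \<in> carrier ?H"
    using module_hom_mem[OF antipode_base_change_hom] s by (simp del: base_change_sel(9))
qed

theorem base_change_split: "hopf_isomorphic L (base_change k L H) (fun_hopf \<Gamma> L)"
  unfolding hopf_isomorphic_def using split_map_hopf_hom split_map_bij
  by (intro bexI[of _ split_map]) simp_all

text \<open>
  Two function forms on the same group need not be isomorphic over \<open>k\<close>, but over \<open>L\<close> both split.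
\<close>

theorem base_change_isomorphic:
  fixes H' :: "('a, 'g \<Rightarrow> 'a, 'y) hopf_scheme"
  assumes "function_form k L \<Gamma> H' h' c'"
  shows "hopf_isomorphic L (base_change k L H) (base_change k L H')"
proof -
  interpret H': function_form k L \<Gamma> H' h' c' by fact
  have C: "module L (fun_hopf \<Gamma> L)"
    by (rule module_cong[OF fun_algebra_module[OF L.cring_axioms]]) (simp_all add: fun_algebra_sel)
  show ?thesis
    by (rule hopf_isomorphic_common_target[OF base_change_hopf_closed H'.base_change_hopf_closed C
          split_map_hopf_hom _ H'.split_map_hopf_hom])
      (use split_map_bij H'.split_map_bij in \<open>simp_all del: fun_hopf_sel(1)\<close>)
qed

end

section \<open>Dual families in vector spaces\<close>

context vectorspace
begin

lemma finsum_in_span: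
  assumes "finite I" "v \<in> I \<rightarrow> S" "S \<subseteq> carrier V" "a \<in> I \<rightarrow> carrier K"
  shows "(\<Oplus>\<^bsub>V\<^esub>i\<in>I. a i \<odot>\<^bsub>V\<^esub> v i) \<in> span S"
proof -
  have sub: "submodule K (span S) V" by (rule span_is_submodule[OF assms(3)])
  show ?thesis using assms(1,2,4)
  proof (induction I rule: finite_induct)
    case empty
    then show ?case using submodule.zero_closed[OF sub] by simp
  next
    case (insert i I)
    have "v i \<in> span S" using insert.prems in_own_span[OF assms(3)] by auto
    then have "a i \<odot>\<^bsub>V\<^esub> v i \<in> span S" using insert.prems by (intro submodule.smult_closed[OF sub]) auto
    moreover have "(\<Oplus>\<^bsub>V\<^esub>i\<in>I. a i \<odot>\<^bsub>V\<^esub> v i) \<in> span S" using insert by auto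
    moreover have "(\<Oplus>\<^bsub>V\<^esub>j\<in>insert i I. a j \<odot>\<^bsub>V\<^esub> v j) = a i \<odot>\<^bsub>V\<^esub> v i \<oplus>\<^bsub>V\<^esub> (\<Oplus>\<^bsub>V\<^esub>i\<in>I. a i \<odot>\<^bsub>V\<^esub> v i)"
      using insert.hyps insert.prems assms(3) by (intro M.finsum_insert) auto
    ultimately show ?case using submodule.m_closed[OF sub] by simp
  qed
qed

text \<open>
  Applying \<open>c\<^sub>i\<close> to a linear relation between the \<open>v\<^sub>j\<close> isolates its \<open>i\<close>-th coefficient.
\<close>

lemma dual_family_independent:
  assumes I: "finite I" and v: "v \<in> I \<rightarrow> carrier V"
    and c: "\<And>i. i \<in> I \<Longrightarrow> c i \<in> module_hom K V (self_algebra K)"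
    and dual: "\<And>i j. i \<in> I \<Longrightarrow> j \<in> I \<Longrightarrow> c i (v j) = (if i = j then \<one>\<^bsub>K\<^esub> else \<zero>\<^bsub>K\<^esub>)"
  shows "inj_on v I" "lin_indpt (v ` I)"
proof -
  show inj: "inj_on v I"
  proof (rule inj_onI)
    fix i j assume ij: "i \<in> I" "j \<in> I" "v i = v j"
    then have "c i (v j) = \<one>\<^bsub>K\<^esub>" using dual[of i i] by simp
    then show "i = j" using dual[of i j] ij by (auto split: if_splits)
  qed
  note self = cring_self_module[OF R.cring_axioms]
  show "lin_indpt (v ` I)"
  proof (rule finite_lin_indpt2)
    show "finite (v ` I)" using I by simp
    show "v ` I \<subseteq> carrier V" using v by auto
    fix a assume a: "a \<in> v ` I \<rightarrow> carrier K" and z: "lincomb a (v ` I) = \<zero>\<^bsub>V\<^esub>"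
    have "a (v i) = \<zero>\<^bsub>K\<^esub>" if i: "i \<in> I" for i
    proof -
      have "lincomb a (v ` I) = (\<Oplus>\<^bsub>V\<^esub>j\<in>I. a (v j) \<odot>\<^bsub>V\<^esub> v j)"
        unfolding lincomb_def using a v by (intro M.add.finprod_reindex[OF _ inj]) auto
      then have "c i \<zero>\<^bsub>V\<^esub> = (\<Oplus>\<^bsub>K\<^esub>j\<in>I. c i (a (v j) \<odot>\<^bsub>V\<^esub> v j))"
        using module_hom_finsum[OF module_axioms self c[OF i], of "\<lambda>j. a (v j) \<odot>\<^bsub>V\<^esub> v j" I] a v z
        by auto
      also have "\<dots> = (\<Oplus>\<^bsub>K\<^esub>j\<in>I. if i = j then a (v j) else \<zero>\<^bsub>K\<^esub>)"
        using a v i dual by (intro R.finsum_cong') (auto simp: module_hom_smult[OF c] Pi_iff)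
      also have "\<dots> = a (v i)" using a i I by (intro R.add.finprod_singleton) auto
      finally show ?thesis using module_hom_zero[OF module_axioms self c[OF i]] by simp
    qed
    then show "\<forall>w\<in>v ` I. a w = \<zero>\<^bsub>K\<^esub>" by auto
  qed
qed

lemma dual_family_dim:
  assumes I: "finite I" and v: "v \<in> I \<rightarrow> carrier V"
    and c: "\<And>i. i \<in> I \<Longrightarrow> c i \<in> module_hom K V (self_algebra K)"
    and dual: "\<And>i j. i \<in> I \<Longrightarrow> j \<in> I \<Longrightarrow> c i (v j) = (if i = j then \<one>\<^bsub>K\<^esub> else \<zero>\<^bsub>K\<^esub>)"
    and expand: "\<And>x. x \<in> carrier V \<Longrightarrow> x = (\<Oplus>\<^bsub>V\<^esub>i\<in>I. c i x \<odot>\<^bsub>V\<^esub> v i)"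
  shows "fin_dim" "dim = card I"
proof -
  have fin: "finite (v ` I)" and sub: "v ` I \<subseteq> carrier V" using I v by auto
  have "carrier V \<subseteq> span (v ` I)"
  proof
    fix x assume x: "x \<in> carrier V"
    have "(\<Oplus>\<^bsub>V\<^esub>i\<in>I. c i x \<odot>\<^bsub>V\<^esub> v i) \<in> span (v ` I)"
      using module_hom_mem[OF c x] by (intro finsum_in_span[OF I _ sub]) auto
    then show "x \<in> span (v ` I)" using expand[OF x] by simp
  qed
  then have gen: "gen_set (v ` I)" using span_is_subset2[OF sub] by blast
  show "fin_dim" unfolding fin_dim_def using fin sub gen by blast
  have "basis (v ` I)"
    unfolding basis_def using dual_family_independent(2)[OF I v c dual] gen sub by blast
  then have "dim = card (v ` I)" by (rule dim_basis[OF fin])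
  then show "dim = card I" using dual_family_independent(1)[OF I v c dual] by (simp add: card_image)
qed

text \<open>
  A generating family with at most as many members as the dimension has distinct members, and these
  form a basis.
\<close>

lemma generating_family_independent:
  assumes I: "finite I" "card I \<le> dim" and v: "v \<in> I \<rightarrow> carrier V"
    and gen: "\<And>x. x \<in> carrier V \<Longrightarrow> \<exists>a\<in>I \<rightarrow> carrier K. x = (\<Oplus>\<^bsub>V\<^esub>i\<in>I. a i \<odot>\<^bsub>V\<^esub> v i)"
    and a: "a \<in> I \<rightarrow> carrier K" "(\<Oplus>\<^bsub>V\<^esub>i\<in>I. a i \<odot>\<^bsub>V\<^esub> v i) = \<zero>\<^bsub>V\<^esub>"
    and i: "i \<in> I"
  shows "a i = \<zero>\<^bsub>K\<^esub>"
proof (rule ccontr)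
  assume nz: "a i \<noteq> \<zero>\<^bsub>K\<^esub>"
  have fin: "finite (v ` I)" and sub: "v ` I \<subseteq> carrier V" using I v by auto
  have "carrier V \<subseteq> span (v ` I)"
  proof
    fix x assume "x \<in> carrier V"
    then obtain b where "b \<in> I \<rightarrow> carrier K" "x = (\<Oplus>\<^bsub>V\<^esub>i\<in>I. b i \<odot>\<^bsub>V\<^esub> v i)" using gen by blast
    then show "x \<in> span (v ` I)" using finsum_in_span[OF I(1) _ sub] by auto
  qed
  then have genset: "gen_set (v ` I)" using span_is_subset2[OF sub] by blast
  have "card (v ` I) = card I"
    using gen_ge_dim[OF fin sub genset] I card_image_le[OF I(1), of v] by linarith
  then have inj: "inj_on v I" using I(1) by (simp add: eq_card_imp_inj_on)
  have "basis (v ` I)"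
    using I card_image_le[OF I(1), of v] by (intro dim_gen_is_basis[OF fin sub genset]) linarith
  then have li: "lin_indpt (v ` I)" by (simp add: basis_def)
  define b where "b w = a (the_inv_into I v w)" for w
  have bv: "b (v j) = a j" if "j \<in> I" for j using that inj by (simp add: b_def the_inv_into_f_f)
  have bK: "b \<in> v ` I \<rightarrow> carrier K" using a(1) bv by auto
  have "lincomb b (v ` I) = (\<Oplus>\<^bsub>V\<^esub>j\<in>I. b (v j) \<odot>\<^bsub>V\<^esub> v j)"
    unfolding lincomb_def using bK v by (intro M.add.finprod_reindex[OF _ inj]) auto
  also have "\<dots> = (\<Oplus>\<^bsub>V\<^esub>j\<in>I. a j \<odot>\<^bsub>V\<^esub> v j)"
    using a(1) v bv by (intro M.finsum_cong') auto
  finally have "lin_dep (v ` I)"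
    using a(2) i nz bv by (intro lin_dep_crit[OF fin order_refl bK, of "v i"]) auto
  then show False using li by simp
qed

lemma independent_card_le:
  assumes "finite A" "finite C" "C \<subseteq> carrier V" "lin_indpt A" "A \<subseteq> span C"
  shows "card A \<le> card C"
  using replacement[OF assms] by force

end

section \<open>Finite Galois extensions\<close>

text \<open>
  The group property of \<open>Gal k L\<close> is part of the hypothesis that this group is abelian, from which it is
  taken below.
\<close>

locale galois_extension = extension k L for k :: "'a ring" and L :: "'a ring" (structure) +
  assumes galois: "finite_galois_extension k L" and gal_group: "group (Gal k L)"
begin

sublocale Gal: group "Gal k L" by (rule gal_group)

abbreviation (input) G where "G \<equiv> carrier (Gal k L)"

lemma gal_ring_hom: "\<sigma> \<in> G \<Longrightarrow> \<sigma> \<in> ring_hom L L" by (simp add: Gal_def)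

lemma gal_simps [simp]:
  assumes "\<sigma> \<in> G"
  shows "x \<in> carrier L \<Longrightarrow> \<sigma> x \<in> carrier L"
    "x \<in> carrier L \<Longrightarrow> y \<in> carrier L \<Longrightarrow> \<sigma> (x \<oplus> y) = \<sigma> x \<oplus> \<sigma> y"
    "x \<in> carrier L \<Longrightarrow> y \<in> carrier L \<Longrightarrow> \<sigma> (x \<otimes> y) = \<sigma> x \<otimes> \<sigma> y"
    "\<sigma> \<one> = \<one>"
  using gal_ring_hom[OF assms]
  by (simp_all add: ring_hom_closed ring_hom_add ring_hom_mult ring_hom_one)

lemma gal_fix: "\<sigma> \<in> G \<Longrightarrow> x \<in> carrier k \<Longrightarrow> \<sigma> x = x" by (simp add: Gal_def)

lemma gal_zero [simp]: "\<sigma> \<in> G \<Longrightarrow> \<sigma> \<zero> = \<zero>" by (rule gal_fix) simp_all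

lemma fixed_in_k: "x \<in> carrier L \<Longrightarrow> (\<And>\<sigma>. \<sigma> \<in> G \<Longrightarrow> \<sigma> x = x) \<Longrightarrow> x \<in> carrier k"
  using galois unfolding finite_galois_extension_def by blast

lemma gal_mult [simp]: "\<sigma> \<in> G \<Longrightarrow> \<tau> \<in> G \<Longrightarrow> x \<in> carrier L \<Longrightarrow> (\<sigma> \<otimes>\<^bsub>Gal k L\<^esub> \<tau>) x = \<sigma> (\<tau> x)"
  by (simp add: Gal_def BijGroup_def compose_def)

lemma gal_one [simp]: "x \<in> carrier L \<Longrightarrow> \<one>\<^bsub>Gal k L\<^esub> x = x"
  by (simp add: Gal_def BijGroup_def)

lemma gal_inv [simp]:
  assumes "\<sigma> \<in> G" "x \<in> carrier L"
  shows "\<sigma> ((inv\<^bsub>Gal k L\<^esub> \<sigma>) x) = x" "(inv\<^bsub>Gal k L\<^esub> \<sigma>) (\<sigma> x) = x"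
  using assms gal_mult[of \<sigma> "inv\<^bsub>Gal k L\<^esub> \<sigma>" x] gal_mult[of "inv\<^bsub>Gal k L\<^esub> \<sigma>" \<sigma> x] by (simp_all del: gal_mult)

lemma gal_eqI:
  assumes "\<sigma> \<in> G" "\<tau> \<in> G" "\<And>x. x \<in> carrier L \<Longrightarrow> \<sigma> x = \<tau> x"
  shows "\<sigma> = \<tau>"
  using assms by (intro extensionalityI[of \<sigma> "carrier L" \<tau>]) (auto simp: Gal_def Bij_def)

lemma gal_hom: "\<sigma> \<in> G \<Longrightarrow> \<sigma> \<in> module_hom k (self_algebra L) (self_algebra L)"
  by (rule module_homI) (simp_all add: gal_fix k_in_L)

lemma gal_finsum: "\<sigma> \<in> G \<Longrightarrow> f \<in> I \<rightarrow> carrier L \<Longrightarrow> \<sigma> (\<Oplus>i\<in>I. f i) = (\<Oplus>i\<in>I. \<sigma> (f i))"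
  using module_hom_finsum[OF L_module L_module gal_hom, of \<sigma> f I] by simp

lemma L_vectorspace: "vectorspace k (self_algebra L)"
  by (intro vectorspace.intro L_module k_field)

sublocale KL: vectorspace k "self_algebra L" by (rule L_vectorspace)

lemma L_fin_dim: "KL.fin_dim"
  using galois by (simp add: finite_galois_extension_def finite_extension_def)

lemma ext_degree_eq: "ext_degree k L = KL.dim" by (simp add: ext_degree_def)

sublocale V: vectorspace L "fun_algebra (Gal k L) L"
  by (intro vectorspace.intro fun_algebra_module L.cring_axioms L.field_axioms)

abbreviation (input) V where "V \<equiv> fun_algebra (Gal k L) L"

lemma V_val: "w \<in> carrier V \<Longrightarrow> \<sigma> \<in> G \<Longrightarrow> w \<sigma> \<in> carrier L"
  by (auto simp: fun_algebra_sel)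

lemma V_eqI: "v \<in> carrier V \<Longrightarrow> w \<in> carrier V \<Longrightarrow> (\<And>\<sigma>. \<sigma> \<in> G \<Longrightarrow> v \<sigma> = w \<sigma>) \<Longrightarrow> v = w"
  unfolding fun_algebra_sel by (intro PiE_ext[of v G "\<lambda>_. carrier L" w]) auto

lemma V_ops:
  assumes "\<sigma> \<in> G"
  shows "(v \<oplus>\<^bsub>V\<^esub> w) \<sigma> = v \<sigma> \<oplus> w \<sigma>" "(r \<odot>\<^bsub>V\<^esub> w) \<sigma> = r \<otimes> w \<sigma>" "(v \<otimes>\<^bsub>V\<^esub> w) \<sigma> = v \<sigma> \<otimes> w \<sigma>"
    "\<zero>\<^bsub>V\<^esub> \<sigma> = \<zero>"
  using assms by (simp_all add: fun_algebra_sel)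

lemma V_mult_closed: "v \<in> carrier V \<Longrightarrow> w \<in> carrier V \<Longrightarrow> v \<otimes>\<^bsub>V\<^esub> w \<in> carrier V"
  by (auto simp: fun_algebra_sel PiE_mem)

lemma V_eval_hom: "\<sigma> \<in> G \<Longrightarrow> (\<lambda>w. w \<sigma>) \<in> module_hom L V (self_algebra L)"
  by (rule module_homI) (simp_all add: V_val V_ops)

text \<open>
  An element \<open>y\<close> of \<open>L\<close> is regarded as the vector of its conjugates in the \<open>L\<close>-vector space of functions
  \<open>G \<rightarrow> L\<close>. The \<open>L\<close>-span of these vectors, called \<open>W\<close> below, is the image of \<open>L \<otimes>\<^sub>k L\<close>.
\<close>

definition evaluation :: "'a \<Rightarrow> ('a \<Rightarrow> 'a) \<Rightarrow> 'a" where
  "evaluation y = (\<lambda>\<sigma>\<in>G. \<sigma> y)"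

lemma evaluation_closed: "y \<in> carrier L \<Longrightarrow> evaluation y \<in> carrier V"
  by (auto simp: evaluation_def fun_algebra_sel)

context
  fixes \<beta> assumes \<beta>: "finite \<beta>" "KL.basis \<beta>"
begin

lemma \<beta>_sub: "\<beta> \<subseteq> carrier L" using \<beta>(2) by (simp add: KL.basis_def)

lemma \<beta>_card: "card \<beta> = ext_degree k L"
  using KL.dim_basis[OF \<beta>] by (simp add: ext_degree_eq)

abbreviation (input) W where "W \<equiv> V.span (evaluation ` \<beta>)"

lemma ev\<beta>: "evaluation ` \<beta> \<subseteq> carrier V" using \<beta>_sub evaluation_closed by blast

lemma W_sub: "submodule L W V" by (rule V.span_is_submodule[OF ev\<beta>])

lemma W_carrier: "w \<in> W \<Longrightarrow> w \<in> carrier V" using submodule.subset[OF W_sub] by blast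

lemma evaluation_in_W:
  assumes "y \<in> carrier L"
  shows "evaluation y \<in> W"
proof -
  have "y \<in> KL.span \<beta>" using \<beta>(2) assms by (simp add: KL.basis_def)
  then obtain a where a: "a \<in> \<beta> \<rightarrow> carrier k" "KL.lincomb a \<beta> = y"
    using KL.finite_in_span[OF \<beta>(1)] \<beta>_sub by auto
  then have y: "y = (\<Oplus>b\<in>\<beta>. a b \<otimes> b)" by (simp add: KL.lincomb_def)
  have aL: "a b \<in> carrier L" "b \<in> carrier L" if "b \<in> \<beta>" for b using that a \<beta>_sub k_in_L by auto
  let ?s = "\<Oplus>\<^bsub>V\<^esub>b\<in>\<beta>. a b \<odot>\<^bsub>V\<^esub> evaluation b"
  have s: "?s \<in> W" using aL ev\<beta> by (intro V.finsum_in_span[OF \<beta>(1) _ ev\<beta>]) auto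
  have "evaluation y = ?s"
  proof (rule V_eqI[OF evaluation_closed[OF assms] W_carrier[OF s]])
    fix \<sigma> assume \<sigma>: "\<sigma> \<in> G"
    have "?s \<sigma> = (\<Oplus>b\<in>\<beta>. (a b \<odot>\<^bsub>V\<^esub> evaluation b) \<sigma>)"
      using module_hom_finsum[OF V.module_axioms L_self_module V_eval_hom[OF \<sigma>],
          of "\<lambda>b. a b \<odot>\<^bsub>V\<^esub> evaluation b" \<beta>] aL evaluation_closed by simp
    also have "\<dots> = (\<Oplus>b\<in>\<beta>. \<sigma> (a b \<otimes> b))"
      using \<sigma> aL a(1) by (intro L.finsum_cong') (auto simp: V_ops evaluation_def gal_fix Pi_iff)
    also have "\<dots> = \<sigma> y" unfolding y using \<sigma> aL by (subst gal_finsum) auto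
    finally show "evaluation y \<sigma> = ?s \<sigma>" using \<sigma> by (simp add: evaluation_def)
  qed
  then show ?thesis using s by simp
qed

text \<open>
  Taking conjugates is multiplicative, so \<open>W\<close> is closed under multiplication by the generating vectors.
\<close>

lemma W_mult_evaluation:
  assumes w: "w \<in> W" and y: "y \<in> carrier L"
  shows "w \<otimes>\<^bsub>V\<^esub> evaluation y \<in> W"
proof -
  let ?S = "{w \<in> carrier V. w \<otimes>\<^bsub>V\<^esub> evaluation y \<in> W}"
  note E = evaluation_closed[OF y]
  have "submodule L ?S V"
  proof (rule submodule.intro)
    show "module L V" by (rule V.module_axioms)
    have "\<zero>\<^bsub>V\<^esub> \<otimes>\<^bsub>V\<^esub> evaluation y = \<zero>\<^bsub>V\<^esub>"
      using E by (intro V_eqI) (auto simp: V_ops V_mult_closed V_val)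
    then show "\<zero>\<^bsub>V\<^esub> \<in> ?S" using submodule.zero_closed[OF W_sub] by simp
    fix v w assume v: "v \<in> ?S" and w: "w \<in> ?S"
    have "(v \<oplus>\<^bsub>V\<^esub> w) \<otimes>\<^bsub>V\<^esub> evaluation y = v \<otimes>\<^bsub>V\<^esub> evaluation y \<oplus>\<^bsub>V\<^esub> w \<otimes>\<^bsub>V\<^esub> evaluation y"
      using E v w by (intro V_eqI) (auto simp: V_ops V_mult_closed V_val L.l_distr)
    then show "v \<oplus>\<^bsub>V\<^esub> w \<in> ?S" using v w submodule.m_closed[OF W_sub] by simp
  next
    fix r v assume r: "r \<in> carrier L" and v: "v \<in> ?S"
    have "(r \<odot>\<^bsub>V\<^esub> v) \<otimes>\<^bsub>V\<^esub> evaluation y = r \<odot>\<^bsub>V\<^esub> (v \<otimes>\<^bsub>V\<^esub> evaluation y)"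
      using E v r by (intro V_eqI) (auto simp: V_ops V_mult_closed V_val L.m_assoc)
    then show "r \<odot>\<^bsub>V\<^esub> v \<in> ?S" using r v submodule.smult_closed[OF W_sub] by simp
  qed auto
  moreover have "evaluation ` \<beta> \<subseteq> ?S"
  proof (intro image_subsetI CollectI conjI)
    fix b assume b: "b \<in> \<beta>"
    then have bL: "b \<in> carrier L" using \<beta>_sub by blast
    show "evaluation b \<in> carrier V" by (rule evaluation_closed[OF bL])
    have "evaluation b \<otimes>\<^bsub>V\<^esub> evaluation y = evaluation (b \<otimes> y)"
      using bL y by (intro V_eqI V_mult_closed evaluation_closed) (auto simp: V_ops evaluation_def)
    then show "evaluation b \<otimes>\<^bsub>V\<^esub> evaluation y \<in> W" using evaluation_in_W bL y by simp
  qed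
  ultimately have "W \<subseteq> ?S" by (intro V.span_is_subset)
  then show ?thesis using w by blast
qed

text \<open>
  This is Artin's argument for the independence of automorphisms. To make \<open>w\<close> vanish at one more
  automorphism \<open>\<tau>\<close>, choose \<open>y\<close> with \<open>\<sigma>(y) \<noteq> \<tau>(y)\<close> and multiply \<open>w\<close> by the function whose value at \<open>\<rho>\<close>
  is \<open>(\<rho>(y) - \<tau>(y)) / (\<sigma>(y) - \<tau>(y))\<close>.
\<close>

lemma W_separates:
  assumes "finite S" "S \<subseteq> G" "\<sigma> \<in> G" "\<sigma> \<notin> S"
  shows "\<exists>w\<in>W. w \<sigma> = \<one> \<and> (\<forall>\<tau>\<in>S. w \<tau> = \<zero>)"
  using assms
proof (induction S rule: finite_induct)
  case empty
  then have "evaluation \<one> \<sigma> = \<one>" by (simp add: evaluation_def)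
  then show ?case using evaluation_in_W[OF L.one_closed] by blast
next
  case (insert \<tau> S)
  have \<tau>: "\<tau> \<in> G" "\<tau> \<noteq> \<sigma>" and \<sigma>: "\<sigma> \<in> G" "\<sigma> \<notin> S" and S: "S \<subseteq> G"
    using insert.prems by auto
  obtain w where w: "w \<in> W" "w \<sigma> = \<one>" "\<forall>\<rho>\<in>S. w \<rho> = \<zero>"
    using insert.IH[OF S \<sigma>] by blast
  note \<sigma> = \<sigma>(1)
  obtain y where y: "y \<in> carrier L" "\<sigma> y \<noteq> \<tau> y" using gal_eqI[OF \<sigma> \<tau>(1)] \<tau>(2) by metis
  define d where "d = \<sigma> y \<oplus> \<ominus> (\<tau> y)"
  have d: "d \<in> carrier L" "d \<noteq> \<zero>"
    using y \<sigma> \<tau> L.minus_other_side[of "\<sigma> y" "\<tau> y"] by (auto simp: d_def a_minus_def)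
  have dinv: "inv d \<in> carrier L" "inv d \<otimes> d = \<one>"
    using d by (auto simp: L.field_Units)
  define u where "u = inv d \<odot>\<^bsub>V\<^esub> (w \<otimes>\<^bsub>V\<^esub> evaluation y \<oplus>\<^bsub>V\<^esub> (\<ominus> (\<tau> y)) \<odot>\<^bsub>V\<^esub> w)"
  have "u \<in> W"
    unfolding u_def using dinv w y \<tau>
    by (intro submodule.smult_closed[OF W_sub] submodule.m_closed[OF W_sub] W_mult_evaluation) auto
  moreover have val: "u \<rho> = inv d \<otimes> (w \<rho> \<otimes> \<rho> y \<oplus> (\<ominus> (\<tau> y)) \<otimes> w \<rho>)" if "\<rho> \<in> G" for \<rho>
    unfolding u_def using that by (simp add: V_ops evaluation_def)
  have "u \<sigma> = \<one>"
    using val[OF \<sigma>] w(2) dinv y \<sigma> \<tau> by (simp add: d_def)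
  moreover have "u \<tau> = \<zero>"
    using val[OF \<tau>(1)] V_val[OF W_carrier[OF w(1)] \<tau>(1)] dinv y \<tau>(1)
    by (simp add: L.l_minus L.r_minus L.m_comm L.r_neg)
  moreover have "u \<rho> = \<zero>" if "\<rho> \<in> S" for \<rho>
    using val[of \<rho>] w(3) that S dinv y \<tau>(1) by auto
  ultimately show ?case by auto
qed

text \<open>
  The separating members of \<open>W\<close> are dual to the points of \<open>S\<close> and hence independent, while \<open>W\<close> is
  spanned by the conjugate vectors of a basis of \<open>L\<close>.
\<close>

lemma finite_gal_subset_card:
  assumes "finite S" "S \<subseteq> G"
  shows "card S \<le> card \<beta>"
proof -
  have "\<forall>\<sigma>\<in>S. \<exists>w\<in>W. w \<sigma> = \<one> \<and> (\<forall>\<tau>\<in>S - {\<sigma>}. w \<tau> = \<zero>)"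
    using assms by (intro ballI W_separates) auto
  then obtain w where w: "\<And>\<sigma>. \<sigma> \<in> S \<Longrightarrow> w \<sigma> \<in> W" "\<And>\<sigma>. \<sigma> \<in> S \<Longrightarrow> w \<sigma> \<sigma> = \<one>"
    "\<And>\<sigma> \<tau>. \<sigma> \<in> S \<Longrightarrow> \<tau> \<in> S \<Longrightarrow> \<tau> \<noteq> \<sigma> \<Longrightarrow> w \<sigma> \<tau> = \<zero>" by (metis Diff_iff singletonD)
  have dual: "w j i = (if i = j then \<one> else \<zero>)" if "i \<in> S" "j \<in> S" for i j
    using w(2)[of i] w(3)[of j i] that by auto
  have wV: "w \<in> S \<rightarrow> carrier V" using w(1) W_carrier by auto
  have hom: "(\<lambda>v. v \<sigma>) \<in> module_hom L V (self_algebra L)" if "\<sigma> \<in> S" for \<sigma>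
    using V_eval_hom assms(2) that by blast
  note ind = V.dual_family_independent[OF assms(1) wV, of "\<lambda>\<sigma> v. v \<sigma>", OF hom dual]
  have "card (w ` S) \<le> card (evaluation ` \<beta>)"
    using w(1) ind(2) by (intro V.independent_card_le[OF _ _ ev\<beta>]) (auto simp: assms(1) \<beta>(1))
  also have "\<dots> \<le> card \<beta>" by (rule card_image_le[OF \<beta>(1)])
  finally show ?thesis using ind(1) by (simp add: card_image)
qed

lemma gal_finite: "finite G"
proof (rule ccontr)
  assume "infinite G"
  then obtain S where "finite S" "card S = Suc (card \<beta>)" "S \<subseteq> G" using infinite_arbitrarily_large by blast
  then show False using finite_gal_subset_card[of S] by simp
qed

text \<open>
  The \<open>z\<^sub>b\<close> are the coefficients of the member of \<open>W\<close> which separates the identity from all the other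
  automorphisms.
\<close>

lemma dual_basis_left:
  obtains z where "\<And>b. b \<in> \<beta> \<Longrightarrow> z b \<in> carrier L"
    and "\<And>\<sigma>. \<sigma> \<in> G \<Longrightarrow> (\<Oplus>b\<in>\<beta>. z b \<otimes> \<sigma> b) = (if \<sigma> = \<one>\<^bsub>Gal k L\<^esub> then \<one> else \<zero>)"
proof -
  obtain w where w: "w \<in> W" "w \<one>\<^bsub>Gal k L\<^esub> = \<one>" "\<forall>\<tau>\<in>G - {\<one>\<^bsub>Gal k L\<^esub>}. w \<tau> = \<zero>"
    using W_separates[of "G - {\<one>\<^bsub>Gal k L\<^esub>}" "\<one>\<^bsub>Gal k L\<^esub>"] gal_finite by auto
  obtain a where a: "a \<in> evaluation ` \<beta> \<rightarrow> carrier L" "V.lincomb a (evaluation ` \<beta>) = w"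
    using V.finite_in_span[OF _ ev\<beta> w(1)] \<beta>(1) by auto
  have inj: "inj_on evaluation \<beta>"
  proof (rule inj_onI)
    fix b b' assume b: "b \<in> \<beta>" "b' \<in> \<beta>" "evaluation b = evaluation b'"
    then have "evaluation b \<one>\<^bsub>Gal k L\<^esub> = evaluation b' \<one>\<^bsub>Gal k L\<^esub>" by simp
    then show "b = b'" using b \<beta>_sub by (simp add: evaluation_def subset_iff)
  qed
  have aL: "a (evaluation b) \<in> carrier L" "b \<in> carrier L" if "b \<in> \<beta>" for b using a(1) \<beta>_sub that by auto
  have "w = (\<Oplus>\<^bsub>V\<^esub>b\<in>\<beta>. a (evaluation b) \<odot>\<^bsub>V\<^esub> evaluation b)"
    unfolding a(2)[symmetric] V.lincomb_def
    using aL evaluation_closed by (intro V.M.add.finprod_reindex[OF _ inj]) auto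
  then have "w \<sigma> = (\<Oplus>b\<in>\<beta>. a (evaluation b) \<otimes> \<sigma> b)" if \<sigma>: "\<sigma> \<in> G" for \<sigma>
  proof -
    have "(\<Oplus>\<^bsub>V\<^esub>b\<in>\<beta>. a (evaluation b) \<odot>\<^bsub>V\<^esub> evaluation b) \<sigma> =
        (\<Oplus>b\<in>\<beta>. (a (evaluation b) \<odot>\<^bsub>V\<^esub> evaluation b) \<sigma>)"
      using module_hom_finsum[OF V.module_axioms L_self_module V_eval_hom[OF \<sigma>],
          of "\<lambda>b. a (evaluation b) \<odot>\<^bsub>V\<^esub> evaluation b" \<beta>] aL evaluation_closed by simp
    also have "\<dots> = (\<Oplus>b\<in>\<beta>. a (evaluation b) \<otimes> \<sigma> b)"
      using \<sigma> aL by (intro L.finsum_cong') (auto simp: V_ops evaluation_def)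
    finally show ?thesis using \<open>w = _\<close> by simp
  qed
  then show thesis using that[of "\<lambda>b. a (evaluation b)"] aL w by auto
qed

end

end

context galois_extension
begin

definition trace :: "'a \<Rightarrow> 'a" where
  "trace x = (\<Oplus>\<sigma>\<in>G. \<sigma> x)"

lemma invariant_sum_in_k:
  assumes f: "f \<in> I \<rightarrow> carrier L" and p: "\<And>\<sigma>. \<sigma> \<in> G \<Longrightarrow> bij_betw (p \<sigma>) I I"
    and eq: "\<And>\<sigma> i. \<sigma> \<in> G \<Longrightarrow> i \<in> I \<Longrightarrow> \<sigma> (f i) = f (p \<sigma> i)"
  shows "(\<Oplus>i\<in>I. f i) \<in> carrier k"
proof (rule fixed_in_k)
  show "(\<Oplus>i\<in>I. f i) \<in> carrier L" using f by (rule L.finsum_closed)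
  fix \<sigma> assume \<sigma>: "\<sigma> \<in> G"
  have "\<sigma> (\<Oplus>i\<in>I. f i) = (\<Oplus>i\<in>I. \<sigma> (f i))" by (rule gal_finsum[OF \<sigma> f])
  also have "\<dots> = (\<Oplus>i\<in>I. f (p \<sigma> i))"
    using f p[OF \<sigma>] \<sigma> by (intro L.finsum_cong') (auto simp: eq bij_betw_def)
  also have "\<dots> = (\<Oplus>i\<in>I. f i)"
    using L.add.finprod_reindex[of f "p \<sigma>" I] p[OF \<sigma>] f by (simp add: bij_betw_def)
  finally show "\<sigma> (\<Oplus>i\<in>I. f i) = (\<Oplus>i\<in>I. f i)" .
qed

lemma trace_in_k: "x \<in> carrier L \<Longrightarrow> trace x \<in> carrier k"
  unfolding trace_def
  by (rule invariant_sum_in_k[where p = "\<lambda>\<rho> \<sigma>. \<rho> \<otimes>\<^bsub>Gal k L\<^esub> \<sigma>"])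
    (auto simp: bij_betw_def Gal.surj_const_mult Gal.inj_on_cmult)

text \<open>
  Applying \<open>\<sigma>\<close> to the relations of \<open>dual_basis_left\<close> gives the first family of relations. Summed over the
  automorphisms with weights \<open>\<sigma>(v)\<close>, they express \<open>v\<close> through the \<open>z\<^sub>b\<close> with coefficients \<open>Tr(b v)\<close>. The \<open>z\<^sub>b\<close> thus generate
  \<open>L\<close> over \<open>k\<close>; as there are \<open>[L : k]\<close> of them, they are independent, and the expansion of \<open>z\<^sub>b\<close> itself
  yields \<open>Tr(b z\<^sub>b\<^sub>') = \<delta>\<^sub>b\<^sub>b\<^sub>'\<close>, which is the second family. In turn this makes the conjugate vectors of the basis
  independent in the space of functions on \<open>G\<close>, so that \<open>[L : k] \<le> |G|\<close>. Together with the opposite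
  inequality the basis has as many members as \<open>G\<close>, and \<open>G\<close> can be used to index it.
\<close>

lemma galois_dual_bases:
  obtains z b where "finite G" "card G = ext_degree k L"
    and "\<And>\<rho>. \<rho> \<in> G \<Longrightarrow> z \<rho> \<in> carrier L" "\<And>\<rho>. \<rho> \<in> G \<Longrightarrow> b \<rho> \<in> carrier L"
    and "\<And>\<sigma> \<tau>. \<sigma> \<in> G \<Longrightarrow> \<tau> \<in> G \<Longrightarrow>
      (\<Oplus>\<rho>\<in>G. \<sigma> (z \<rho>) \<otimes> \<tau> (b \<rho>)) = (if \<sigma> = \<tau> then \<one> else \<zero>)"
    and "\<And>\<rho> \<pi>. \<rho> \<in> G \<Longrightarrow> \<pi> \<in> G \<Longrightarrow>
      (\<Oplus>\<sigma>\<in>G. \<sigma> (b \<rho>) \<otimes> \<sigma> (z \<pi>)) = (if \<rho> = \<pi> then \<one> else \<zero>)"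
proof -
  obtain \<beta> where \<beta>: "finite \<beta>" "KL.basis \<beta>" using KL.finite_basis_exists[OF L_fin_dim] by blast
  have fin: "finite G" by (rule gal_finite[OF \<beta>])
  have \<beta>L: "b \<in> carrier L" if "b \<in> \<beta>" for b using \<beta>_sub[OF \<beta>] that by blast
  obtain z where z: "\<And>b. b \<in> \<beta> \<Longrightarrow> z b \<in> carrier L"
    and z1: "\<And>\<sigma>. \<sigma> \<in> G \<Longrightarrow> (\<Oplus>b\<in>\<beta>. z b \<otimes> \<sigma> b) = (if \<sigma> = \<one>\<^bsub>Gal k L\<^esub> then \<one> else \<zero>)"
    by (rule dual_basis_left[OF \<beta>]) blast
  have orth: "(\<Oplus>b\<in>\<beta>. \<sigma> (z b) \<otimes> \<tau> b) = (if \<sigma> = \<tau> then \<one> else \<zero>)"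
    if \<sigma>: "\<sigma> \<in> G" and \<tau>: "\<tau> \<in> G" for \<sigma> \<tau>
  proof -
    let ?\<rho> = "inv\<^bsub>Gal k L\<^esub> \<sigma> \<otimes>\<^bsub>Gal k L\<^esub> \<tau>"
    have \<rho>: "?\<rho> \<in> G" using \<sigma> \<tau> by simp
    have "(\<Oplus>b\<in>\<beta>. \<sigma> (z b) \<otimes> \<tau> b) = (\<Oplus>b\<in>\<beta>. \<sigma> (z b \<otimes> ?\<rho> b))"
      using \<sigma> \<tau> z \<beta>L by (intro L.finsum_cong') auto
    also have "\<dots> = \<sigma> (\<Oplus>b\<in>\<beta>. z b \<otimes> ?\<rho> b)"
      using \<sigma> \<rho> z \<beta>L by (intro gal_finsum[symmetric]) (auto simp del: gal_mult)
    also have "\<dots> = (if ?\<rho> = \<one>\<^bsub>Gal k L\<^esub> then \<one> else \<zero>)"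
      unfolding z1[OF \<rho>] using \<sigma> by simp
    also have "?\<rho> = \<one>\<^bsub>Gal k L\<^esub> \<longleftrightarrow> \<sigma> = \<tau>"
      using \<sigma> \<tau> by (metis Gal.inv_closed Gal.inv_equality Gal.inv_inv Gal.l_inv)
    finally show ?thesis .
  qed
  have tr: "trace (b \<otimes> v) \<in> carrier L" if "b \<in> \<beta>" "v \<in> carrier L" for b v
    using trace_in_k that \<beta>L k_in_L by simp
  have expand: "v = (\<Oplus>b\<in>\<beta>. trace (b \<otimes> v) \<otimes> z b)" if v: "v \<in> carrier L" for v
  proof -
    have "(\<Oplus>b\<in>\<beta>. trace (b \<otimes> v) \<otimes> z b) = (\<Oplus>b\<in>\<beta>. \<Oplus>\<sigma>\<in>G. \<sigma> (b \<otimes> v) \<otimes> z b)"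
      unfolding trace_def using v z \<beta>L fin by (intro L.finsum_cong' L.finsum_ldistr) auto
    also have "\<dots> = (\<Oplus>\<sigma>\<in>G. \<Oplus>b\<in>\<beta>. \<sigma> (b \<otimes> v) \<otimes> z b)"
      using v z \<beta>L fin \<beta>(1) by (intro L.finsum_finsum_swap) auto
    also have "\<dots> = (\<Oplus>\<sigma>\<in>G. if \<one>\<^bsub>Gal k L\<^esub> = \<sigma> then \<sigma> v else \<zero>)"
    proof (rule L.finsum_cong'[OF refl])
      fix \<sigma> assume \<sigma>: "\<sigma> \<in> G"
      have "(\<Oplus>b\<in>\<beta>. \<sigma> (b \<otimes> v) \<otimes> z b) = (\<Oplus>b\<in>\<beta>. (z b \<otimes> \<sigma> b) \<otimes> \<sigma> v)"
        using \<sigma> v z \<beta>L by (intro L.finsum_cong') (auto simp: L.m_ac)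
      also have "\<dots> = (\<Oplus>b\<in>\<beta>. z b \<otimes> \<sigma> b) \<otimes> \<sigma> v"
        using \<sigma> v z \<beta>L \<beta>(1) by (intro L.finsum_ldistr[symmetric]) auto
      finally show "(\<Oplus>b\<in>\<beta>. \<sigma> (b \<otimes> v) \<otimes> z b) = (if \<one>\<^bsub>Gal k L\<^esub> = \<sigma> then \<sigma> v else \<zero>)"
        using z1[OF \<sigma>] \<sigma> v by auto
    qed (use v in auto)
    also have "\<dots> = v" using v fin
      L.add.finprod_singleton[of "\<one>\<^bsub>Gal k L\<^esub>" G "\<lambda>\<sigma>. \<sigma> v"] by auto
    finally show ?thesis ..
  qed
  have dual: "trace (b \<otimes> z b') = (if b = b' then \<one> else \<zero>)" if b: "b \<in> \<beta>" and b': "b' \<in> \<beta>" for b b'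
  proof -
    \<comment> \<open>The \<open>z\<close> are subject to the relation with coefficients \<open>Tr(b z\<^sub>b\<^sub>') - \<delta>\<^sub>b\<^sub>b\<^sub>'\<close>, so these vanish.\<close>
    let ?\<delta> = "\<lambda>b. if b = b' then \<one> else \<zero>"
    let ?a = "\<lambda>b. trace (b \<otimes> z b') \<oplus> (\<ominus>\<^bsub>k\<^esub> \<one>\<^bsub>k\<^esub>) \<otimes> ?\<delta> b"
    have m: "\<ominus>\<^bsub>k\<^esub> \<one>\<^bsub>k\<^esub> \<in> carrier k" by (rule k.a_inv_closed) (rule k.one_closed)
    have m1: "\<one> \<oplus> \<ominus>\<^bsub>k\<^esub> \<one>\<^bsub>k\<^esub> = \<zero>" using k.r_neg[OF k.one_closed] by simp
    have neg: "x \<oplus> (\<ominus>\<^bsub>k\<^esub> \<one>\<^bsub>k\<^esub>) \<otimes> x = \<zero>" if "x \<in> carrier L" for x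
      using L.l_distr[of "\<one>" "\<ominus>\<^bsub>k\<^esub> \<one>\<^bsub>k\<^esub>" x] m1 k_in_L[OF m] that by (simp del: k_ops)
    have aK: "?a \<in> \<beta> \<rightarrow> carrier k"
      using m trace_in_k \<beta>L z b' by (auto simp del: k_ops)
    have "(\<Oplus>b\<in>\<beta>. ?a b \<otimes> z b) =
        (\<Oplus>b\<in>\<beta>. trace (b \<otimes> z b') \<otimes> z b \<oplus> (if b' = b then (\<ominus>\<^bsub>k\<^esub> \<one>\<^bsub>k\<^esub>) \<otimes> z b else \<zero>))"
      using tr z b' k_in_L[OF m] by (intro L.finsum_cong') (auto simp: L.l_distr simp del: k_ops)
    also have "\<dots> = (\<Oplus>b\<in>\<beta>. trace (b \<otimes> z b') \<otimes> z b) \<oplus>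
        (\<Oplus>b\<in>\<beta>. if b' = b then (\<ominus>\<^bsub>k\<^esub> \<one>\<^bsub>k\<^esub>) \<otimes> z b else \<zero>)"
      using tr z b' k_in_L[OF m] by (intro L.finsum_addf) (auto simp del: k_ops)
    also have "\<dots> = z b' \<oplus> (\<ominus>\<^bsub>k\<^esub> \<one>\<^bsub>k\<^esub>) \<otimes> z b'"
      using expand[OF z[OF b']] z b' k_in_L[OF m] \<beta>(1)
        L.add.finprod_singleton[of b' \<beta> "\<lambda>b. (\<ominus>\<^bsub>k\<^esub> \<one>\<^bsub>k\<^esub>) \<otimes> z b"] by (auto simp del: k_ops)
    also have "\<dots> = \<zero>" using neg z b' by simp
    finally have rel: "(\<Oplus>\<^bsub>self_algebra L\<^esub>b\<in>\<beta>. ?a b \<odot>\<^bsub>self_algebra L\<^esub> z b) = \<zero>\<^bsub>self_algebra L\<^esub>" by (simp del: k_ops)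
    have gen: "\<exists>a\<in>\<beta> \<rightarrow> carrier k. x = (\<Oplus>\<^bsub>self_algebra L\<^esub>i\<in>\<beta>. a i \<odot>\<^bsub>self_algebra L\<^esub> z i)"
      if "x \<in> carrier (self_algebra L)" for x
      using that expand[of x] trace_in_k \<beta>L by (intro bexI[of _ "\<lambda>b. trace (b \<otimes> x)"]) auto
    have "?a b = \<zero>\<^bsub>k\<^esub>"
      by (rule KL.generating_family_independent[OF \<beta>(1) _ _ gen aK rel b])
        (use z \<beta>_card[OF \<beta>] in \<open>auto simp: ext_degree_eq\<close>)
    then have 0: "trace (b \<otimes> z b') \<oplus> (\<ominus>\<^bsub>k\<^esub> \<one>\<^bsub>k\<^esub>) \<otimes> ?\<delta> b = \<zero>" by simp
    have d: "?\<delta> b \<in> carrier L" by simp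
    have "trace (b \<otimes> z b') = ?\<delta> b"
      by (rule L.add.right_cancel[THEN iffD1, of "(\<ominus>\<^bsub>k\<^esub> \<one>\<^bsub>k\<^esub>) \<otimes> ?\<delta> b"])
        (use 0 neg[OF d] tr[OF b z[OF b']] d k_in_L[OF m] in \<open>simp_all del: k_ops\<close>)
    then show ?thesis by simp
  qed
  have cV: "(\<lambda>w. \<Oplus>\<tau>\<in>G. \<tau> (z b) \<otimes> w \<tau>) \<in> module_hom L V (self_algebra L)" if b: "b \<in> \<beta>" for b
  proof (rule module_homI)
    fix v w assume vw: "v \<in> carrier V" "w \<in> carrier V"
    have "(\<Oplus>\<tau>\<in>G. \<tau> (z b) \<otimes> (v \<oplus>\<^bsub>V\<^esub> w) \<tau>) =
        (\<Oplus>\<tau>\<in>G. \<tau> (z b) \<otimes> v \<tau> \<oplus> \<tau> (z b) \<otimes> w \<tau>)"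
      using vw z[OF b] by (intro L.finsum_cong') (auto simp: V_ops V_val L.r_distr)
    then show "(\<Oplus>\<tau>\<in>G. \<tau> (z b) \<otimes> (v \<oplus>\<^bsub>V\<^esub> w) \<tau>) = (\<Oplus>\<tau>\<in>G. \<tau> (z b) \<otimes> v \<tau>)
        \<oplus>\<^bsub>self_algebra L\<^esub> (\<Oplus>\<tau>\<in>G. \<tau> (z b) \<otimes> w \<tau>)"
      using vw z[OF b] by (simp add: L.finsum_addf V_val Pi_def)
  next
    fix r w assume rw: "r \<in> carrier L" "w \<in> carrier V"
    have "(\<Oplus>\<tau>\<in>G. \<tau> (z b) \<otimes> (r \<odot>\<^bsub>V\<^esub> w) \<tau>) = (\<Oplus>\<tau>\<in>G. r \<otimes> (\<tau> (z b) \<otimes> w \<tau>))"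
      using rw z[OF b] by (intro L.finsum_cong') (auto simp: V_ops V_val L.m_ac)
    then show "(\<Oplus>\<tau>\<in>G. \<tau> (z b) \<otimes> (r \<odot>\<^bsub>V\<^esub> w) \<tau>) =
        r \<odot>\<^bsub>self_algebra L\<^esub> (\<Oplus>\<tau>\<in>G. \<tau> (z b) \<otimes> w \<tau>)"
      using rw z[OF b] fin by (simp add: L.finsum_rdistr V_val Pi_def)
  qed (use z[OF b] V_val in \<open>auto intro!: L.finsum_closed\<close>)
  have cE: "(\<Oplus>\<tau>\<in>G. \<tau> (z b) \<otimes> evaluation b' \<tau>) = (if b = b' then \<one> else \<zero>)"
    if b: "b \<in> \<beta>" and b': "b' \<in> \<beta>" for b b'
  proof -
    have "(\<Oplus>\<tau>\<in>G. \<tau> (z b) \<otimes> evaluation b' \<tau>) = trace (b' \<otimes> z b)"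
      unfolding trace_def using b b' z \<beta>L
      by (intro L.finsum_cong') (auto simp: evaluation_def L.m_comm)
    then show ?thesis using dual[OF b' b] by auto
  qed
  have EV: "evaluation \<in> \<beta> \<rightarrow> carrier V" using evaluation_closed \<beta>L by auto
  note ind = V.dual_family_independent[OF \<beta>(1) EV, of "\<lambda>b w. \<Oplus>\<tau>\<in>G. \<tau> (z b) \<otimes> w \<tau>", OF cV cE]
  have pf: "point_fun (Gal k L) L \<in> G \<rightarrow> carrier V" by (auto simp: point_fun_def fun_algebra_sel)
  have pdual: "point_fun (Gal k L) L \<tau> \<sigma> = (if \<sigma> = \<tau> then \<one> else \<zero>)" if "\<sigma> \<in> G" "\<tau> \<in> G" for \<sigma> \<tau>
    using that by (simp add: point_fun_def)
  have pexpand: "w = (\<Oplus>\<^bsub>V\<^esub>\<tau>\<in>G. w \<tau> \<odot>\<^bsub>V\<^esub> point_fun (Gal k L) L \<tau>)" if w: "w \<in> carrier V" for w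
  proof (rule V_eqI[OF w])
    have mem: "(\<lambda>\<tau>. w \<tau> \<odot>\<^bsub>V\<^esub> point_fun (Gal k L) L \<tau>) \<in> G \<rightarrow> carrier V" using w pf V_val by auto
    then show "(\<Oplus>\<^bsub>V\<^esub>\<tau>\<in>G. w \<tau> \<odot>\<^bsub>V\<^esub> point_fun (Gal k L) L \<tau>) \<in> carrier V" by (rule V.M.finsum_closed)
    fix \<sigma> assume \<sigma>: "\<sigma> \<in> G"
    have "(\<Oplus>\<^bsub>V\<^esub>\<tau>\<in>G. w \<tau> \<odot>\<^bsub>V\<^esub> point_fun (Gal k L) L \<tau>) \<sigma> =
        (\<Oplus>\<tau>\<in>G. (w \<tau> \<odot>\<^bsub>V\<^esub> point_fun (Gal k L) L \<tau>) \<sigma>)"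
      using module_hom_finsum[OF V.module_axioms L_self_module V_eval_hom[OF \<sigma>] mem] by simp
    also have "\<dots> = (\<Oplus>\<tau>\<in>G. if \<sigma> = \<tau> then w \<tau> else \<zero>)"
      using \<sigma> w by (intro L.finsum_cong') (auto simp: V_ops pdual V_val)
    also have "\<dots> = w \<sigma>" using \<sigma> fin w V_val by (intro L.add.finprod_singleton) auto
    finally show "w \<sigma> = (\<Oplus>\<^bsub>V\<^esub>\<tau>\<in>G. w \<tau> \<odot>\<^bsub>V\<^esub> point_fun (Gal k L) L \<tau>) \<sigma>" ..
  qed
  note dimV = V.dual_family_dim[OF fin pf, of "\<lambda>\<sigma> w. w \<sigma>", OF V_eval_hom pdual pexpand]
  have "card (evaluation ` \<beta>) \<le> card G"
    using V.li_le_dim(2)[OF dimV(1) _ ind(2)] EV dimV(2) by auto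
  then have "card \<beta> \<le> card G" using ind(1) by (simp add: card_image)
  then have card: "card G = card \<beta>" using finite_gal_subset_card[OF \<beta> fin order_refl] by simp
  then obtain e where e: "bij_betw e G \<beta>" using fin \<beta>(1) finite_same_card_bij by blast
  have e\<beta>: "e \<rho> \<in> \<beta>" if "\<rho> \<in> G" for \<rho> using e that by (auto simp: bij_betw_def)
  show thesis
  proof (rule that[of "\<lambda>\<rho>. z (e \<rho>)" e])
    show "finite G" by (rule fin)
    show "card G = ext_degree k L" using card \<beta>_card[OF \<beta>] by simp
    show "z (e \<rho>) \<in> carrier L" "e \<rho> \<in> carrier L" if "\<rho> \<in> G" for \<rho> using e\<beta>[OF that] z \<beta>L by auto
    show "(\<Oplus>\<rho>\<in>G. \<sigma> (z (e \<rho>)) \<otimes> \<tau> (e \<rho>)) = (if \<sigma> = \<tau> then \<one> else \<zero>)"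
      if \<sigma>: "\<sigma> \<in> G" and \<tau>: "\<tau> \<in> G" for \<sigma> \<tau>
      using L.add.finprod_reindex[of "\<lambda>b. \<sigma> (z b) \<otimes> \<tau> b" e G] e orth[OF \<sigma> \<tau>] \<sigma> \<tau> z \<beta>L
      by (auto simp: bij_betw_def)
    show "(\<Oplus>\<sigma>\<in>G. \<sigma> (e \<rho>) \<otimes> \<sigma> (z (e \<pi>))) = (if \<rho> = \<pi> then \<one> else \<zero>)"
      if \<rho>: "\<rho> \<in> G" and \<pi>: "\<pi> \<in> G" for \<rho> \<pi>
    proof -
      have "(\<Oplus>\<sigma>\<in>G. \<sigma> (e \<rho>) \<otimes> \<sigma> (z (e \<pi>))) = trace (e \<rho> \<otimes> z (e \<pi>))"
        unfolding trace_def using e\<beta>[OF \<rho>] e\<beta>[OF \<pi>] z \<beta>L by (intro L.finsum_cong') auto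
      moreover have "e \<rho> = e \<pi> \<longleftrightarrow> \<rho> = \<pi>" using e \<rho> \<pi> by (auto simp: bij_betw_def inj_on_def)
      ultimately show ?thesis using dual[OF e\<beta>[OF \<rho>] e\<beta>[OF \<pi>]] by simp
    qed
  qed
qed

end

section \<open>Equivariant functions\<close>

text \<open>
  \<open>G\<close> acts on \<open>\<Gamma>\<close> through group automorphisms \<open>act \<sigma>\<close>. The functions \<open>f\<close> with \<open>f(\<sigma> x) = \<sigma>(f x)\<close> form
  the algebra to be constructed, and \<open>h\<close> and \<open>c\<close> are dual families of such functions.
\<close>

locale equivariant_functions = galois_extension k L + Gam: group \<Gamma>
  for k :: "'a ring" and L :: "'a ring" (structure) and \<Gamma> :: "('g, 'n) monoid_scheme" +
  fixes act :: "('a \<Rightarrow> 'a) \<Rightarrow> 'g \<Rightarrow> 'g" and h c :: "'g \<Rightarrow> 'g \<Rightarrow> 'a"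
  assumes finite_group: "finite (carrier \<Gamma>)"
    and act_bij: "\<And>\<sigma>. \<sigma> \<in> carrier (Gal k L) \<Longrightarrow> bij_betw (act \<sigma>) (carrier \<Gamma>) (carrier \<Gamma>)"
    and act_mult: "\<And>\<sigma> x y. \<sigma> \<in> carrier (Gal k L) \<Longrightarrow> x \<in> carrier \<Gamma> \<Longrightarrow> y \<in> carrier \<Gamma> \<Longrightarrow>
      act \<sigma> (x \<otimes>\<^bsub>\<Gamma>\<^esub> y) = act \<sigma> x \<otimes>\<^bsub>\<Gamma>\<^esub> act \<sigma> y"
    and family: "\<And>i. i \<in> carrier \<Gamma> \<Longrightarrow> h i \<in> carrier \<Gamma> \<rightarrow>\<^sub>E carrier L"
      "\<And>i. i \<in> carrier \<Gamma> \<Longrightarrow> c i \<in> carrier \<Gamma> \<rightarrow>\<^sub>E carrier L"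
    and family_equivariant: "\<And>i \<sigma> x. i \<in> carrier \<Gamma> \<Longrightarrow> \<sigma> \<in> carrier (Gal k L) \<Longrightarrow> x \<in> carrier \<Gamma> \<Longrightarrow>
        h i (act \<sigma> x) = \<sigma> (h i x)"
      "\<And>i \<sigma> x. i \<in> carrier \<Gamma> \<Longrightarrow> \<sigma> \<in> carrier (Gal k L) \<Longrightarrow> x \<in> carrier \<Gamma> \<Longrightarrow>
        c i (act \<sigma> x) = \<sigma> (c i x)"
    and family_dual: "\<And>x y. x \<in> carrier \<Gamma> \<Longrightarrow> y \<in> carrier \<Gamma> \<Longrightarrow>
      (\<Oplus>i\<in>carrier \<Gamma>. h i x \<otimes> c i y) = (if x = y then \<one> else \<zero>)"
begin

lemma act_closed [simp]: "\<sigma> \<in> carrier (Gal k L) \<Longrightarrow> x \<in> carrier \<Gamma> \<Longrightarrow> act \<sigma> x \<in> carrier \<Gamma>"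
  using act_bij by (auto simp: bij_betw_def)

lemma act_one: "\<sigma> \<in> carrier (Gal k L) \<Longrightarrow> act \<sigma> \<one>\<^bsub>\<Gamma>\<^esub> = \<one>\<^bsub>\<Gamma>\<^esub>"
  using act_mult[of \<sigma> "\<one>\<^bsub>\<Gamma>\<^esub>" "\<one>\<^bsub>\<Gamma>\<^esub>"] by simp

lemma act_inv:
  assumes "\<sigma> \<in> carrier (Gal k L)" "x \<in> carrier \<Gamma>"
  shows "act \<sigma> (inv\<^bsub>\<Gamma>\<^esub> x) = inv\<^bsub>\<Gamma>\<^esub> (act \<sigma> x)"
  using act_mult[OF assms(1), of "inv\<^bsub>\<Gamma>\<^esub> x" x] assms act_one
  by (intro Gam.inv_equality[symmetric]) auto

definition equivariant :: "('g \<Rightarrow> 'a) set" where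
  "equivariant = {f \<in> carrier \<Gamma> \<rightarrow>\<^sub>E carrier L.
     \<forall>\<sigma>\<in>carrier (Gal k L). \<forall>x\<in>carrier \<Gamma>. f (act \<sigma> x) = \<sigma> (f x)}"

definition equivariant_algebra :: "('a, 'g \<Rightarrow> 'a) module" where
  "equivariant_algebra = (fun_algebra \<Gamma> L)\<lparr>carrier := equivariant\<rparr>"

lemma equivariantI:
  assumes "\<And>x. x \<in> carrier \<Gamma> \<Longrightarrow> f x \<in> carrier L"
    and "\<And>\<sigma> x. \<sigma> \<in> carrier (Gal k L) \<Longrightarrow> x \<in> carrier \<Gamma> \<Longrightarrow> f (act \<sigma> x) = \<sigma> (f x)"
  shows "(\<lambda>x\<in>carrier \<Gamma>. f x) \<in> equivariant"
  using assms by (auto simp: equivariant_def)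

lemma equivariantD:
  assumes "f \<in> equivariant"
  shows "\<And>x. x \<in> carrier \<Gamma> \<Longrightarrow> f x \<in> carrier L"
    and "\<And>\<sigma> x. \<sigma> \<in> carrier (Gal k L) \<Longrightarrow> x \<in> carrier \<Gamma> \<Longrightarrow> f (act \<sigma> x) = \<sigma> (f x)"
    and "f \<in> carrier \<Gamma> \<rightarrow>\<^sub>E carrier L"
  using assms by (auto simp: equivariant_def)

lemma sum_equivariant_in_k:
  assumes "f \<in> equivariant" "g \<in> equivariant"
  shows "(\<Oplus>x\<in>carrier \<Gamma>. f x \<otimes> g x) \<in> carrier k"
  by (rule invariant_sum_in_k[where p = act])
    (use equivariantD[OF assms(1)] equivariantD[OF assms(2)] act_bij in auto)

lemma family_in: "i \<in> carrier \<Gamma> \<Longrightarrow> h i \<in> equivariant" "i \<in> carrier \<Gamma> \<Longrightarrow> c i \<in> equivariant"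
  using family family_equivariant by (auto simp: equivariant_def)

sublocale function_module k L \<Gamma> equivariant_algebra h c
proof unfold_locales
  have car: "carrier equivariant_algebra = equivariant" by (simp add: equivariant_algebra_def)
  note D = equivariantD
  show "finite (carrier \<Gamma>)" by (rule finite_group)
  show "carrier equivariant_algebra \<subseteq> carrier \<Gamma> \<rightarrow>\<^sub>E carrier L" unfolding car using D(3) by blast
  show "monoid.mult equivariant_algebra = monoid.mult (fun_algebra \<Gamma> L)"
    "monoid.one equivariant_algebra = monoid.one (fun_algebra \<Gamma> L)"
    "ring.add equivariant_algebra = ring.add (fun_algebra \<Gamma> L)"
    "ring.zero equivariant_algebra = ring.zero (fun_algebra \<Gamma> L)"
    "smult equivariant_algebra = smult (fun_algebra \<Gamma> L)"
    by (simp_all add: equivariant_algebra_def)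
  show "\<And>f g. f \<in> carrier equivariant_algebra \<Longrightarrow> g \<in> carrier equivariant_algebra \<Longrightarrow>
      f \<otimes>\<^bsub>equivariant_algebra\<^esub> g \<in> carrier equivariant_algebra"
    "\<And>f g. f \<in> carrier equivariant_algebra \<Longrightarrow> g \<in> carrier equivariant_algebra \<Longrightarrow>
      f \<oplus>\<^bsub>equivariant_algebra\<^esub> g \<in> carrier equivariant_algebra"
    "\<And>r f. r \<in> carrier k \<Longrightarrow> f \<in> carrier equivariant_algebra \<Longrightarrow>
      r \<odot>\<^bsub>equivariant_algebra\<^esub> f \<in> carrier equivariant_algebra"
    "\<one>\<^bsub>equivariant_algebra\<^esub> \<in> carrier equivariant_algebra"
    "\<zero>\<^bsub>equivariant_algebra\<^esub> \<in> carrier equivariant_algebra"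
    unfolding equivariant_algebra_def
    by (simp_all add: fun_algebra_sel; intro equivariantI; simp add: D(1,2) k_in_L gal_fix)+
  show "\<And>i. i \<in> carrier \<Gamma> \<Longrightarrow> h i \<in> carrier equivariant_algebra" unfolding car by (rule family_in)
  show "\<And>i x. i \<in> carrier \<Gamma> \<Longrightarrow> x \<in> carrier \<Gamma> \<Longrightarrow> c i x \<in> carrier L" using D(1)[OF family_in(2)] .
  show "\<And>i f. i \<in> carrier \<Gamma> \<Longrightarrow> f \<in> carrier equivariant_algebra \<Longrightarrow>
      (\<Oplus>x\<in>carrier \<Gamma>. c i x \<otimes> f x) \<in> carrier k"
    unfolding car by (intro sum_equivariant_in_k family_in)
qed (rule family_dual)

lemma carrier_equivariant_algebra [simp]: "carrier equivariant_algebra = equivariant"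
  by (simp add: equivariant_algebra_def)

text \<open>
  The coefficients of \<open>(x, y) \<mapsto> f(x y)\<close> in its first variable are equivariant in \<open>y\<close>: acting on \<open>y\<close> is
  compensated by acting on the summation variable \<open>x\<close>, because \<open>act \<sigma>\<close> respects products.
\<close>

lemma translation_comes_from_tensor:
  assumes f: "f \<in> equivariant"
  shows "\<exists>t\<in>carrier (tensor_module k equivariant_algebra equivariant_algebra).
    \<forall>x\<in>carrier \<Gamma>. \<forall>y\<in>carrier \<Gamma>. ev x y t = f (x \<otimes>\<^bsub>\<Gamma>\<^esub> y)"
proof (rule two_variable_function)
  note D = equivariantD[OF f]
  show "\<And>x y. x \<in> carrier \<Gamma> \<Longrightarrow> y \<in> carrier \<Gamma> \<Longrightarrow> f (x \<otimes>\<^bsub>\<Gamma>\<^esub> y) \<in> carrier L" using D(1) by simp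
  fix i assume i: "i \<in> carrier \<Gamma>"
  note C = equivariantD[OF family_in(2)[OF i]]
  show "(\<lambda>y\<in>carrier \<Gamma>. \<Oplus>x\<in>carrier \<Gamma>. c i x \<otimes> f (x \<otimes>\<^bsub>\<Gamma>\<^esub> y)) \<in> carrier equivariant_algebra"
    unfolding carrier_equivariant_algebra
  proof (rule equivariantI)
    show "(\<Oplus>x\<in>carrier \<Gamma>. c i x \<otimes> f (x \<otimes>\<^bsub>\<Gamma>\<^esub> y)) \<in> carrier L" if "y \<in> carrier \<Gamma>" for y
      using C(1) D(1) that by (intro L.finsum_closed) auto
    fix \<sigma> y assume \<sigma>: "\<sigma> \<in> carrier (Gal k L)" and y: "y \<in> carrier \<Gamma>"
    have "(\<Oplus>x\<in>carrier \<Gamma>. c i x \<otimes> f (x \<otimes>\<^bsub>\<Gamma>\<^esub> act \<sigma> y)) =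
        (\<Oplus>x\<in>carrier \<Gamma>. c i (act \<sigma> x) \<otimes> f (act \<sigma> x \<otimes>\<^bsub>\<Gamma>\<^esub> act \<sigma> y))"
      using L.add.finprod_reindex[of "\<lambda>x. c i x \<otimes> f (x \<otimes>\<^bsub>\<Gamma>\<^esub> act \<sigma> y)" "act \<sigma>" "carrier \<Gamma>"]
        act_bij[OF \<sigma>] C(1) D(1) \<sigma> y by (auto simp: bij_betw_def)
    also have "\<dots> = (\<Oplus>x\<in>carrier \<Gamma>. \<sigma> (c i x \<otimes> f (x \<otimes>\<^bsub>\<Gamma>\<^esub> y)))"
      using C D \<sigma> y by (intro L.finsum_cong') (auto simp: act_mult[symmetric])
    also have "\<dots> = \<sigma> (\<Oplus>x\<in>carrier \<Gamma>. c i x \<otimes> f (x \<otimes>\<^bsub>\<Gamma>\<^esub> y))"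
      using C(1) D(1) \<sigma> y by (intro gal_finsum[symmetric]) auto
    finally show "(\<Oplus>x\<in>carrier \<Gamma>. c i x \<otimes> f (x \<otimes>\<^bsub>\<Gamma>\<^esub> act \<sigma> y)) =
        \<sigma> (\<Oplus>x\<in>carrier \<Gamma>. c i x \<otimes> f (x \<otimes>\<^bsub>\<Gamma>\<^esub> y))" .
  qed
qed

text \<open>
  The tensor chosen for the comultiplication is unique, since its values are prescribed.
\<close>

definition equivariant_hopf :: "('a, 'g \<Rightarrow> 'a) hopf" where
  "equivariant_hopf = module.extend equivariant_algebra (hopf.fields
     (\<lambda>f. SOME t. t \<in> carrier (tensor_module k equivariant_algebra equivariant_algebra) \<and>
        (\<forall>x\<in>carrier \<Gamma>. \<forall>y\<in>carrier \<Gamma>. ev x y t = f (x \<otimes>\<^bsub>\<Gamma>\<^esub> y)))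
     (\<lambda>f. f \<one>\<^bsub>\<Gamma>\<^esub>)
     (\<lambda>f. \<lambda>x\<in>carrier \<Gamma>. f (inv\<^bsub>\<Gamma>\<^esub> x)))"

lemma equivariant_hopf_sel [simp]:
  "carrier equivariant_hopf = equivariant"
  "monoid.mult equivariant_hopf = monoid.mult (fun_algebra \<Gamma> L)"
  "monoid.one equivariant_hopf = monoid.one (fun_algebra \<Gamma> L)"
  "ring.add equivariant_hopf = ring.add (fun_algebra \<Gamma> L)"
  "ring.zero equivariant_hopf = ring.zero (fun_algebra \<Gamma> L)"
  "smult equivariant_hopf = smult (fun_algebra \<Gamma> L)"
  "counit equivariant_hopf f = f \<one>\<^bsub>\<Gamma>\<^esub>"
  "antipode equivariant_hopf f = (\<lambda>x\<in>carrier \<Gamma>. f (inv\<^bsub>\<Gamma>\<^esub> x))"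
  by (simp_all add: equivariant_hopf_def module.extend_def hopf.fields_def equivariant_algebra_def)

lemma equivariant_comult:
  assumes "f \<in> equivariant"
  shows "comult equivariant_hopf f \<in> carrier (tensor_module k equivariant_algebra equivariant_algebra)"
    and "\<And>x y. x \<in> carrier \<Gamma> \<Longrightarrow> y \<in> carrier \<Gamma> \<Longrightarrow> ev x y (comult equivariant_hopf f) = f (x \<otimes>\<^bsub>\<Gamma>\<^esub> y)"
proof -
  let ?P = "\<lambda>t. t \<in> carrier (tensor_module k equivariant_algebra equivariant_algebra) \<and>
        (\<forall>x\<in>carrier \<Gamma>. \<forall>y\<in>carrier \<Gamma>. ev x y t = f (x \<otimes>\<^bsub>\<Gamma>\<^esub> y))"
  have "comult equivariant_hopf f = (SOME t. ?P t)"
    by (simp add: equivariant_hopf_def module.extend_def hopf.fields_def)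
  moreover have "?P (SOME t. ?P t)"
    using translation_comes_from_tensor[OF assms] by (intro someI_ex[of ?P]) blast
  ultimately show "comult equivariant_hopf f \<in> carrier (tensor_module k equivariant_algebra equivariant_algebra)"
    "\<And>x y. x \<in> carrier \<Gamma> \<Longrightarrow> y \<in> carrier \<Gamma> \<Longrightarrow> ev x y (comult equivariant_hopf f) = f (x \<otimes>\<^bsub>\<Gamma>\<^esub> y)"
    by simp_all
qed

theorem equivariant_form: "function_form k L \<Gamma> equivariant_hopf h c"
proof -
  have TT: "tensor_module k equivariant_hopf equivariant_hopf =
      tensor_module k equivariant_algebra equivariant_algebra"
    by (rule tensor_module_cong) (simp_all add: equivariant_algebra_def)
  note car = carrier_equivariant_algebra
  show ?thesis
  proof unfold_locales
    show "finite (carrier \<Gamma>)" by (rule fin)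
    show "carrier equivariant_hopf \<subseteq> carrier \<Gamma> \<rightarrow>\<^sub>E carrier L" using carrier_sub by simp
    show "\<And>f g. f \<in> carrier equivariant_hopf \<Longrightarrow> g \<in> carrier equivariant_hopf \<Longrightarrow>
        f \<otimes>\<^bsub>equivariant_hopf\<^esub> g \<in> carrier equivariant_hopf"
      "\<And>f g. f \<in> carrier equivariant_hopf \<Longrightarrow> g \<in> carrier equivariant_hopf \<Longrightarrow>
        f \<oplus>\<^bsub>equivariant_hopf\<^esub> g \<in> carrier equivariant_hopf"
      "\<And>r f. r \<in> carrier k \<Longrightarrow> f \<in> carrier equivariant_hopf \<Longrightarrow>
        r \<odot>\<^bsub>equivariant_hopf\<^esub> f \<in> carrier equivariant_hopf"
      "\<one>\<^bsub>equivariant_hopf\<^esub> \<in> carrier equivariant_hopf"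
      "\<zero>\<^bsub>equivariant_hopf\<^esub> \<in> carrier equivariant_hopf"
      using closed unfolding ops by simp_all
    show "\<And>i. i \<in> carrier \<Gamma> \<Longrightarrow> h i \<in> carrier equivariant_hopf" using h by simp
    show "\<And>i x. i \<in> carrier \<Gamma> \<Longrightarrow> x \<in> carrier \<Gamma> \<Longrightarrow> c i x \<in> carrier L" by (rule c)
    show "\<And>i f. i \<in> carrier \<Gamma> \<Longrightarrow> f \<in> carrier equivariant_hopf \<Longrightarrow>
      (\<Oplus>x\<in>carrier \<Gamma>. c i x \<otimes> f x) \<in> carrier k" using coef by simp
    show "\<And>x y. x \<in> carrier \<Gamma> \<Longrightarrow> y \<in> carrier \<Gamma> \<Longrightarrow>
      (\<Oplus>i\<in>carrier \<Gamma>. h i x \<otimes> c i y) = (if x = y then \<one> else \<zero>)" by (rule dual)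
    fix f assume "f \<in> carrier equivariant_hopf"
    then have f: "f \<in> equivariant" by simp
    note D = equivariantD[OF f]
    show "f \<one>\<^bsub>\<Gamma>\<^esub> \<in> carrier k"
    proof (rule fixed_in_k)
      show "f \<one>\<^bsub>\<Gamma>\<^esub> \<in> carrier L" using D(1) by simp
      show "\<sigma> (f \<one>\<^bsub>\<Gamma>\<^esub>) = f \<one>\<^bsub>\<Gamma>\<^esub>" if "\<sigma> \<in> carrier (Gal k L)" for \<sigma>
        using D(2)[OF that, of "\<one>\<^bsub>\<Gamma>\<^esub>"] act_one[OF that] by simp
    qed
    show "antipode equivariant_hopf f \<in> carrier equivariant_hopf"
      unfolding equivariant_hopf_sel
      by (rule equivariantI) (simp_all add: D act_inv[symmetric])
    show "comult equivariant_hopf f \<in> carrier (tensor_module k equivariant_hopf equivariant_hopf)"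
      unfolding TT by (rule equivariant_comult(1)[OF f])
    show "\<And>x y. x \<in> carrier \<Gamma> \<Longrightarrow> y \<in> carrier \<Gamma> \<Longrightarrow>
      tensor_lift k (self_algebra L) (\<lambda>a b. a x \<otimes> b y) (comult equivariant_hopf f) = f (x \<otimes>\<^bsub>\<Gamma>\<^esub> y)"
      using equivariant_comult(2)[OF f] by (simp add: ev_def)
  qed simp_all
qed

sublocale EH: function_form k L \<Gamma> equivariant_hopf h c by (rule equivariant_form)

text \<open>
  If the two families are also orthogonal in the other order, pairing with \<open>c\<close> gives the coefficient
  functionals of the basis \<open>h\<close>.
\<close>

lemma equivariant_dim:
  assumes dual': "\<And>i j. i \<in> carrier \<Gamma> \<Longrightarrow> j \<in> carrier \<Gamma> \<Longrightarrow>
    (\<Oplus>x\<in>carrier \<Gamma>. c i x \<otimes> h j x) = (if i = j then \<one> else \<zero>)"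
  shows "vectorspace.fin_dim k equivariant_hopf" "vectorspace.dim k equivariant_hopf = card (carrier \<Gamma>)"
proof -
  interpret HV: vectorspace k equivariant_hopf
    by (intro vectorspace.intro EH.H_module k_field)
  let ?C = "\<lambda>i f. \<Oplus>x\<in>carrier \<Gamma>. c i x \<otimes> f x"
  have C: "?C i \<in> module_hom k equivariant_hopf (self_algebra k)" if i: "i \<in> carrier \<Gamma>" for i
  proof (rule module_homI)
    show "?C i f \<in> carrier (self_algebra k)" if "f \<in> carrier equivariant_hopf" for f
      using EH.coef[OF i that] by simp
    fix f g assume fg: "f \<in> carrier equivariant_hopf" "g \<in> carrier equivariant_hopf"
    have "?C i (f \<oplus>\<^bsub>equivariant_hopf\<^esub> g) = (\<Oplus>x\<in>carrier \<Gamma>. c i x \<otimes> f x \<oplus> c i x \<otimes> g x)"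
      using fg c[OF i] by (intro L.finsum_cong') (auto simp: L.r_distr simp del: equivariant_hopf_sel)
    also have "\<dots> = ?C i f \<oplus> ?C i g"
      using fg c[OF i] by (intro L.finsum_addf) (auto simp del: equivariant_hopf_sel)
    finally show "?C i (f \<oplus>\<^bsub>equivariant_hopf\<^esub> g) = ?C i f \<oplus>\<^bsub>self_algebra k\<^esub> ?C i g" by simp
  next
    fix r f assume rf: "r \<in> carrier k" "f \<in> carrier equivariant_hopf"
    have "?C i (r \<odot>\<^bsub>equivariant_hopf\<^esub> f) = (\<Oplus>x\<in>carrier \<Gamma>. r \<otimes> (c i x \<otimes> f x))"
      using rf c[OF i] k_in_L by (intro L.finsum_cong') (auto simp: L.m_ac simp del: equivariant_hopf_sel)
    also have "\<dots> = r \<otimes> ?C i f"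
      using rf c[OF i] k_in_L fin by (intro L.finsum_rdistr[symmetric]) (auto simp del: equivariant_hopf_sel)
    finally show "?C i (r \<odot>\<^bsub>equivariant_hopf\<^esub> f) = r \<odot>\<^bsub>self_algebra k\<^esub> ?C i f" by simp
  qed
  have hH: "h \<in> carrier \<Gamma> \<rightarrow> carrier equivariant_hopf" using EH.h by blast
  have D: "?C i (h j) = (if i = j then \<one>\<^bsub>k\<^esub> else \<zero>\<^bsub>k\<^esub>)" if "i \<in> carrier \<Gamma>" "j \<in> carrier \<Gamma>" for i j
    using dual'[OF that] by simp
  have expand: "f = (\<Oplus>\<^bsub>equivariant_hopf\<^esub>i\<in>carrier \<Gamma>. ?C i f \<odot>\<^bsub>equivariant_hopf\<^esub> h i)"
    if "f \<in> carrier equivariant_hopf" for f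
    using EH.H_coordinates that unfolding coordinates_def by blast
  note dims = HV.dual_family_dim[OF fin hH, of ?C, OF C D expand]
  show "HV.fin_dim" by (rule dims(1))
  show "HV.dim = card (carrier \<Gamma>)" by (rule dims(2))
qed

end

section \<open>The generalized dihedral group\<close>

lemma inversion_semidirect_simps:
  "carrier (inversion_semidirect N) = {0, 1} \<times> carrier N"
  "\<one>\<^bsub>inversion_semidirect N\<^esub> = (0, \<one>\<^bsub>N\<^esub>)"
  "(0, x) \<otimes>\<^bsub>inversion_semidirect N\<^esub> (0, y) = (0, x \<otimes>\<^bsub>N\<^esub> y)"
  "(1, x) \<otimes>\<^bsub>inversion_semidirect N\<^esub> (0, y) = (1, x \<otimes>\<^bsub>N\<^esub> y)"
  "(0, x) \<otimes>\<^bsub>inversion_semidirect N\<^esub> (1, y) = (1, inv\<^bsub>N\<^esub> x \<otimes>\<^bsub>N\<^esub> y)"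
  "(1, x) \<otimes>\<^bsub>inversion_semidirect N\<^esub> (1, y) = (0, inv\<^bsub>N\<^esub> x \<otimes>\<^bsub>N\<^esub> y)"
proof -
  have inv: "inv\<^bsub>integer_mod_group 2\<^esub> 0 = 0" "inv\<^bsub>integer_mod_group 2\<^esub> 1 = 1"
    by (simp_all add: carrier_integer_mod_group)
  have car: "carrier (integer_mod_group 2) = {0, 1}"
    by (auto simp: carrier_integer_mod_group)
  show "carrier (inversion_semidirect N) = {0, 1} \<times> carrier N"
    "\<one>\<^bsub>inversion_semidirect N\<^esub> = (0, \<one>\<^bsub>N\<^esub>)"
    "(0, x) \<otimes>\<^bsub>inversion_semidirect N\<^esub> (0, y) = (0, x \<otimes>\<^bsub>N\<^esub> y)"
    "(1, x) \<otimes>\<^bsub>inversion_semidirect N\<^esub> (0, y) = (1, x \<otimes>\<^bsub>N\<^esub> y)"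
    "(0, x) \<otimes>\<^bsub>inversion_semidirect N\<^esub> (1, y) = (1, inv\<^bsub>N\<^esub> x \<otimes>\<^bsub>N\<^esub> y)"
    "(1, x) \<otimes>\<^bsub>inversion_semidirect N\<^esub> (1, y) = (0, inv\<^bsub>N\<^esub> x \<otimes>\<^bsub>N\<^esub> y)"
    by (simp_all add: inversion_semidirect_def semidirect_product_def car inv del: inv_integer_mod_group)
qed

lemma inversion_semidirect_group:
  assumes "comm_group N"
  shows "group (inversion_semidirect N)"
proof -
  interpret N: comm_group N by fact
  note s = inversion_semidirect_simps
  show ?thesis
  proof (rule groupI)
    fix x assume "x \<in> carrier (inversion_semidirect N)"
    then consider g where "g \<in> carrier N" "x = (0, g)" | g where "g \<in> carrier N" "x = (1, g)"
      by (auto simp: s)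
    then show "\<exists>y\<in>carrier (inversion_semidirect N).
        y \<otimes>\<^bsub>inversion_semidirect N\<^esub> x = \<one>\<^bsub>inversion_semidirect N\<^esub>"
    proof cases
      case 1
      then show ?thesis by (intro bexI[of _ "(0, inv\<^bsub>N\<^esub> g)"]) (simp_all add: s)
    next
      case 2
      then show ?thesis by (intro bexI[of _ "(1, g)"]) (simp_all add: s)
    qed
  next
    fix x y z assume "x \<in> carrier (inversion_semidirect N)" "y \<in> carrier (inversion_semidirect N)"
      "z \<in> carrier (inversion_semidirect N)"
    then show "x \<otimes>\<^bsub>inversion_semidirect N\<^esub> y \<otimes>\<^bsub>inversion_semidirect N\<^esub> z =
        x \<otimes>\<^bsub>inversion_semidirect N\<^esub> (y \<otimes>\<^bsub>inversion_semidirect N\<^esub> z)"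
      by (auto simp: s N.m_assoc N.inv_mult)
  qed (auto simp: s)
qed

section \<open>Semisimplicity\<close>

text \<open>
  The ideals generated by the idempotents are the simple summands. The decomposition of \<open>x\<close> is the sum
  of the products \<open>e x\<close>, and the last hypothesis says that \<open>e\<close> lies in every nonzero ideal inside
  the one generated by \<open>e\<close>.
\<close>

lemma semisimple_ring_orthogonal_idempotents:
  fixes A :: "('b, 'm) ring_scheme" (structure)
  assumes "cring A" and E: "finite E" "E \<subseteq> carrier A"
    and orth: "\<And>e e'. e \<in> E \<Longrightarrow> e' \<in> E \<Longrightarrow> e \<otimes> e' = (if e = e' then e else \<zero>)"
    and sum: "(\<Oplus>e\<in>E. e) = \<one>"
    and nonzero: "\<zero> \<notin> E"
    and fld: "\<And>e x. e \<in> E \<Longrightarrow> x \<in> carrier A \<Longrightarrow> e \<otimes> x \<noteq> \<zero> \<Longrightarrow>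
      \<exists>y\<in>carrier A. y \<otimes> (e \<otimes> x) = e"
  shows "semisimple_ring A"
proof -
  interpret A: cring A by fact
  define S where "S e = (\<lambda>x. e \<otimes> x) ` carrier A" for e
  have EA: "e \<in> carrier A" if "e \<in> E" for e using E(2) that by blast
  have eS: "e \<in> S e" if "e \<in> E" for e
    unfolding S_def using EA[OF that] orth[OF that that] by (intro image_eqI[of _ _ e]) auto
  have S_car: "S e \<subseteq> carrier A" if "e \<in> E" for e using EA[OF that] by (auto simp: S_def)
  have S_id: "e \<otimes> s = s" if e: "e \<in> E" and s: "s \<in> S e" for e s
  proof -
    obtain x where x: "x \<in> carrier A" "s = e \<otimes> x" using s by (auto simp: S_def)
    then show ?thesis using A.m_assoc[of e e x] EA[OF e] orth[OF e e] by simp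
  qed
  have S_orth: "e \<otimes> s = \<zero>" if e: "e \<in> E" and e': "e' \<in> E" and ne: "e \<noteq> e'" and s: "s \<in> S e'" for e e' s
  proof -
    obtain x where x: "x \<in> carrier A" "s = e' \<otimes> x" using s by (auto simp: S_def)
    then show ?thesis using A.m_assoc[of e e' x] EA[OF e] EA[OF e'] orth[OF e e'] ne by simp
  qed
  have inj: "inj_on S E"
  proof (rule inj_onI)
    fix e e' assume e: "e \<in> E" and e': "e' \<in> E" and eq: "S e = S e'"
    have "e \<in> S e'" using eS[OF e] eq by simp
    then have "e' \<otimes> e = e" by (rule S_id[OF e'])
    then show "e = e'" using orth[OF e' e] nonzero e by (auto split: if_splits)
  qed
  have left: "left_ideal (S e) A" if e: "e \<in> E" for e
  proof -
    note [simp] = EA[OF e]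
    have "subgroup (S e) (add_monoid A)"
    proof (rule A.add.subgroupI)
      show "S e \<subseteq> carrier A" by (rule S_car[OF e])
      show "S e \<noteq> {}" using eS[OF e] by blast
      show "\<ominus> a \<in> S e" if a: "a \<in> S e" for a
      proof -
        obtain x where "x \<in> carrier A" "a = e \<otimes> x" using a by (auto simp: S_def)
        then have "\<ominus> a = e \<otimes> (\<ominus> x)" "\<ominus> x \<in> carrier A" by (simp_all add: A.r_minus)
        then show ?thesis unfolding S_def by blast
      qed
      show "a \<oplus> b \<in> S e" if "a \<in> S e" "b \<in> S e" for a b
      proof -
        obtain x y where "x \<in> carrier A" "a = e \<otimes> x" "y \<in> carrier A" "b = e \<otimes> y"
          using \<open>a \<in> S e\<close> \<open>b \<in> S e\<close> by (auto simp: S_def)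
        then have "a \<oplus> b = e \<otimes> (x \<oplus> y)" "x \<oplus> y \<in> carrier A" by (simp_all add: A.r_distr)
        then show ?thesis unfolding S_def by auto
      qed
    qed
    then have "additive_subgroup (S e) A" by (rule additive_subgroupI)
    moreover have "a \<otimes> s \<in> S e" if a: "a \<in> carrier A" and s: "s \<in> S e" for a s
    proof -
      obtain x where "x \<in> carrier A" "s = e \<otimes> x" using s by (auto simp: S_def)
      then have "a \<otimes> s = e \<otimes> (a \<otimes> x)" "a \<otimes> x \<in> carrier A" using a by (simp_all add: A.m_lcomm)
      then show ?thesis unfolding S_def by blast
    qed
    ultimately show ?thesis unfolding left_ideal_def by blast
  qed
  have simple: "simple_left_ideal (S e) A" if e: "e \<in> E" for e
    unfolding simple_left_ideal_def
  proof (intro conjI allI impI)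
    show "left_ideal (S e) A" by (rule left[OF e])
    show "S e \<noteq> {\<zero>}" using eS[OF e] nonzero e by (metis singletonD)
    fix I assume I: "left_ideal I A \<and> I \<subseteq> S e"
    have sub: "additive_subgroup I A" using I unfolding left_ideal_def by blast
    have mult: "a \<otimes> x \<in> I" if "a \<in> carrier A" "x \<in> I" for a x
      using I that unfolding left_ideal_def by blast
    show "I = {\<zero>} \<or> I = S e"
    proof (cases "I \<subseteq> {\<zero>}")
      case True
      then show ?thesis using additive_subgroup.zero_closed[OF sub] by blast
    next
      case False
      then obtain s where s: "s \<in> I" "s \<noteq> \<zero>" by blast
      then obtain x where x: "x \<in> carrier A" "s = e \<otimes> x" using I by (auto simp: S_def)
      obtain y where y: "y \<in> carrier A" "y \<otimes> s = e" using fld[OF e x(1)] s(2) x(2) by blast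
      have eI: "e \<in> I" using mult[OF y(1) s(1)] y(2) by simp
      have "S e \<subseteq> I"
      proof
        fix t assume t: "t \<in> S e"
        have tA: "t \<in> carrier A" using t S_car[OF e] by blast
        have "t \<otimes> e \<in> I" by (rule mult[OF tA eI])
        then show "t \<in> I" using S_id[OF e t] A.m_comm[OF tA EA[OF e]] by simp
      qed
      then show ?thesis using I by blast
    qed
  qed
  have unique: "\<exists>!f. f \<in> (\<Pi>\<^sub>E T\<in>S ` E. T) \<and> x = (\<Oplus>T\<in>S ` E. f T)" if x: "x \<in> carrier A" for x
  proof (rule ex1I)
    define f where "f = (\<lambda>T\<in>S ` E. the_inv_into E S T \<otimes> x)"
    have fS: "f (S e) = e \<otimes> x" if "e \<in> E" for e
      using that by (simp add: f_def the_inv_into_f_f[OF inj])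
    have "(\<Oplus>T\<in>S ` E. f T) = (\<Oplus>e\<in>E. f (S e))"
      using fS EA x by (intro A.add.finprod_reindex[OF _ inj]) auto
    also have "\<dots> = (\<Oplus>e\<in>E. e \<otimes> x)" using fS EA x by (intro A.finsum_cong') auto
    also have "\<dots> = x" using A.finsum_ldistr[of E x "\<lambda>e. e"] EA x sum E(1) by (simp add: Pi_def)
    finally have sum_f: "x = (\<Oplus>T\<in>S ` E. f T)" ..
    have fS': "f (S e) \<in> S e" if "e \<in> E" for e
    proof -
      have "e \<otimes> x \<in> S e" unfolding S_def using x by (rule imageI)
      then show ?thesis by (simp only: fS[OF that])
    qed
    have f: "f \<in> (\<Pi>\<^sub>E T\<in>S ` E. T)"
    proof (rule PiE_I)
      show "f T \<in> T" if T: "T \<in> S ` E" for T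
        using T by (elim imageE) (simp only: fS')
      show "f T = undefined" if "T \<notin> S ` E" for T using that by (simp add: f_def)
    qed
    show "f \<in> (\<Pi>\<^sub>E T\<in>S ` E. T) \<and> x = (\<Oplus>T\<in>S ` E. f T)"
      by (rule conjI[OF f sum_f])
    fix g assume g: "g \<in> (\<Pi>\<^sub>E T\<in>S ` E. T) \<and> x = (\<Oplus>T\<in>S ` E. g T)"
    have gS: "g (S e) \<in> S e" if "e \<in> E" for e
      by (rule PiE_mem[OF conjunct1[OF g] imageI[OF that]])
    have gA: "g (S e) \<in> carrier A" if "e \<in> E" for e using gS[OF that] S_car[OF that] by blast
    have "(\<Oplus>T\<in>S ` E. g T) = (\<Oplus>e\<in>E. g (S e))"
      by (rule A.add.finprod_reindex[OF _ inj]) (use gA in auto)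
    then have xg: "x = (\<Oplus>e\<in>E. g (S e))" by (rule trans[OF conjunct2[OF g]])
    have gf: "g (S e) = f (S e)" if e: "e \<in> E" for e
    proof -
      have "e \<otimes> x = (\<Oplus>e'\<in>E. e \<otimes> g (S e'))"
        unfolding xg using gA EA[OF e] E(1) by (intro A.finsum_rdistr) auto
      also have "\<dots> = (\<Oplus>e'\<in>E. if e = e' then g (S e') else \<zero>)"
      proof (rule A.finsum_cong'[OF refl])
        show "e \<otimes> g (S e') = (if e = e' then g (S e') else \<zero>)" if e': "e' \<in> E" for e'
          using S_id[OF e gS[OF e]] S_orth[OF e e' _ gS[OF e']] by (cases "e = e'") simp_all
      qed (use gA in auto)
      also have "\<dots> = g (S e)" using e E(1) gA by (intro A.add.finprod_singleton) auto
      finally show ?thesis using fS[OF e] by simp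
    qed
    show "g = f"
    proof (rule PiE_ext[OF conjunct1[OF g] f])
      show "g T = f T" if T: "T \<in> S ` E" for T
        using T by (elim imageE) (simp only: gf)
    qed
  qed
  show ?thesis
    unfolding semisimple_ring_def
  proof (intro exI[of _ "S ` E"] conjI ballI)
    show "finite (S ` E)" using E(1) by simp
    show "simple_left_ideal T A" if T: "T \<in> S ` E" for T
      using T by (elim imageE) (simp only: simple)
    show "\<exists>!f. f \<in> (\<Pi>\<^sub>E T\<in>S ` E. T) \<and> x = (\<Oplus>T\<in>S ` E. f T)" if x: "x \<in> carrier A" for x
      using unique[OF x] .
  qed
qed

section \<open>The twisted form\<close>

locale abelian_galois_extension = galois_extension k L for k :: "'a ring" and L :: "'a ring" (structure) +
  assumes abelian: "comm_group (Gal k L)"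
begin

abbreviation (input) \<Gamma> where "\<Gamma> \<equiv> inversion_semidirect (Gal k L)"

lemmas \<Gamma>_simps [simp] = inversion_semidirect_simps[of "Gal k L"]

text \<open>
  The twist: \<open>\<sigma>\<close> acts trivially on the subgroup and by translation on the other coset.
\<close>

definition coset_action :: "('a \<Rightarrow> 'a) \<Rightarrow> int \<times> ('a \<Rightarrow> 'a) \<Rightarrow> int \<times> ('a \<Rightarrow> 'a)" where
  "coset_action \<sigma> x = (if fst x = 0 then x else (fst x, \<sigma> \<otimes>\<^bsub>Gal k L\<^esub> snd x))"

text \<open>
  The members indexed by the subgroup are its point functions. The members indexed by the other coset
  are supported there, and are the equivariant functions given by the elements \<open>w \<rho>\<close> of \<open>L\<close>.
\<close>

definition coset_family :: "(('a \<Rightarrow> 'a) \<Rightarrow> 'a) \<Rightarrow> int \<times> ('a \<Rightarrow> 'a) \<Rightarrow> int \<times> ('a \<Rightarrow> 'a) \<Rightarrow> 'a" where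
  "coset_family w i = (\<lambda>x\<in>carrier \<Gamma>.
     if fst i = 0 then (if x = i then \<one> else \<zero>)
     else if fst x = 0 then \<zero> else snd x (w (snd i)))"

lemma coset_family_simps [simp]:
  assumes "\<sigma> \<in> G" "\<tau> \<in> G"
  shows "coset_family w (0, \<sigma>) (0, \<tau>) = (if \<sigma> = \<tau> then \<one> else \<zero>)"
    "coset_family w (0, \<sigma>) (1, \<tau>) = \<zero>" "coset_family w (1, \<sigma>) (0, \<tau>) = \<zero>"
    "coset_family w (1, \<sigma>) (1, \<tau>) = \<tau> (w \<sigma>)"
  using assms by (auto simp: coset_family_def)

lemma finsum_two_cosets:
  assumes "finite G" "F \<in> carrier \<Gamma> \<rightarrow> carrier L"
  shows "(\<Oplus>x\<in>carrier \<Gamma>. F x) = (\<Oplus>\<sigma>\<in>G. F (0, \<sigma>)) \<oplus> (\<Oplus>\<sigma>\<in>G. F (1, \<sigma>))"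
proof -
  have F: "F (0, \<sigma>) \<in> carrier L" "F (1, \<sigma>) \<in> carrier L" if "\<sigma> \<in> G" for \<sigma>
    by (rule funcset_mem[OF assms(2)]; use that in simp)+
  have "carrier \<Gamma> = Pair 0 ` G \<union> Pair 1 ` G" by auto
  moreover have "(\<Oplus>x\<in>Pair 0 ` G \<union> Pair 1 ` G. F x) =
      (\<Oplus>x\<in>Pair 0 ` G. F x) \<oplus> (\<Oplus>x\<in>Pair 1 ` G. F x)"
  proof (rule L.finsum_Un_disjoint)
    show "Pair 0 ` G \<inter> Pair (1 :: int) ` G = {}" by auto
    show "F \<in> Pair 0 ` G \<rightarrow> carrier L" "F \<in> Pair 1 ` G \<rightarrow> carrier L"
      by (rule funcsetI, elim imageE, simp only: F)+
  qed (use assms(1) in simp_all)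
  moreover have "(\<Oplus>x\<in>Pair 0 ` G. F x) = (\<Oplus>\<sigma>\<in>G. F (0, \<sigma>))"
    by (rule L.add.finprod_reindex) (use F in \<open>auto simp: inj_on_def\<close>)
  moreover have "(\<Oplus>x\<in>Pair 1 ` G. F x) = (\<Oplus>\<sigma>\<in>G. F (1, \<sigma>))"
    by (rule L.add.finprod_reindex) (use F in \<open>auto simp: inj_on_def\<close>)
  ultimately show ?thesis by (simp only:)
qed

lemma finsum_delta:
  assumes "finite G" "\<sigma> \<in> G" "\<tau> \<in> G"
  shows "(\<Oplus>\<rho>\<in>G. (if \<rho> = \<sigma> then \<one> else \<zero>) \<otimes> (if \<rho> = \<tau> then \<one> else \<zero>)) =
    (if \<sigma> = \<tau> then \<one> else \<zero>)"
proof -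
  have "(\<Oplus>\<rho>\<in>G. (if \<rho> = \<sigma> then \<one> else \<zero>) \<otimes> (if \<rho> = \<tau> then \<one> else \<zero>)) =
      (\<Oplus>\<rho>\<in>G. if \<sigma> = \<rho> then (if \<rho> = \<tau> then \<one> else \<zero>) else \<zero>)"
    by (intro L.finsum_cong') auto
  also have "\<dots> = (if \<sigma> = \<tau> then \<one> else \<zero>)"
    using assms by (intro L.add.finprod_singleton) auto
  finally show ?thesis .
qed

text \<open>
  A member vanishes off its coset, so only one coset contributes to each relation. On the subgroup the
  relations are those of point functions, and on the other coset they are those of \<open>galois_dual_bases\<close>, in both
  orders. The action respects products because \<open>G\<close> is commutative.
\<close>

lemma coset_equivariant_functions:
  obtains z b where "equivariant_functions k L \<Gamma> coset_action (coset_family z) (coset_family b)"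
    and "\<And>i j. i \<in> carrier \<Gamma> \<Longrightarrow> j \<in> carrier \<Gamma> \<Longrightarrow>
      (\<Oplus>x\<in>carrier \<Gamma>. coset_family b i x \<otimes> coset_family z j x) =
      (if i = j then \<one> else \<zero>)"
    and "card (carrier \<Gamma>) = 2 * ext_degree k L"
proof -
  interpret CG: comm_group "Gal k L" by (rule abelian)
  interpret Gam: group \<Gamma> by (rule inversion_semidirect_group[OF abelian])
  obtain z b where fin: "finite G" and card: "card G = ext_degree k L"
    and z: "\<And>\<rho>. \<rho> \<in> G \<Longrightarrow> z \<rho> \<in> carrier L" and b: "\<And>\<rho>. \<rho> \<in> G \<Longrightarrow> b \<rho> \<in> carrier L"
    and d1: "\<And>\<sigma> \<tau>. \<sigma> \<in> G \<Longrightarrow> \<tau> \<in> G \<Longrightarrow>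
      (\<Oplus>\<rho>\<in>G. \<sigma> (z \<rho>) \<otimes> \<tau> (b \<rho>)) = (if \<sigma> = \<tau> then \<one> else \<zero>)"
    and d2: "\<And>\<rho> \<pi>. \<rho> \<in> G \<Longrightarrow> \<pi> \<in> G \<Longrightarrow>
      (\<Oplus>\<sigma>\<in>G. \<sigma> (b \<rho>) \<otimes> \<sigma> (z \<pi>)) = (if \<rho> = \<pi> then \<one> else \<zero>)"
    by (rule galois_dual_bases) blast
  have fam: "coset_family w i \<in> carrier \<Gamma> \<rightarrow>\<^sub>E carrier L"
    if "i \<in> carrier \<Gamma>" "\<And>\<rho>. \<rho> \<in> G \<Longrightarrow> w \<rho> \<in> carrier L" for w i
    using that by (auto simp: coset_family_def)
  have fam_eq: "coset_family w i (coset_action \<sigma> x) = \<sigma> (coset_family w i x)"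
    if "i \<in> carrier \<Gamma>" "\<And>\<rho>. \<rho> \<in> G \<Longrightarrow> w \<rho> \<in> carrier L" "\<sigma> \<in> G" "x \<in> carrier \<Gamma>" for w i \<sigma> x
    using that by (auto simp: coset_action_def)
  have zero_sum: "(\<Oplus>\<rho>\<in>G. F \<rho>) = \<zero>" if "\<And>\<rho>. \<rho> \<in> G \<Longrightarrow> F \<rho> = \<zero>" for F
    using that by (rule L.add.finprod_one_eqI)
  have D1: "(\<Oplus>i\<in>carrier \<Gamma>. coset_family z i x \<otimes> coset_family b i y) =
      (if x = y then \<one> else \<zero>)" if x: "x \<in> carrier \<Gamma>" and y: "y \<in> carrier \<Gamma>" for x y
  proof -
    have split: "(\<Oplus>i\<in>carrier \<Gamma>. coset_family z i x \<otimes> coset_family b i y) =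
        (\<Oplus>\<rho>\<in>G. coset_family z (0, \<rho>) x \<otimes> coset_family b (0, \<rho>) y) \<oplus>
        (\<Oplus>\<rho>\<in>G. coset_family z (1, \<rho>) x \<otimes> coset_family b (1, \<rho>) y)"
    proof (rule finsum_two_cosets[OF fin], rule funcsetI)
      fix i assume i: "i \<in> carrier \<Gamma>"
      show "coset_family z i x \<otimes> coset_family b i y \<in> carrier L"
        by (rule L.m_closed[OF PiE_mem[OF fam[of i z, OF i z] x] PiE_mem[OF fam[of i b, OF i b] y]])
    qed
    consider \<sigma> \<tau> where "x = (0, \<sigma>)" "y = (0, \<tau>)" "\<sigma> \<in> G" "\<tau> \<in> G"
      | \<sigma> \<tau> where "x = (0, \<sigma>)" "y = (1, \<tau>)" "\<sigma> \<in> G" "\<tau> \<in> G"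
      | \<sigma> \<tau> where "x = (1, \<sigma>)" "y = (0, \<tau>)" "\<sigma> \<in> G" "\<tau> \<in> G"
      | \<sigma> \<tau> where "x = (1, \<sigma>)" "y = (1, \<tau>)" "\<sigma> \<in> G" "\<tau> \<in> G"
      using x y by auto
    then show ?thesis
    proof cases
      case (1 \<sigma> \<tau>)
      have "(\<Oplus>\<rho>\<in>G. coset_family z (0, \<rho>) x \<otimes> coset_family b (0, \<rho>) y) =
          (\<Oplus>\<rho>\<in>G. (if \<rho> = \<sigma> then \<one> else \<zero>) \<otimes> (if \<rho> = \<tau> then \<one> else \<zero>))"
        using 1 by (intro L.finsum_cong') auto
      moreover have "(\<Oplus>\<rho>\<in>G. coset_family z (1, \<rho>) x \<otimes> coset_family b (1, \<rho>) y) = \<zero>"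
        using 1 by (intro zero_sum) simp
      ultimately show ?thesis unfolding split using 1 finsum_delta[OF fin 1(3,4)] by simp
    next
      case (4 \<sigma> \<tau>)
      have "(\<Oplus>\<rho>\<in>G. coset_family z (0, \<rho>) x \<otimes> coset_family b (0, \<rho>) y) = \<zero>"
        using 4 by (intro zero_sum) simp
      moreover have "(\<Oplus>\<rho>\<in>G. coset_family z (1, \<rho>) x \<otimes> coset_family b (1, \<rho>) y) =
          (\<Oplus>\<rho>\<in>G. \<sigma> (z \<rho>) \<otimes> \<tau> (b \<rho>))"
        using 4 z b by (intro L.finsum_cong') auto
      ultimately show ?thesis unfolding split using 4 d1[OF 4(3,4)] by simp
    next
      case (2 \<sigma> \<tau>)
      then have "(\<Oplus>\<rho>\<in>G. coset_family z (0, \<rho>) x \<otimes> coset_family b (0, \<rho>) y) = \<zero>"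
        "(\<Oplus>\<rho>\<in>G. coset_family z (1, \<rho>) x \<otimes> coset_family b (1, \<rho>) y) = \<zero>"
        using z b by (intro zero_sum; simp)+
      then show ?thesis unfolding split using 2 by simp
    next
      case (3 \<sigma> \<tau>)
      then have "(\<Oplus>\<rho>\<in>G. coset_family z (0, \<rho>) x \<otimes> coset_family b (0, \<rho>) y) = \<zero>"
        "(\<Oplus>\<rho>\<in>G. coset_family z (1, \<rho>) x \<otimes> coset_family b (1, \<rho>) y) = \<zero>"
        using z b by (intro zero_sum; simp)+
      then show ?thesis unfolding split using 3 by simp
    qed
  qed
  have D2: "(\<Oplus>x\<in>carrier \<Gamma>. coset_family b i x \<otimes> coset_family z j x) =
      (if i = j then \<one> else \<zero>)" if i: "i \<in> carrier \<Gamma>" and j: "j \<in> carrier \<Gamma>" for i j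
  proof -
    have split: "(\<Oplus>x\<in>carrier \<Gamma>. coset_family b i x \<otimes> coset_family z j x) =
        (\<Oplus>\<rho>\<in>G. coset_family b i (0, \<rho>) \<otimes> coset_family z j (0, \<rho>)) \<oplus>
        (\<Oplus>\<rho>\<in>G. coset_family b i (1, \<rho>) \<otimes> coset_family z j (1, \<rho>))"
    proof (rule finsum_two_cosets[OF fin], rule funcsetI)
      fix x assume x: "x \<in> carrier \<Gamma>"
      show "coset_family b i x \<otimes> coset_family z j x \<in> carrier L"
        by (rule L.m_closed[OF PiE_mem[OF fam[of i b, OF i b] x] PiE_mem[OF fam[of j z, OF j z] x]])
    qed
    consider \<sigma> \<tau> where "i = (0, \<sigma>)" "j = (0, \<tau>)" "\<sigma> \<in> G" "\<tau> \<in> G"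
      | \<sigma> \<tau> where "i = (0, \<sigma>)" "j = (1, \<tau>)" "\<sigma> \<in> G" "\<tau> \<in> G"
      | \<sigma> \<tau> where "i = (1, \<sigma>)" "j = (0, \<tau>)" "\<sigma> \<in> G" "\<tau> \<in> G"
      | \<sigma> \<tau> where "i = (1, \<sigma>)" "j = (1, \<tau>)" "\<sigma> \<in> G" "\<tau> \<in> G"
      using i j by auto
    then show ?thesis
    proof cases
      case (1 \<sigma> \<tau>)
      have "(\<Oplus>\<rho>\<in>G. coset_family b i (0, \<rho>) \<otimes> coset_family z j (0, \<rho>)) =
          (\<Oplus>\<rho>\<in>G. (if \<rho> = \<sigma> then \<one> else \<zero>) \<otimes> (if \<rho> = \<tau> then \<one> else \<zero>))"
        using 1 by (intro L.finsum_cong') auto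
      moreover have "(\<Oplus>\<rho>\<in>G. coset_family b i (1, \<rho>) \<otimes> coset_family z j (1, \<rho>)) = \<zero>"
        using 1 by (intro zero_sum) simp
      ultimately show ?thesis unfolding split using 1 finsum_delta[OF fin 1(3,4)] by simp
    next
      case (4 \<sigma> \<tau>)
      have "(\<Oplus>\<rho>\<in>G. coset_family b i (0, \<rho>) \<otimes> coset_family z j (0, \<rho>)) = \<zero>"
        using 4 by (intro zero_sum) simp
      moreover have "(\<Oplus>\<rho>\<in>G. coset_family b i (1, \<rho>) \<otimes> coset_family z j (1, \<rho>)) =
          (\<Oplus>\<rho>\<in>G. \<rho> (b \<sigma>) \<otimes> \<rho> (z \<tau>))"
        using 4 z b by (intro L.finsum_cong') auto
      ultimately show ?thesis unfolding split using 4 d2[OF 4(3,4)] by simp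
    next
      case (2 \<sigma> \<tau>)
      then have "(\<Oplus>\<rho>\<in>G. coset_family b i (0, \<rho>) \<otimes> coset_family z j (0, \<rho>)) = \<zero>"
        "(\<Oplus>\<rho>\<in>G. coset_family b i (1, \<rho>) \<otimes> coset_family z j (1, \<rho>)) = \<zero>"
        using z b by (intro zero_sum; simp)+
      then show ?thesis unfolding split using 2 by simp
    next
      case (3 \<sigma> \<tau>)
      then have "(\<Oplus>\<rho>\<in>G. coset_family b i (0, \<rho>) \<otimes> coset_family z j (0, \<rho>)) = \<zero>"
        "(\<Oplus>\<rho>\<in>G. coset_family b i (1, \<rho>) \<otimes> coset_family z j (1, \<rho>)) = \<zero>"
        using z b by (intro zero_sum; simp)+
      then show ?thesis unfolding split using 3 by simp
    qed
  qed
  have cancel: "inv\<^bsub>Gal k L\<^esub> \<sigma> \<otimes>\<^bsub>Gal k L\<^esub> (\<sigma> \<otimes>\<^bsub>Gal k L\<^esub> g) = g"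
    "\<sigma> \<otimes>\<^bsub>Gal k L\<^esub> (inv\<^bsub>Gal k L\<^esub> \<sigma> \<otimes>\<^bsub>Gal k L\<^esub> g) = g" if "\<sigma> \<in> G" "g \<in> G" for \<sigma> g
    using that Gal.m_assoc[of "inv\<^bsub>Gal k L\<^esub> \<sigma>" \<sigma> g, symmetric]
      Gal.m_assoc[of \<sigma> "inv\<^bsub>Gal k L\<^esub> \<sigma>" g, symmetric] by simp_all
  have bij: "bij_betw (coset_action \<sigma>) (carrier \<Gamma>) (carrier \<Gamma>)" if \<sigma>: "\<sigma> \<in> G" for \<sigma>
  proof (rule bij_betwI[where g = "coset_action (inv\<^bsub>Gal k L\<^esub> \<sigma>)"])
    show "coset_action \<sigma> \<in> carrier \<Gamma> \<rightarrow> carrier \<Gamma>"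
      "coset_action (inv\<^bsub>Gal k L\<^esub> \<sigma>) \<in> carrier \<Gamma> \<rightarrow> carrier \<Gamma>"
      using \<sigma> by (auto simp: coset_action_def)
    show "coset_action (inv\<^bsub>Gal k L\<^esub> \<sigma>) (coset_action \<sigma> x) = x" if "x \<in> carrier \<Gamma>" for x
      using that cancel(1)[OF \<sigma>] by (auto simp: coset_action_def)
    show "coset_action \<sigma> (coset_action (inv\<^bsub>Gal k L\<^esub> \<sigma>) x) = x" if "x \<in> carrier \<Gamma>" for x
      using that cancel(2)[OF \<sigma>] by (auto simp: coset_action_def)
  qed
  have mult: "coset_action \<sigma> (x \<otimes>\<^bsub>\<Gamma>\<^esub> y) = coset_action \<sigma> x \<otimes>\<^bsub>\<Gamma>\<^esub> coset_action \<sigma> y"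
    if \<sigma>: "\<sigma> \<in> G" and xy: "x \<in> carrier \<Gamma>" "y \<in> carrier \<Gamma>" for \<sigma> x y
  proof -
    have eq: "inv\<^bsub>Gal k L\<^esub> (\<sigma> \<otimes>\<^bsub>Gal k L\<^esub> g) \<otimes>\<^bsub>Gal k L\<^esub> (\<sigma> \<otimes>\<^bsub>Gal k L\<^esub> h) = inv\<^bsub>Gal k L\<^esub> g \<otimes>\<^bsub>Gal k L\<^esub> h"
      if "g \<in> G" "h \<in> G" for g h
      using \<sigma> that cancel(1) by (simp add: Gal.inv_mult_group Gal.m_assoc)
    have left: "\<sigma> \<otimes>\<^bsub>Gal k L\<^esub> (g \<otimes>\<^bsub>Gal k L\<^esub> h) = g \<otimes>\<^bsub>Gal k L\<^esub> (\<sigma> \<otimes>\<^bsub>Gal k L\<^esub> h)"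
      "\<sigma> \<otimes>\<^bsub>Gal k L\<^esub> (g \<otimes>\<^bsub>Gal k L\<^esub> h) = \<sigma> \<otimes>\<^bsub>Gal k L\<^esub> g \<otimes>\<^bsub>Gal k L\<^esub> h"
      if "g \<in> G" "h \<in> G" for g h
      using \<sigma> that by (simp_all only: CG.m_lcomm Gal.m_assoc)
    obtain a g b h where e: "x = (a, g)" "y = (b, h)" by (metis prod.exhaust)
    have gh: "a = 0 \<or> a = 1" "b = 0 \<or> b = 1" "g \<in> G" "h \<in> G" using xy by (auto simp: e)
    show ?thesis
      using gh(1,2)
    proof (elim disjE)
      assume "a = 0" "b = 0"
      then show ?thesis by (simp add: e coset_action_def)
    next
      assume "a = 0" "b = 1"
      then show ?thesis using left(1)[of "inv\<^bsub>Gal k L\<^esub> g" h] gh by (simp add: e coset_action_def)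
    next
      assume "a = 1" "b = 0"
      then show ?thesis using left(2)[OF gh(3,4)] by (simp add: e coset_action_def)
    next
      assume "a = 1" "b = 1"
      then show ?thesis using eq[OF gh(3,4)] by (simp add: e coset_action_def)
    qed
  qed
  show thesis
  proof (rule that[of z b])
    show "equivariant_functions k L \<Gamma> coset_action (coset_family z) (coset_family b)"
    proof unfold_locales
      show "finite (carrier \<Gamma>)" using fin by simp
      show "\<And>i. i \<in> carrier \<Gamma> \<Longrightarrow> coset_family z i \<in> carrier \<Gamma> \<rightarrow>\<^sub>E carrier L"
        by (rule fam[of _ z]) (use z in simp_all)
      show "\<And>i. i \<in> carrier \<Gamma> \<Longrightarrow> coset_family b i \<in> carrier \<Gamma> \<rightarrow>\<^sub>E carrier L"
        by (rule fam[of _ b]) (use b in auto)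
      show "\<And>i \<sigma> x. i \<in> carrier \<Gamma> \<Longrightarrow> \<sigma> \<in> G \<Longrightarrow> x \<in> carrier \<Gamma> \<Longrightarrow>
          coset_family z i (coset_action \<sigma> x) = \<sigma> (coset_family z i x)"
        by (rule fam_eq[of _ z]) (use z in auto)
      show "\<And>i \<sigma> x. i \<in> carrier \<Gamma> \<Longrightarrow> \<sigma> \<in> G \<Longrightarrow> x \<in> carrier \<Gamma> \<Longrightarrow>
          coset_family b i (coset_action \<sigma> x) = \<sigma> (coset_family b i x)"
        by (rule fam_eq[of _ b]) (use b in auto)
    qed (fact bij mult D1)+
    show "card (carrier \<Gamma>) = 2 * ext_degree k L" by (simp add: card_cartesian_product card)
  qed (rule D2)
qed

text \<open>The equivariant functions on the nontrivial coset form a copy of \<open>L\<close>.\<close>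

definition coset_embedding :: "'a \<Rightarrow> int \<times> ('a \<Rightarrow> 'a) \<Rightarrow> 'a" where
  "coset_embedding l = (\<lambda>x\<in>carrier \<Gamma>. if fst x = 0 then \<zero> else snd x l)"

lemma coset_embedding_simps [simp]:
  assumes "\<sigma> \<in> G"
  shows "coset_embedding l (0, \<sigma>) = \<zero>" "coset_embedding l (1, \<sigma>) = \<sigma> l"
  using assms by (simp_all add: coset_embedding_def)

lemma point_fun_simps [simp]:
  assumes "\<sigma> \<in> G" "\<tau> \<in> G"
  shows "point_fun \<Gamma> L (0, \<sigma>) (0, \<tau>) = (if \<tau> = \<sigma> then \<one> else \<zero>)"
    "point_fun \<Gamma> L (0, \<sigma>) (1, \<tau>) = \<zero>"
  using assms by (simp_all add: point_fun_def)

context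
  fixes h c
  assumes fam: "equivariant_functions k L \<Gamma> coset_action h c"
begin

interpretation EQ: equivariant_functions k L \<Gamma> coset_action h c by (rule fam)

lemma embedding_equivariant: "l \<in> carrier L \<Longrightarrow> coset_embedding l \<in> EQ.equivariant"
  unfolding coset_embedding_def by (rule EQ.equivariantI) (auto simp: coset_action_def)

lemma point_equivariant: "\<sigma> \<in> G \<Longrightarrow> point_fun \<Gamma> L (0, \<sigma>) \<in> EQ.equivariant"
  unfolding point_fun_def by (rule EQ.equivariantI) (auto simp: coset_action_def)

lemma equivariant_trivial_coset:
  assumes "f \<in> EQ.equivariant" "\<sigma> \<in> G"
  shows "f (0, \<sigma>) \<in> carrier k"
proof (rule fixed_in_k)
  show "f (0, \<sigma>) \<in> carrier L" using EQ.equivariantD(1)[OF assms(1)] assms(2) by simp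
  show "\<tau> (f (0, \<sigma>)) = f (0, \<sigma>)" if "\<tau> \<in> G" for \<tau>
    using EQ.equivariantD(2)[OF assms(1) that, of "(0, \<sigma>)"] assms(2) by (simp add: coset_action_def)
qed

lemma equivariant_nontrivial_coset:
  assumes "f \<in> EQ.equivariant" "\<sigma> \<in> G"
  shows "f (1, \<sigma>) = \<sigma> (f (1, \<one>\<^bsub>Gal k L\<^esub>))"
  using EQ.equivariantD(2)[OF assms, of "(1, \<one>\<^bsub>Gal k L\<^esub>)"] assms(2) by (simp add: coset_action_def)

text \<open>
  The algebra is \<open>k\<^sup>G \<times> L\<close>. Its primitive idempotents are the point functions of the subgroup and the
  indicator function of the other coset. On the factors belonging to them nonzero elements are
  inverted by scalars from \<open>k\<close> and by functions coming from \<open>L\<close> respectively.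
\<close>

lemma equivariant_semisimple: "semisimple_ring EQ.equivariant_hopf"
proof -
  let ?A = "EQ.equivariant_hopf"
  let ?p = "\<lambda>\<sigma>. point_fun \<Gamma> L (0, \<sigma>)" and ?u = "coset_embedding \<one>"
  let ?E = "insert ?u (?p ` G)"
  note A_def = EQ.equivariant_hopf_sel(1)
  note [simp del] = EQ.equivariant_hopf_sel
  interpret A: cring ?A by (rule EQ.EH.H_cring)
  have finG: "finite G" using EQ.fin by (auto simp: finite_cartesian_product_iff)
  have pA: "?p \<sigma> \<in> carrier ?A" if "\<sigma> \<in> G" for \<sigma> using point_equivariant[OF that] by (simp add: A_def)
  have uA: "?u \<in> carrier ?A" using embedding_equivariant by (simp add: A_def)
  have eqI: "f = g" if "f \<in> carrier ?A" "g \<in> carrier ?A"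
      "\<And>\<sigma>. \<sigma> \<in> G \<Longrightarrow> f (0, \<sigma>) = g (0, \<sigma>)" "\<And>\<sigma>. \<sigma> \<in> G \<Longrightarrow> f (1, \<sigma>) = g (1, \<sigma>)" for f g
    using that by (intro EQ.EH.fun_eqI) auto
  have inj: "inj_on ?p G"
  proof (rule inj_onI)
    fix \<sigma> \<tau> assume *: "\<sigma> \<in> G" "\<tau> \<in> G" "?p \<sigma> = ?p \<tau>"
    show "\<sigma> = \<tau>" using fun_cong[OF *(3), of "(0, \<sigma>)"] *(1,2) by (simp split: if_splits)
  qed
  have unp: "?u \<noteq> ?p \<sigma>" if "\<sigma> \<in> G" for \<sigma>
    using that by (auto dest: fun_cong[of _ _ "(0, \<sigma>)"])
  have val: "f (a, \<sigma>) \<in> carrier L" if "f \<in> carrier ?A" "\<sigma> \<in> G" "a = 0 \<or> a = 1" for f a \<sigma>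
    using EQ.EH.val[OF that(1), of "(a, \<sigma>)"] that(2,3) by auto
  show ?thesis
  proof (rule semisimple_ring_orthogonal_idempotents[of ?A ?E])
    show "cring ?A" by (rule A.cring_axioms)
    show "finite ?E" using finG by simp
    show "?E \<subseteq> carrier ?A" using pA uA by auto
    show "e \<otimes>\<^bsub>?A\<^esub> e' = (if e = e' then e else \<zero>\<^bsub>?A\<^esub>)" if eE: "e \<in> ?E" "e' \<in> ?E" for e e'
    proof -
      have pp: "?p \<sigma> \<otimes>\<^bsub>?A\<^esub> ?p \<tau> = (if \<sigma> = \<tau> then ?p \<sigma> else \<zero>\<^bsub>?A\<^esub>)" if "\<sigma> \<in> G" "\<tau> \<in> G" for \<sigma> \<tau>
        by (rule eqI) (use that pA in auto)
      have up: "?u \<otimes>\<^bsub>?A\<^esub> ?p \<sigma> = \<zero>\<^bsub>?A\<^esub>" "?p \<sigma> \<otimes>\<^bsub>?A\<^esub> ?u = \<zero>\<^bsub>?A\<^esub>" if "\<sigma> \<in> G" for \<sigma>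
        by (rule eqI; use that pA uA in auto)+
      have uu: "?u \<otimes>\<^bsub>?A\<^esub> ?u = ?u" by (rule eqI) (use uA in auto)
      have eq: "?p \<sigma> = ?p \<tau> \<longleftrightarrow> \<sigma> = \<tau>" if "\<sigma> \<in> G" "\<tau> \<in> G" for \<sigma> \<tau>
        using inj that by (auto dest: inj_onD)
      consider "e = ?u" "e' = ?u" | \<sigma> where "e = ?u" "e' = ?p \<sigma>" "\<sigma> \<in> G"
        | \<sigma> where "e = ?p \<sigma>" "e' = ?u" "\<sigma> \<in> G"
        | \<sigma> \<tau> where "e = ?p \<sigma>" "e' = ?p \<tau>" "\<sigma> \<in> G" "\<tau> \<in> G"
        using eE by blast
      then show ?thesis
      proof cases
        case 1
        then show ?thesis using uu by simp
      next
        case (2 \<sigma>)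
        then show ?thesis using up(1)[OF 2(3)] unp[OF 2(3)] by simp
      next
        case (3 \<sigma>)
        then show ?thesis using up(2)[OF 3(3)] unp[OF 3(3)] by simp
      next
        case (4 \<sigma> \<tau>)
        show ?thesis unfolding 4(1,2) pp[OF 4(3,4)] eq[OF 4(3,4)] by (rule refl)
      qed
    qed
    show "(\<Oplus>\<^bsub>?A\<^esub>e\<in>?E. e) = \<one>\<^bsub>?A\<^esub>"
    proof -
      let ?s = "\<Oplus>\<^bsub>?A\<^esub>\<sigma>\<in>G. ?p \<sigma>"
      have sA: "?s \<in> carrier ?A" using pA by (intro A.finsum_closed) auto
      have "(\<Oplus>\<^bsub>?A\<^esub>e\<in>?E. e) = ?u \<oplus>\<^bsub>?A\<^esub> (\<Oplus>\<^bsub>?A\<^esub>e\<in>?p ` G. e)"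
        using finG pA uA unp by (intro A.finsum_insert) auto
      also have "(\<Oplus>\<^bsub>?A\<^esub>e\<in>?p ` G. e) = ?s"
        using pA by (intro A.add.finprod_reindex[OF _ inj]) auto
      also have "?u \<oplus>\<^bsub>?A\<^esub> ?s = \<one>\<^bsub>?A\<^esub>"
      proof (rule eqI)
        have s: "?s x = (\<Oplus>\<sigma>\<in>G. ?p \<sigma> x)" if "x \<in> carrier \<Gamma>" for x
          using module_hom_finsum[OF EQ.EH.H_module L_module EQ.EH.eval_hom[OF that], of ?p G] pA by simp
        fix \<tau> assume \<tau>: "\<tau> \<in> G"
        have "?s (0, \<tau>) = (\<Oplus>\<sigma>\<in>G. if \<tau> = \<sigma> then \<one> else \<zero>)"
          using \<tau> by (subst s) (auto intro!: L.finsum_cong')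
        also have "\<dots> = \<one>" using \<tau> finG by (intro L.add.finprod_singleton) auto
        finally show "(?u \<oplus>\<^bsub>?A\<^esub> ?s) (0, \<tau>) = \<one>\<^bsub>?A\<^esub> (0, \<tau>)" using \<tau> by simp
        have "?s (1, \<tau>) = \<zero>"
          using \<tau> by (subst s) (auto intro!: L.add.finprod_one_eqI)
        then show "(?u \<oplus>\<^bsub>?A\<^esub> ?s) (1, \<tau>) = \<one>\<^bsub>?A\<^esub> (1, \<tau>)" using \<tau> by simp
      qed (use uA sA in auto)
      finally show ?thesis .
    qed
    show "\<zero>\<^bsub>?A\<^esub> \<notin> ?E"
    proof
      assume "\<zero>\<^bsub>?A\<^esub> \<in> ?E"
      then consider "\<zero>\<^bsub>?A\<^esub> = ?u" | \<sigma> where "\<sigma> \<in> G" "\<zero>\<^bsub>?A\<^esub> = ?p \<sigma>" by blast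
      then show False
      proof cases
        case 1
        show False using fun_cong[OF 1, of "(1, \<one>\<^bsub>Gal k L\<^esub>)"] by simp
      next
        case (2 \<sigma>)
        show False using fun_cong[OF 2(2), of "(0, \<sigma>)"] 2(1) by simp
      qed
    qed
    fix e x assume e: "e \<in> ?E" and x: "x \<in> carrier ?A" and nz: "e \<otimes>\<^bsub>?A\<^esub> x \<noteq> \<zero>\<^bsub>?A\<^esub>"
    consider \<sigma> where "\<sigma> \<in> G" "e = ?p \<sigma>" | "e = ?u" using e by blast
    then show "\<exists>y\<in>carrier ?A. y \<otimes>\<^bsub>?A\<^esub> (e \<otimes>\<^bsub>?A\<^esub> x) = e"
    proof cases
      case (1 \<sigma>)
      define r where "r = x (0, \<sigma>)"
      have rk: "r \<in> carrier k"
        using equivariant_trivial_coset[of x \<sigma>] x 1(1) by (simp add: r_def A_def)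
      have "r \<noteq> \<zero>"
      proof
        assume r0: "r = \<zero>"
        have "e \<otimes>\<^bsub>?A\<^esub> x = \<zero>\<^bsub>?A\<^esub>"
          by (rule eqI) (use 1 x pA val[OF x] r0 in \<open>auto simp: r_def\<close>)
        then show False using nz by simp
      qed
      then have "r \<in> Units k" using rk by (simp add: k.field_Units)
      then have inv: "inv\<^bsub>k\<^esub> r \<in> carrier k" "inv\<^bsub>k\<^esub> r \<otimes> r = \<one>"
        using k.Units_inv_closed[of r] k.Units_l_inv[of r] by simp_all
      let ?y = "inv\<^bsub>k\<^esub> r \<odot>\<^bsub>?A\<^esub> \<one>\<^bsub>?A\<^esub>"
      have y: "?y \<in> carrier ?A" using inv by simp
      have "?y \<otimes>\<^bsub>?A\<^esub> (e \<otimes>\<^bsub>?A\<^esub> x) = e"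
        by (rule eqI) (use 1 x y pA val[OF x] inv k_in_L[OF inv(1)] in \<open>auto simp: r_def\<close>)
      then show ?thesis using y by blast
    next
      case 2
      define l where "l = x (1, \<one>\<^bsub>Gal k L\<^esub>)"
      have lL: "l \<in> carrier L" using val[OF x] by (simp add: l_def)
      have xl: "x (1, \<sigma>) = \<sigma> l" if "\<sigma> \<in> G" for \<sigma>
        using equivariant_nontrivial_coset[of x \<sigma>] x that by (simp add: l_def A_def)
      have "l \<noteq> \<zero>"
      proof
        assume l0: "l = \<zero>"
        have "e \<otimes>\<^bsub>?A\<^esub> x = \<zero>\<^bsub>?A\<^esub>"
          by (rule eqI) (use 2 x uA val[OF x] xl l0 in auto)
        then show False using nz by simp
      qed
      then have "l \<in> Units L" using lL by (simp add: L.field_Units)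
      then have inv: "inv l \<in> carrier L" "inv l \<otimes> l = \<one>"
        using L.Units_inv_closed[of l] L.Units_l_inv[of l] by simp_all
      let ?y = "coset_embedding (inv l)"
      have y: "?y \<in> carrier ?A" using embedding_equivariant[OF inv(1)] by (simp add: A_def)
      have mult: "\<sigma> (inv l) \<otimes> \<sigma> l = \<one>" if "\<sigma> \<in> G" for \<sigma>
        using gal_simps(3)[OF that inv(1) lL] inv(2) that by simp
      have "?y \<otimes>\<^bsub>?A\<^esub> (e \<otimes>\<^bsub>?A\<^esub> x) = e"
        by (rule eqI) (use 2 x y uA val[OF x] xl mult lL in auto)
      then show ?thesis using y by blast
    qed
  qed
qed

lemma equivariant_onto_L:
  "(\<lambda>f. f (1, \<one>\<^bsub>Gal k L\<^esub>)) \<in> algebra_hom k EQ.equivariant_hopf (self_algebra L)"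
  "(\<lambda>f. f (1, \<one>\<^bsub>Gal k L\<^esub>)) ` carrier EQ.equivariant_hopf = carrier L"
proof -
  let ?\<phi> = "\<lambda>f :: int \<times> ('a \<Rightarrow> 'a) \<Rightarrow> 'a. f (1, \<one>\<^bsub>Gal k L\<^esub>)"
  note [simp del] = EQ.equivariant_hopf_sel
  have x: "(1, \<one>\<^bsub>Gal k L\<^esub>) \<in> carrier \<Gamma>" by simp
  note ev = EQ.EH.eval_ops[OF x] EQ.EH.val[OF _ x]
  show "?\<phi> \<in> algebra_hom k EQ.equivariant_hopf (self_algebra L)"
    unfolding algebra_hom_def
    by (intro IntI ring_hom_memI module_homI) (simp_all add: ev del: \<Gamma>_simps)
  show "?\<phi> ` carrier EQ.equivariant_hopf = carrier L"
  proof (intro equalityI subsetI)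
    fix l assume l: "l \<in> carrier L"
    have "?\<phi> (coset_embedding l) = l" using l by simp
    moreover have "coset_embedding l \<in> carrier EQ.equivariant_hopf"
      using embedding_equivariant[OF l] by (simp add: EQ.equivariant_hopf_sel)
    ultimately show "l \<in> ?\<phi> ` carrier EQ.equivariant_hopf" by (metis imageI)
  qed (auto simp: ev simp del: \<Gamma>_simps)
qed

end

end

theorem theorem1p4:
  fixes k L :: "'a ring"
  assumes galois: "finite_galois_extension k L"
    and abelian: "comm_group (Gal k L)"
  shows "\<exists>H :: ('a, int \<times> ('a \<Rightarrow> 'a) \<Rightarrow> 'a) hopf.
    hopf_algebra k H \<and> cring H \<and> semisimple_ring H \<and>
    vectorspace.fin_dim k H \<and> vectorspace.dim k H = 2 * ext_degree k L \<and>
    (\<exists>\<phi>\<in>algebra_hom k H (self_algebra L). \<phi> ` carrier H = carrier L) \<and>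
    hopf_isomorphic L (base_change k L H)
      (base_change k L (fun_hopf (inversion_semidirect (Gal k L)) k)) \<and>
    hopf_isomorphic L (base_change k L (fun_hopf (inversion_semidirect (Gal k L)) k))
      (fun_hopf (inversion_semidirect (Gal k L)) L) \<and>
    is_form_of k H (fun_hopf (inversion_semidirect (Gal k L)) k)"
proof -
  let ?\<Gamma> = "inversion_semidirect (Gal k L)"
  have ext: "field_extension k L"
    using galois by (simp add: finite_galois_extension_def finite_extension_def)
  interpret galois_extension k L by
    (intro galois_extension.intro galois_extension_axioms.intro extension.intro ext galois
      comm_group.axioms(2)[OF abelian])
  interpret abelian_galois_extension k L
    by (intro abelian_galois_extension.intro abelian_galois_extension_axioms.intro
        galois_extension_axioms abelian)
  obtain z b where fam: "equivariant_functions k L ?\<Gamma> coset_action (coset_family z) (coset_family b)"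
    and dual: "\<And>i j. i \<in> carrier ?\<Gamma> \<Longrightarrow> j \<in> carrier ?\<Gamma> \<Longrightarrow>
      (\<Oplus>\<^bsub>L\<^esub>x\<in>carrier ?\<Gamma>. coset_family b i x \<otimes>\<^bsub>L\<^esub> coset_family z j x) =
      (if i = j then \<one>\<^bsub>L\<^esub> else \<zero>\<^bsub>L\<^esub>)"
    and card: "card (carrier ?\<Gamma>) = 2 * ext_degree k L"
    by (rule coset_equivariant_functions) blast
  interpret EQ: equivariant_functions k L ?\<Gamma> coset_action "coset_family z" "coset_family b"
    by (rule fam)
  have const: "function_form k L ?\<Gamma> (fun_hopf ?\<Gamma> k) (point_fun ?\<Gamma> k) (point_fun ?\<Gamma> k)"
    by (rule fun_hopf_form[OF extension_axioms EQ.Gam.group_axioms EQ.fin])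
  have iso: "hopf_isomorphic L (base_change k L EQ.equivariant_hopf) (base_change k L (fun_hopf ?\<Gamma> k))"
    by (rule EQ.EH.base_change_isomorphic[OF const])
  show ?thesis
  proof (intro exI[of _ EQ.equivariant_hopf] conjI)
    show "hopf_algebra k EQ.equivariant_hopf" by (rule EQ.EH.hopf_algebra)
    show "cring EQ.equivariant_hopf" by (rule EQ.EH.H_cring)
    show "semisimple_ring EQ.equivariant_hopf" by (rule equivariant_semisimple[OF fam])
    show "vectorspace.fin_dim k EQ.equivariant_hopf" by (rule EQ.equivariant_dim(1)[OF dual])
    show "vectorspace.dim k EQ.equivariant_hopf = 2 * ext_degree k L"
      using EQ.equivariant_dim(2)[OF dual] card by simp
    show "\<exists>\<phi>\<in>algebra_hom k EQ.equivariant_hopf (self_algebra L).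
        \<phi> ` carrier EQ.equivariant_hopf = carrier L"
      using equivariant_onto_L[OF fam] by blast
    show "hopf_isomorphic L (base_change k L EQ.equivariant_hopf) (base_change k L (fun_hopf ?\<Gamma> k))"
      by (rule iso)
    show "hopf_isomorphic L (base_change k L (fun_hopf ?\<Gamma> k)) (fun_hopf ?\<Gamma> L)"
      by (rule function_form.base_change_split[OF const])
    show "is_form_of k EQ.equivariant_hopf (fun_hopf ?\<Gamma> k)"
      unfolding is_form_of_def using ext iso by blast
  qed
qed

end
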